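(* Let $n\ge 1$, let $p_1,\dots,p_n\in\mathbb{C}[Z_1^{\pm1},\dots,Z_n^{\pm1}]$ be Laurent polynomials, write $p(Z)=(p_1(Z),\dots,p_n(Z))$, and consider the system of ordinary differential equations $$\dot z_i=z_i\,p_i(z),\qquad z_i(0)=c_i,\qquad 1\le i\le n. \qquad ( * )$$ (Necessity.) Suppose that for all $c=(c_1,\dots,c_n)$ in some nonempty open subset of $\mathbb{C}^n$ all components $z_1,\dots,z_n$ of the solution of $( * )$ are units. Then $p$ is of the following form: $$p(Z)=\sum_{k=1}^{n-1}u_k\,\theta_k\big(M^{(k)}\big)+u_0, \qquad ( ** )$$ where $u_0,\dots,u_{n-1}\in\mathbb{C}^n$ are vectors; each $\theta_k$ ($1\le k\le n-1$) is a (scalar-valued) Laurent polynomial in $k$ variables; $M^{(k)}=(M^{(k)}_1,\dots,M^{(k)}_k)\in\mathbb{C}[Z,Z^{-1}]^k$ is defined by $M^{(n)}=Z=(Z_1,\dots,Z_n)$ and $$M^{(k-1)}_i=\prod_{j=1}^{k}\big(M^{(k)}_j\big)^{a^{(k)}_{ij}},\qquad 1\le i\le k-1,\quad k=n,n-1,\dots,2,$$ for some $(k-1)\times k$ matrices $a^{(k)}=(a^{(k)}_{ij})$ with integer entries ($2\le k\le n$); and $$a^{(k+1)}a^{(k+2)}\cdots a^{(n)}u_k=0\qquad\text{for } 1\le k\le n-1.$$ (Converse.) Conversely, if $p$ is of the form $( ** )$ with $u_k,\theta_k,M^{(k)},a^{(k)}$ as just described, then the system $( * )$ has only entire solutions,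 and every component of every solution is either a unit or identically zero.
   Context: A unit is an entire holomorphic function $\mathbb{C}\to\mathbb{C}$ without zeros. The time variable $t$ is complex and $\dot z_i=dz_i/dt$. A solution is called entire if all its components extend to entire functions of $t\in\mathbb{C}$. Initial values $c\in\mathbb{C}^n$ are taken among those at which the Laurent polynomials $p_i$ are defined. $\mathbb{C}[Z,Z^{-1}]$ denotes $\mathbb{C}[Z_1^{\pm1},\dots,Z_n^{\pm1}]$. For $n=1$ the sum in $( ** )$ is empty. *)

theory Defs
  imports
    "HOL-Complex_Analysis.Complex_Analysis"
    "HOL-Library.Poly_Mapping"
    "Jordan_Normal_Form.Matrix"
begin

(* C[Z_0^{+-1}, Z_1^{+-1}, ...] as the group ring over C of the free abelian group of
   finitely supported integer exponent vectors. Variables are indexed from 0, so that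
   Z_0, ..., Z_{n-1} here play the role of Z_1, ..., Z_n. *)
type_synonym laurent = "(nat \<Rightarrow>\<^sub>0 int) \<Rightarrow>\<^sub>0 complex"

definition laurent_polys :: "nat \<Rightarrow> laurent set" where
  "laurent_polys n = {P. \<forall>m\<in>Poly_Mapping.keys P. Poly_Mapping.keys m \<subseteq> {..<n}}"

definition laurent_const :: "complex \<Rightarrow> laurent" where
  "laurent_const x = Poly_Mapping.single 0 x"

definition laurent_var :: "nat \<Rightarrow> laurent" where
  "laurent_var i = Poly_Mapping.single (Poly_Mapping.single i 1) 1"

definition laurent_defined :: "laurent \<Rightarrow> (nat \<Rightarrow> complex) \<Rightarrow> bool" where
  "laurent_defined P x \<longleftrightarrow>
     (\<forall>m\<in>Poly_Mapping.keys P. \<forall>i\<in>Poly_Mapping.keys m. Poly_Mapping.lookup m i < 0 \<longrightarrow> x i \<noteq> 0)"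

(* Meaningful only where laurent_defined holds, since 0 powi e = 0 for e < 0. *)
definition laurent_eval :: "laurent \<Rightarrow> (nat \<Rightarrow> complex) \<Rightarrow> complex" where
  "laurent_eval P x =
     (\<Sum>m\<in>Poly_Mapping.keys P. Poly_Mapping.lookup P m *
        (\<Prod>i\<in>Poly_Mapping.keys m. x i powi Poly_Mapping.lookup m i))"

(* Integer powers of an invertible ring element. The library operator powi is not available
   on Laurent polynomials, which do not form a division ring. For e < 0 and x not invertible
   the value is unspecified; below x is always a Laurent monomial. *)
definition unit_powi :: "'a::comm_ring_1 \<Rightarrow> int \<Rightarrow> 'a" where
  "unit_powi x e = (if 0 \<le> e then x ^ nat e else (THE y. x * y = 1) ^ nat (- e))"

definition laurent_subst :: "laurent \<Rightarrow> (nat \<Rightarrow> laurent) \<Rightarrow> laurent" where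
  "laurent_subst P M =
     (\<Sum>m\<in>Poly_Mapping.keys P. laurent_const (Poly_Mapping.lookup P m) *
        (\<Prod>i\<in>Poly_Mapping.keys m. unit_powi (M i) (Poly_Mapping.lookup m i)))"

(* The matrix product a (k+1) * a (k+2) * ... * a n, where a n has n columns. *)
definition mat_chain :: "(nat \<Rightarrow> int mat) \<Rightarrow> nat \<Rightarrow> nat \<Rightarrow> int mat" where
  "mat_chain a k n = foldr (*) (map a [k+1..<n+1]) (1\<^sub>m n)"

definition triangular_form :: "nat \<Rightarrow> (nat \<Rightarrow> laurent) \<Rightarrow> bool" where
  "triangular_form n p \<longleftrightarrow>
     (\<exists>(u :: nat \<Rightarrow> complex Matrix.vec) (\<theta> :: nat \<Rightarrow> laurent)
       (M :: nat \<Rightarrow> nat \<Rightarrow> laurent) (a :: nat \<Rightarrow> int mat).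
        (\<forall>k\<in>{0..n-1}. u k \<in> carrier_vec n) \<and>
        (\<forall>k\<in>{1..n-1}. \<theta> k \<in> laurent_polys k) \<and>
        (\<forall>k\<in>{2..n}. a k \<in> carrier_mat (k-1) k) \<and>
        (\<forall>i<n. M n i = laurent_var i) \<and>
        (\<forall>k\<in>{2..n}. \<forall>i<k-1. M (k-1) i = (\<Prod>j<k. unit_powi (M k j) (a k $$ (i, j)))) \<and>
        (\<forall>k\<in>{1..n-1}. map_mat of_int (mat_chain a k n) *\<^sub>v u k = 0\<^sub>v k) \<and>
        (\<forall>i<n. p i =
           (\<Sum>k=1..n-1. laurent_const (vec_index (u k) i) * laurent_subst (\<theta> k) (M k))
           + laurent_const (vec_index (u 0) i)))"

definition admissible :: "nat \<Rightarrow> (nat \<Rightarrow> laurent) \<Rightarrow> (nat \<Rightarrow> complex) \<Rightarrow> bool" where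
  "admissible n p x \<longleftrightarrow> (\<forall>i<n. laurent_defined (p i) x)"

(* z solves z_i' = z_i p_i(z), z_i(0) = c_i (i < n) on the complex domain V around 0. *)
definition solves_on ::
    "nat \<Rightarrow> (nat \<Rightarrow> laurent) \<Rightarrow> (nat \<Rightarrow> complex) \<Rightarrow> complex set \<Rightarrow> (nat \<Rightarrow> complex \<Rightarrow> complex) \<Rightarrow> bool"
  where
  "solves_on n p c V z \<longleftrightarrow>
     open V \<and> connected V \<and> 0 \<in> V \<and>
     (\<forall>i<n. z i 0 = c i) \<and>
     (\<forall>t\<in>V. admissible n p (\<lambda>j. z j t) \<and>
       (\<forall>i<n. (z i has_field_derivative z i t * laurent_eval (p i) (\<lambda>j. z j t)) (at t)))"

definition entire_extension :: "complex set \<Rightarrow> (complex \<Rightarrow> complex) \<Rightarrow> (complex \<Rightarrow> complex) \<Rightarrow> bool" where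
  "entire_extension V g f \<longleftrightarrow> f holomorphic_on UNIV \<and> (\<forall>t\<in>V. f t = g t)"

definition unit_function :: "(complex \<Rightarrow> complex) \<Rightarrow> bool" where
  "unit_function f \<longleftrightarrow> f holomorphic_on UNIV \<and> (\<forall>t. f t \<noteq> 0)"

end

theory Submission
  imports Defs "HOL-Real_Asymp.Real_Asymp"
begin

text \<open>
  Necessity. Write $z_i = \exp g_i$ with entire $g_i$. For an exponent vector $m$ of $p$ the function
  $e_m = m \cdot g$ satisfies $e_m' = \sum_{m'} (m \cdot p_{m'}) \exp(e_{m'})$, where $p_{m'}$ is the
  coefficient vector of $Z^{m'}$. Borel--Caratheodory bounds the left-hand sides by the real parts of
  the $e_m$ themselves, so all of them, with their derivatives, are only logarithmically large compared
  with the exponentials. For an initial value at which no nonempty partial sum of a right-hand side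
  vanishes, a Borel-type argument (elimination of exponentials, and division by removing zeros with
  Blaschke factors) shows that every $\exp(e_{m'})$ occurring in one of these sums is then small as well.
  If every $m'$ occurred, the $e_m$ would be constant, contradicting genericity. Hence some
  $p_{m'} \neq 0$ is orthogonal to all exponents of $p$. Therefore the exponents lie in the kernel of a
  nonzero integer vector, a unimodular monomial change of variables leads to a system in $n - 1$
  variables, and induction gives the flag of lattices in the triangular form.

  Converse. An exponent $m$ belongs to a first lattice of the flag, and $m \cdot p_{m'} = 0$ unless the
  level of $m'$ is lower than that of $m$. So the monomials $z^m$ solve linear equations that can be
  integrated level by level.
\<close>

subsection \<open>Zero removal and Borel--Caratheodory\<close>

text \<open>The obstacle is circularity: the \<open>e_m\<close> are compared with the very
  exponentials that drive them. Their growth is measured by \<open>A r\<close>, the maximum over a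
  disc of the sum of the positive parts of \<open>Re e_m\<close>. Derivatives and divisions each
  cost a shrinking of the disc. Instead of exceptional sets of radii, \<open>small\<close> keeps the
  gap \<open>d\<close> as a free parameter and pays a factor \<open>(r / d) ^ k\<close> in the
  exponent; \<open>d\<close> is chosen only at the end. Once all exponentials are small,
  \<open>A r\<close> is at most \<open>C * (r / d) ^ k\<close> times the logarithms of
  \<open>r + d\<close> and \<open>A (r + d)\<close>. A gap that is a negative power of
  \<open>A r\<close>, at a radius where \<open>A\<close> does not double, yields a polynomial bound;
  then \<open>d = r\<close> yields a logarithmic one at arbitrarily large radii, enough for
  Liouville's argument. Genericity enters because a sum of exponentials that cancels identically
  says nothing about its terms. The orthogonal vector obtained is complex and must be made integral,
  since only an integral direction can be split off by a monomial change of variables.\<close>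

lemma Borel_Caratheodory:
  fixes w :: "complex \<Rightarrow> complex"
  assumes hol: "w holomorphic_on ball 0 R" and R: "0 < R"
    and le: "\<And>t. norm t < R \<Longrightarrow> Re (w t) \<le> B"
    and t: "norm t \<le> r" and r: "0 \<le> r" "r < R"
  shows "norm (w t - w 0) \<le> 2 * r / (R - r) * (B - Re (w 0))"
proof -
  let ?K = "\<lambda>e. B + e - Re (w 0)"
  \<comment> \<open>The slack \<open>e\<close> keeps \<open>?K e\<close> positive also when
    \<open>Re (w 0) = B\<close>; it tends to 0 at the end.\<close>
  have main: "norm (w t - w 0) \<le> 2 * r / (R - r) * ?K e" if e: "e > 0" for e
  proof -
    have K: "?K e > 0" using le[of 0] R e by simp
    \<comment> \<open>The Moebius map sending \<open>x\<close> to \<open>x / (2 * K - x)\<close>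
      takes the half plane \<open>Re x < K\<close> into the unit disc and fixes 0, so the Schwarz
      lemma applies. Solving the resulting inequality for \<open>norm x\<close> gives the
      bound.\<close>
    define \<phi> where "\<phi> s = (w (of_real R * s) - w 0) / (2 * of_real (?K e) - (w (of_real R * s) - w 0))" for s
    have in_ball: "of_real R * s \<in> ball 0 R" if "norm s < 1" for s :: complex
      using that R by (simp add: norm_mult)
    have Reg: "Re (2 * of_real (?K e) - (w (of_real R * s) - w 0)) > \<bar>Re (w (of_real R * s) - w 0)\<bar>"
      if "norm s < 1" for s :: complex
      using le[of "of_real R * s"] in_ball[OF that] K e by (auto simp: abs_if)
    have nz: "2 * of_real (?K e) - (w (of_real R * s) - w 0) \<noteq> 0" if "norm s < 1" for s :: complex
    proof
      assume "2 * of_real (?K e) - (w (of_real R * s) - w 0) = 0"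
      then have "Re (2 * of_real (?K e) - (w (of_real R * s) - w 0)) = 0" by (metis zero_complex.simps(1))
      with Reg[OF that] show False by linarith
    qed
    have "(\<lambda>s. w (of_real R * s)) holomorphic_on ball 0 1"
      using in_ball by (intro holomorphic_on_compose_gen[OF _ hol, unfolded o_def]) (auto intro!: holomorphic_intros)
    then have hol\<phi>: "\<phi> holomorphic_on ball 0 1"
      unfolding \<phi>_def using nz by (intro holomorphic_intros) auto
    have small: "norm (\<phi> s) < 1" if "norm s < 1" for s
    proof -
      let ?x = "w (of_real R * s) - w 0"
      let ?y = "2 * of_real (?K e) - ?x"
      have "\<bar>Re ?x\<bar> < \<bar>Re ?y\<bar>" using Reg[OF that] by linarith
      moreover have "Im ?y = - Im ?x" by simp
      ultimately have "norm ?x < norm ?y"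
        unfolding cmod_def
        by (metis abs_le_square_iff add_strict_right_mono linorder_not_less power2_minus real_sqrt_less_iff)
      then show ?thesis unfolding \<phi>_def using nz[OF that] by (simp add: norm_divide)
    qed
    define s where "s = t / of_real R"
    have s: "norm s \<le> r / R" "norm s < 1" and t_s: "of_real R * s = t"
      using t r R by (auto simp: s_def norm_divide divide_simps)
    have sch: "norm (\<phi> s) \<le> norm s"
      using Schwarz_Lemma(1)[OF hol\<phi> _ small s(2)] by (simp add: \<phi>_def)
    let ?x = "w t - w 0"
    have "\<phi> s * (2 * of_real (?K e) - ?x) = ?x"
      using nz[OF s(2)] by (simp add: \<phi>_def t_s)
    then have "norm ?x = norm (\<phi> s) * norm (2 * of_real (?K e) - ?x)"
      by (metis norm_mult)
    also have "\<dots> \<le> (r / R) * (2 * ?K e + norm ?x)"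
    proof (rule mult_mono)
      have "norm (2 * of_real (?K e) - ?x) \<le> norm (2 * of_real (?K e) :: complex) + norm ?x"
        by (rule norm_triangle_ineq4)
      also have "norm (2 * of_real (?K e) :: complex) = 2 * ?K e"
        by (simp only: norm_mult norm_numeral norm_of_real abs_of_pos[OF K])
      finally show "norm (2 * of_real (?K e) - ?x) \<le> 2 * ?K e + norm ?x" .
    qed (use sch s r R in auto)
    finally have "norm ?x * R \<le> r * (2 * ?K e + norm ?x)"
      using R by (simp add: field_simps)
    then have "norm ?x * (R - r) \<le> 2 * r * ?K e" by (simp add: algebra_simps)
    then show ?thesis using r by (simp add: field_simps)
  qed
  have lim: "((\<lambda>e. 2 * r / (R - r) * ?K e) \<longlongrightarrow> 2 * r / (R - r) * (B + 0 - Re (w 0))) (at_right 0)"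
    by (intro tendsto_intros)
  have ev: "\<forall>\<^sub>F e in at_right 0. norm (w t - w 0) \<le> 2 * r / (R - r) * ?K e"
    using eventually_at_right_less by (rule eventually_mono) (rule main)
  show ?thesis using tendsto_lowerbound[OF lim ev] by simp
qed

text \<open>The quotient off \<open>a\<close> and the local factor near \<open>a\<close> agree on
  the overlap and glue to an entire function. The point \<open>b\<close> excludes the zero function,
  whose zeros have no order.\<close>

lemma factor_zero_entire:
  fixes f :: "complex \<Rightarrow> complex"
  assumes hol: "f holomorphic_on UNIV" and ne: "f b \<noteq> 0"
  obtains h k where "h holomorphic_on UNIV" "h a \<noteq> 0" "\<And>z. f z = (z - a) ^ k * h z"
proof (cases "f a = 0")
  case False
  show thesis by (rule that[of f 0]) (use hol False in auto)
next
  case True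
  have "\<not> f constant_on UNIV" using True ne unfolding constant_on_def by (metis UNIV_I)
  then obtain g r k where g: "0 < r" "g holomorphic_on ball a r"
      "\<And>w. w \<in> ball a r \<Longrightarrow> f w = (w - a) ^ k * g w" "\<And>w. w \<in> ball a r \<Longrightarrow> g w \<noteq> 0" "0 < k"
    using holomorphic_factor_zero_nonconstant[OF hol open_UNIV connected_UNIV UNIV_I True] by metis
  define h where "h z = (if z = a then g a else f z / (z - a) ^ k)" for z
  have 1: "h holomorphic_on (- {a})"
    using hol by (subst holomorphic_cong[OF refl, of _ _ "\<lambda>z. f z / (z - a) ^ k"])
      (auto simp: h_def intro!: holomorphic_intros intro: holomorphic_on_subset)
  have 2: "h holomorphic_on ball a r"
    using g(2) by (rule holomorphic_transform) (use g in \<open>auto simp: h_def\<close>)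
  have "h holomorphic_on (- {a} \<union> ball a r)"
    by (rule holomorphic_on_Un[OF 1 2]) auto
  moreover have "- {a} \<union> ball a r = UNIV" using g by auto
  ultimately have "h holomorphic_on UNIV" by simp
  moreover have "h a \<noteq> 0" using g by (auto simp: h_def)
  moreover have "f z = (z - a) ^ k * h z" for z using g True by (auto simp: h_def)
  ultimately show thesis by (rule that)
qed

text \<open>Each zero $a$ is replaced by its mirror image in the circle: dividing by a Blaschke
  factor leaves the modulus on the circle unchanged and does not decrease it inside.\<close>

lemma remove_zeros_in_disc:
  fixes f :: "complex \<Rightarrow> complex"
  assumes "f holomorphic_on UNIV" and "f 0 \<noteq> 0" and R: "R > 0"
  obtains F where "F holomorphic_on UNIV" "\<And>z. norm z < R \<Longrightarrow> F z \<noteq> 0"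
    "\<And>z. norm z = R \<Longrightarrow> norm (F z) = norm (f z)" "norm (f 0) \<le> norm (F 0)"
proof -
  have "\<exists>F. F holomorphic_on UNIV \<and> (\<forall>z. norm z < R \<longrightarrow> F z \<noteq> 0) \<and>
      (\<forall>z. norm z = R \<longrightarrow> norm (F z) = norm (f z)) \<and> norm (f 0) \<le> norm (F 0)"
    using assms(1,2)
  proof (induction "card {z \<in> ball 0 R. f z = 0}" arbitrary: f rule: less_induct)
    case less
    have fin: "finite {z \<in> ball 0 R. f z = 0}"
    proof (cases "f constant_on UNIV")
      case True
      then obtain c where "\<And>z. f z = c" by (auto simp: constant_on_def)
      with less.prems(2) show ?thesis by auto
    next
      case False
      have "finite {z \<in> cball 0 R. f z = 0}"
        by (rule holomorphic_compact_finite_zeros[OF less.prems(1)]) (use False in auto)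
      then show ?thesis by (rule rev_finite_subset) auto
    qed
    show ?case
    proof (cases "\<forall>z. norm z < R \<longrightarrow> f z \<noteq> 0")
      case True
      then show ?thesis using less.prems by blast
    next
      case False
      then obtain a where a: "norm a < R" "f a = 0" by blast
      obtain h k where h: "h holomorphic_on UNIV" "h a \<noteq> 0" "\<And>z. f z = (z - a) ^ k * h z"
        using factor_zero_entire[OF less.prems] by metis
      \<comment> \<open>The factor \<open>z - a\<close> is traded for
        \<open>(R^2 - cnj a * z) / R\<close>, which has no zero in the disc. On the circle
        \<open>R^2 = z * cnj z\<close>, so the moduli agree; at 0 the trade replaces
        \<open>norm a\<close> by the larger \<open>R\<close>. Each round removes one zero with its
        full multiplicity, so distinct zeros are counted.\<close>
      define G where "G z = ((of_real (R\<^sup>2) - cnj a * z) / of_real R) ^ k * h z" for z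
      have nz: "of_real (R\<^sup>2) - cnj a * z \<noteq> 0" if "norm z < R" for z
      proof
        assume "of_real (R\<^sup>2) - cnj a * z = 0"
        then have "norm (of_real (R\<^sup>2) :: complex) = norm (cnj a * z)" by simp
        then have "R\<^sup>2 = norm a * norm z" by (simp add: norm_mult norm_power)
        moreover have "norm a * norm z \<le> norm a * R" using that by (intro mult_left_mono) auto
        moreover have "norm a * R < R * R" using a R by simp
        ultimately show False by (simp add: power2_eq_square)
      qed
      have holG: "G holomorphic_on UNIV" unfolding G_def using R
        by (intro holomorphic_intros h) auto
      have Ga: "G a \<noteq> 0" using nz[of a] a h(2) R by (simp add: G_def)
      have "{z \<in> ball 0 R. G z = 0} \<subset> {z \<in> ball 0 R. f z = 0}"
      proof
        show "{z \<in> ball 0 R. G z = 0} \<subseteq> {z \<in> ball 0 R. f z = 0}"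
        proof clarsimp
          fix z assume "norm z < R" "G z = 0"
          with nz[of z] R have "h z = 0" by (simp add: G_def)
          then show "f z = 0" by (simp only: h(3) mult_zero_right)
        qed
        show "{z \<in> ball 0 R. G z = 0} \<noteq> {z \<in> ball 0 R. f z = 0}"
          using a Ga by (metis (mono_tags, lifting) mem_Collect_eq mem_ball_0)
      qed
      then have card: "card {z \<in> ball 0 R. G z = 0} < card {z \<in> ball 0 R. f z = 0}"
        using fin by (rule psubset_card_mono[rotated])
      have a0: "norm a ^ k \<le> R ^ k" using a by (intro power_mono) auto
      have "norm (f 0) \<le> norm (G 0)"
        unfolding h(3)[of 0] using a0 R by (simp add: G_def norm_mult norm_power norm_divide power2_eq_square mult_right_mono)
      moreover have nG: "norm (G z) = norm (f z)" if z: "norm z = R" for z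
      proof -
        have "of_real (R\<^sup>2) = z * cnj z" using z complex_norm_square[of z] by simp
        then have "of_real (R\<^sup>2) - cnj a * z = z * cnj (z - a)" by (simp add: algebra_simps)
        then have "norm ((of_real (R\<^sup>2) - cnj a * z) / of_real R) = norm (z - a)"
          using z R by (simp add: norm_mult norm_divide del: of_real_power complex_cnj_diff)
        then show ?thesis by (simp only: G_def h(3)[of z] norm_mult norm_power)
      qed
      have G0: "G 0 \<noteq> 0" using \<open>norm (f 0) \<le> norm (G 0)\<close> less.prems(2) by auto
      obtain F where "F holomorphic_on UNIV" "\<forall>z. norm z < R \<longrightarrow> F z \<noteq> 0"
          "\<forall>z. norm z = R \<longrightarrow> norm (F z) = norm (G z)" "norm (G 0) \<le> norm (F 0)"
        using less.hyps[OF card holG G0] by blast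
      ultimately show ?thesis using nG by (intro exI[of _ F]) auto
    qed
  qed
  then show thesis using that by blast
qed

text \<open>Dividing by \<open>f\<close> needs a lower bound, which fails near its zeros. For
  \<open>F\<close> from zero removal, \<open>F\<close> and \<open>F * E\<close> are still bounded by
  \<open>exp B\<close> through the maximum principle, and \<open>F = exp w\<close>.
  Borel--Caratheodory for \<open>w\<close> bounds \<open>Re w\<close> from below, and
  \<open>E\<close> is the quotient of \<open>F * E\<close> by \<open>F\<close>.\<close>

lemma norm_le_of_norm_mult_le:
  fixes f E :: "complex \<Rightarrow> complex"
  assumes f: "f holomorphic_on UNIV" "f 0 \<noteq> 0" and E: "E holomorphic_on UNIV"
    and R: "0 \<le> r" "r < R"
    and fB: "\<And>z. norm z \<le> R \<Longrightarrow> norm (f z) \<le> exp B"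
    and fE: "\<And>z. norm z \<le> R \<Longrightarrow> norm (f z * E z) \<le> exp B"
    and t: "norm t \<le> r"
  shows "norm (E t) \<le> exp ((1 + 2 * r / (R - r)) * (B - ln (norm (f 0))))"
proof -
  have R0: "R > 0" using R by simp
  obtain F where F: "F holomorphic_on UNIV" "\<And>z. norm z < R \<Longrightarrow> F z \<noteq> 0"
    "\<And>z. norm z = R \<Longrightarrow> norm (F z) = norm (f z)" "norm (f 0) \<le> norm (F 0)"
    using remove_zeros_in_disc[OF f R0] by metis
  have max: "norm (G z) \<le> exp B" if "G holomorphic_on UNIV" "\<And>z. norm z = R \<Longrightarrow> norm (G z) \<le> exp B"
    "norm z \<le> R" for G z
    by (rule maximum_modulus_frontier[of G "cball 0 R"])
      (use that R0 in \<open>auto intro: holomorphic_on_subset holomorphic_on_imp_continuous_on\<close>)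
  have FB: "norm (F z) \<le> exp B" if "norm z \<le> R" for z
    by (rule max[OF F(1) _ that]) (simp add: F fB)
  have FE: "norm (F z * E z) \<le> exp B" if "norm z \<le> R" for z
  proof (rule max[OF _ _ that, of "\<lambda>z. F z * E z"])
    show "(\<lambda>z. F z * E z) holomorphic_on UNIV" by (intro holomorphic_intros F E)
  qed (use fE in \<open>simp add: F norm_mult\<close>)
  obtain w where w: "w holomorphic_on ball 0 R" "\<And>z. norm z < R \<Longrightarrow> F z = exp (w z)"
    using contractible_imp_holomorphic_log[of F "ball 0 R"] F(1,2)
      convex_imp_contractible[OF convex_ball, of "0::complex" R]
    by (metis holomorphic_on_subset mem_ball_0 subset_UNIV)
  have Rew: "Re (w z) \<le> B" if "norm z < R" for z
    using FB[of z] w(2)[OF that] that by simp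
  have "norm (w t - w 0) \<le> 2 * r / (R - r) * (B - Re (w 0))"
    by (rule Borel_Caratheodory[OF w(1) R0 Rew t R])
  then have low: "Re (w 0) - Re (w t) \<le> 2 * r / (R - r) * (B - Re (w 0))"
    using abs_Re_le_cmod[of "w t - w 0"] by simp
  have "ln (norm (f 0)) \<le> ln (norm (F 0))" by (metis F(4) f(2) ln_mono zero_less_norm_iff)
  then have w0: "ln (norm (f 0)) \<le> Re (w 0)" using w(2)[of 0] R0 by simp
  have tR: "norm t < R" using t R by simp
  have "exp (Re (w t)) * norm (E t) \<le> exp B"
    using FE[of t] w(2)[OF tR] tR by (simp add: norm_mult)
  then have "norm (E t) \<le> exp B * exp (- Re (w t))"
    by (simp add: exp_minus field_simps)
  also have "\<dots> = exp (B - Re (w t))" by (simp add: exp_diff exp_minus field_simps)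
  also have "B - Re (w t) \<le> (1 + 2 * r / (R - r)) * (B - Re (w 0))"
    using low by (simp add: algebra_simps)
  also have "\<dots> \<le> (1 + 2 * r / (R - r)) * (B - ln (norm (f 0)))"
    using w0 R by (intro mult_left_mono) auto
  finally show ?thesis by simp
qed

subsection \<open>Functions of logarithmic growth\<close>

locale growth =
  fixes A :: "real \<Rightarrow> real"
  assumes A_nonneg: "0 \<le> A r" and A_mono: "r \<le> s \<Longrightarrow> A r \<le> A s"
begin

text \<open>Evaluating at \<open>r + d\<close> leaves room for a larger disc. The constant 3 exceeds
  Euler's number, so \<open>lam\<close> is at least 1 and absorbs additive constants.\<close>

definition lam :: "real \<Rightarrow> real \<Rightarrow> real" where
  "lam r d = ln (3 + r + d) + ln (3 + A (r + d))"

text \<open>Apart from the factor \<open>(r / d) ^ k\<close>, the logarithm of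
  \<open>norm (f t)\<close> is of the order of the logarithms of the radius and of \<open>A\<close>.
  One \<open>C\<close> and \<open>k\<close> serve all gaps \<open>d\<close>, so finitely many losses
  of radius can be combined before \<open>d\<close> is fixed.\<close>

definition small :: "(complex \<Rightarrow> complex) \<Rightarrow> bool" where
  "small f \<longleftrightarrow> f holomorphic_on UNIV \<and>
     (\<exists>C\<ge>0. \<exists>k. \<forall>r d t. 1 \<le> r \<longrightarrow> 0 < d \<longrightarrow> d \<le> r \<longrightarrow> norm t \<le> r \<longrightarrow>
        norm (f t) \<le> exp (C * (r / d) ^ k * lam r d))"

lemma smallI:
  assumes "f holomorphic_on UNIV" "0 \<le> C"
    and "\<And>r d t. 1 \<le> r \<Longrightarrow> 0 < d \<Longrightarrow> d \<le> r \<Longrightarrow> norm t \<le> r \<Longrightarrow> norm (f t) \<le> exp (C * (r / d) ^ k * lam r d)"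
  shows "small f"
  using assms unfolding small_def by blast

lemma smallE:
  assumes "small f"
  obtains C k where "0 \<le> C"
    "\<And>r d t. 1 \<le> r \<Longrightarrow> 0 < d \<Longrightarrow> d \<le> r \<Longrightarrow> norm t \<le> r \<Longrightarrow> norm (f t) \<le> exp (C * (r / d) ^ k * lam r d)"
  using assms unfolding small_def by blast

lemma small_holomorphic: "small f \<Longrightarrow> f holomorphic_on UNIV"
  by (simp add: small_def)

lemma lam_ge_1:
  assumes "1 \<le> r" "0 < d"
  shows "1 \<le> lam r d"
proof -
  have "exp 1 \<le> (3::real)" by (rule exp_le)
  then have "exp 1 \<le> 3 + r + d" using assms by linarith
  then have "1 \<le> ln (3 + r + d)" using assms by (simp add: ln_ge_iff)
  moreover have "0 \<le> ln (3 + A (r + d))" using A_nonneg[of "r + d"] by simp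
  ultimately show ?thesis by (simp add: lam_def)
qed

lemma power_lam_mono:
  assumes "1 \<le> r" "0 < d" "d \<le> r" "0 \<le> C" "C \<le> C'" "k \<le> k'"
  shows "C * (r / d) ^ k * lam r d \<le> C' * (r / d) ^ k' * lam r d"
  using assms lam_ge_1[OF assms(1,2)]
  by (intro mult_right_mono mult_mono power_increasing) auto

lemma power_lam_ge:
  assumes "1 \<le> r" "0 < d" "d \<le> r" "0 \<le> C"
  shows "C \<le> C * (r / d) ^ k * lam r d"
proof -
  have "1 * 1 \<le> (r / d) ^ k * lam r d"
    using lam_ge_1[OF assms(1,2)] assms by (intro mult_mono one_le_power) auto
  then show ?thesis using mult_left_mono[OF _ assms(4), of 1 "(r / d) ^ k * lam r d"] by (simp add: mult.assoc)
qed

text \<open>The radii $r$ and $r + d/2$ have the same outer radius $r + d$ once the gap is halved.\<close>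

lemma smallE_wide:
  assumes "small f"
  obtains C k where "0 \<le> C"
    "\<And>r d t. 1 \<le> r \<Longrightarrow> 0 < d \<Longrightarrow> d \<le> r \<Longrightarrow> norm t \<le> r + d / 2 \<Longrightarrow>
       norm (f t) \<le> exp (C * (r / d) ^ k * lam r d)"
proof -
  obtain C k where C: "0 \<le> C"
    "\<And>r d t. 1 \<le> r \<Longrightarrow> 0 < d \<Longrightarrow> d \<le> r \<Longrightarrow> norm t \<le> r \<Longrightarrow> norm (f t) \<le> exp (C * (r / d) ^ k * lam r d)"
    using smallE[OF assms] by metis
  show thesis
  proof (rule that[of "C * 3 ^ k" k])
    fix r d :: real and t :: complex
    assume r: "1 \<le> r" "0 < d" "d \<le> r" "norm t \<le> r + d / 2"
    have "norm (f t) \<le> exp (C * ((r + d / 2) / (d / 2)) ^ k * lam (r + d / 2) (d / 2))"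
      using r by (intro C) auto
    also have "lam (r + d / 2) (d / 2) = lam r d"
    proof -
      have "r + d / 2 + d / 2 = r + d" "3 + (r + d / 2) + d / 2 = 3 + r + d" by simp_all
      then show ?thesis by (simp only: lam_def)
    qed
    also have "C * ((r + d / 2) / (d / 2)) ^ k * lam r d \<le> C * (3 * (r / d)) ^ k * lam r d"
      using r C(1) lam_ge_1[OF r(1,2)]
      by (intro mult_right_mono mult_left_mono power_mono) (auto simp: field_simps)
    finally show "norm (f t) \<le> exp (C * 3 ^ k * (r / d) ^ k * lam r d)"
      by (simp add: power_mult_distrib power_divide mult.assoc)
  qed (use C in auto)
qed

lemma small_pairE:
  assumes "small f" "small g"
  obtains C k where "0 \<le> C"
    "\<And>r d t. 1 \<le> r \<Longrightarrow> 0 < d \<Longrightarrow> d \<le> r \<Longrightarrow> norm t \<le> r + d / 2 \<Longrightarrow>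
       norm (f t) \<le> exp (C * (r / d) ^ k * lam r d)"
    "\<And>r d t. 1 \<le> r \<Longrightarrow> 0 < d \<Longrightarrow> d \<le> r \<Longrightarrow> norm t \<le> r + d / 2 \<Longrightarrow>
       norm (g t) \<le> exp (C * (r / d) ^ k * lam r d)"
proof -
  obtain C1 k1 where 1: "0 \<le> C1"
    "\<And>r d t. 1 \<le> r \<Longrightarrow> 0 < d \<Longrightarrow> d \<le> r \<Longrightarrow> norm t \<le> r + d / 2 \<Longrightarrow> norm (f t) \<le> exp (C1 * (r / d) ^ k1 * lam r d)"
    using smallE_wide[OF assms(1)] by metis
  obtain C2 k2 where 2: "0 \<le> C2"
    "\<And>r d t. 1 \<le> r \<Longrightarrow> 0 < d \<Longrightarrow> d \<le> r \<Longrightarrow> norm t \<le> r + d / 2 \<Longrightarrow> norm (g t) \<le> exp (C2 * (r / d) ^ k2 * lam r d)"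
    using smallE_wide[OF assms(2)] by metis
  show thesis
  proof (rule that[of "max C1 C2" "max k1 k2"])
    fix r d :: real and t :: complex
    assume r: "1 \<le> r" "0 < d" "d \<le> r" "norm t \<le> r + d / 2"
    show "norm (f t) \<le> exp (max C1 C2 * (r / d) ^ max k1 k2 * lam r d)"
      using 1(2)[OF r] power_lam_mono[OF r(1-3) 1(1), of "max C1 C2" k1 "max k1 k2"]
      by (meson exp_le_cancel_iff max.cobounded1 order_trans)
    show "norm (g t) \<le> exp (max C1 C2 * (r / d) ^ max k1 k2 * lam r d)"
      using 2(2)[OF r] power_lam_mono[OF r(1-3) 2(1), of "max C1 C2" k2 "max k1 k2"]
      by (meson exp_le_cancel_iff max.cobounded2 order_trans)
  qed (use 1 in auto)
qed

lemma small_const [intro]: "small (\<lambda>_. c)"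
proof (rule smallI[of _ "norm c" 0])
  fix r d :: real assume r: "1 \<le> r" "0 < d" "d \<le> r"
  have "norm c \<le> exp (norm c)" using exp_ge_add_one_self[of "norm c"] by linarith
  also have "\<dots> \<le> exp (norm c * (r / d) ^ 0 * lam r d)"
    using power_lam_ge[OF r, of "norm c" 0] by simp
  finally show "norm c \<le> exp (norm c * (r / d) ^ 0 * lam r d)" .
qed auto

lemma small_add [intro]:
  assumes "small f" "small g"
  shows "small (\<lambda>t. f t + g t)"
proof -
  obtain C k where C: "0 \<le> C"
    "\<And>r d t. 1 \<le> r \<Longrightarrow> 0 < d \<Longrightarrow> d \<le> r \<Longrightarrow> norm t \<le> r + d / 2 \<Longrightarrow> norm (f t) \<le> exp (C * (r / d) ^ k * lam r d)"
    "\<And>r d t. 1 \<le> r \<Longrightarrow> 0 < d \<Longrightarrow> d \<le> r \<Longrightarrow> norm t \<le> r + d / 2 \<Longrightarrow> norm (g t) \<le> exp (C * (r / d) ^ k * lam r d)"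
    using small_pairE[OF assms] by metis
  show ?thesis
  proof (rule smallI[of _ "C + 1" k])
    fix r d :: real and t :: complex
    assume r: "1 \<le> r" "0 < d" "d \<le> r" "norm t \<le> r"
    then have t: "norm t \<le> r + d / 2" by simp
    have "norm (f t + g t) \<le> exp (C * (r / d) ^ k * lam r d) + exp (C * (r / d) ^ k * lam r d)"
      using C(2,3)[OF r(1-3) t] norm_triangle_ineq[of "f t" "g t"] by linarith
    also have "\<dots> \<le> exp (C * (r / d) ^ k * lam r d) * exp 1"
      using exp_ge_add_one_self[of 1] by simp
    also have "\<dots> = exp (C * (r / d) ^ k * lam r d + 1)" by (simp add: exp_add)
    also have "\<dots> \<le> exp ((C + 1) * (r / d) ^ k * lam r d)"
      using power_lam_ge[OF r(1-3), of 1 k] by (simp add: algebra_simps)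
    finally show "norm (f t + g t) \<le> exp ((C + 1) * (r / d) ^ k * lam r d)" .
  qed (use C small_holomorphic assms in \<open>auto intro!: holomorphic_intros\<close>)
qed

lemma small_mult [intro]:
  assumes "small f" "small g"
  shows "small (\<lambda>t. f t * g t)"
proof -
  obtain C k where C: "0 \<le> C"
    "\<And>r d t. 1 \<le> r \<Longrightarrow> 0 < d \<Longrightarrow> d \<le> r \<Longrightarrow> norm t \<le> r + d / 2 \<Longrightarrow> norm (f t) \<le> exp (C * (r / d) ^ k * lam r d)"
    "\<And>r d t. 1 \<le> r \<Longrightarrow> 0 < d \<Longrightarrow> d \<le> r \<Longrightarrow> norm t \<le> r + d / 2 \<Longrightarrow> norm (g t) \<le> exp (C * (r / d) ^ k * lam r d)"
    using small_pairE[OF assms] by metis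
  show ?thesis
  proof (rule smallI[of _ "C + C" k])
    fix r d :: real and t :: complex
    assume r: "1 \<le> r" "0 < d" "d \<le> r" "norm t \<le> r"
    then have t: "norm t \<le> r + d / 2" by simp
    have "norm (f t * g t) \<le> exp (C * (r / d) ^ k * lam r d) * exp (C * (r / d) ^ k * lam r d)"
      unfolding norm_mult using C(2,3)[OF r(1-3) t] by (intro mult_mono) auto
    then show "norm (f t * g t) \<le> exp ((C + C) * (r / d) ^ k * lam r d)"
      by (simp add: exp_add[symmetric] algebra_simps)
  qed (use C small_holomorphic assms in \<open>auto intro!: holomorphic_intros\<close>)
qed

lemma small_diff [intro]:
  assumes "small f" "small g"
  shows "small (\<lambda>t. f t - g t)"
  using small_add[OF assms(1) small_mult[OF small_const[of "-1"] assms(2)]] by simp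

lemma small_sum [intro]:
  assumes "\<And>i. i \<in> I \<Longrightarrow> small (f i)"
  shows "small (\<lambda>t. \<Sum>i\<in>I. f i t)"
  using assms by (induction I rule: infinite_finite_induct) auto

text \<open>Cauchy's estimate on a circle of radius \<open>d / 2\<close> stays within the reach of
  \<open>smallE_wide\<close>. Its factor \<open>2 / d\<close> is at most
  \<open>exp (2 * (r / d))\<close> because \<open>r \<ge> 1\<close>; moving it into the exponent can
  cost one more power of \<open>r / d\<close>.\<close>

lemma small_deriv:
  assumes "small f"
  shows "small (deriv f)"
proof -
  obtain C k where C: "0 \<le> C"
    "\<And>r d t. 1 \<le> r \<Longrightarrow> 0 < d \<Longrightarrow> d \<le> r \<Longrightarrow> norm t \<le> r + d / 2 \<Longrightarrow> norm (f t) \<le> exp (C * (r / d) ^ k * lam r d)"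
    using smallE_wide[OF assms] by metis
  note hol = small_holomorphic[OF assms]
  show ?thesis
  proof (rule smallI[of _ "2 + C" "Suc k"])
    fix r d :: real and t :: complex
    assume r: "1 \<le> r" "0 < d" "d \<le> r" "norm t \<le> r"
    let ?X = "C * (r / d) ^ k * lam r d"
    have "norm ((deriv ^^ 1) f t) \<le> fact 1 * exp ?X / (d / 2) ^ 1"
    proof (rule Cauchy_inequality)
      show "norm (f x) \<le> exp ?X" if "norm (t - x) = d / 2" for x
        using norm_triangle_ineq4[of t "t - x"] that r by (intro C) auto
    qed (use r hol in \<open>auto intro: holomorphic_on_subset holomorphic_on_imp_continuous_on\<close>)
    also have "\<dots> = exp ?X * (2 / d)" by simp
    also have "2 / d \<le> 2 * (r / d)" using r by (simp add: field_simps)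
    also have "\<dots> \<le> exp (2 * (r / d))" using exp_ge_add_one_self[of "2 * (r / d)"] by linarith
    also have "2 * (r / d) \<le> 2 * (r / d) ^ Suc k * lam r d"
    proof -
      have "(r / d) ^ 1 \<le> (r / d) ^ Suc k" using r by (intro power_increasing) auto
      then have "(r / d) ^ 1 * 1 \<le> (r / d) ^ Suc k * lam r d"
        using r lam_ge_1[OF r(1,2)] by (intro mult_mono) auto
      then show ?thesis unfolding power_one_right mult_1_right mult.assoc by linarith
    qed
    also have "exp ?X * exp (2 * (r / d) ^ Suc k * lam r d) = exp (?X + 2 * (r / d) ^ Suc k * lam r d)"
      by (simp add: exp_add)
    also have "?X \<le> C * (r / d) ^ Suc k * lam r d"
      by (rule power_lam_mono) (use r C in auto)
    also have "C * (r / d) ^ Suc k * lam r d + 2 * (r / d) ^ Suc k * lam r d = (2 + C) * (r / d) ^ Suc k * lam r d"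
      by (simp only: distrib_right add.commute)
    finally show "norm (deriv f t) \<le> exp ((2 + C) * (r / d) ^ Suc k * lam r d)" by simp
  qed (use C hol in \<open>auto intro!: holomorphic_intros\<close>)
qed

text \<open>On a circle of radius \<open>r \<ge> 1\<close> the factor \<open>z ^ m\<close> has
  modulus at least 1, and the maximum principle carries the bound for \<open>h\<close>
  inside.\<close>

lemma small_factor_power:
  assumes sm: "small (\<lambda>z. z ^ m * h z)" and hol: "h holomorphic_on UNIV"
  shows "small h"
proof -
  obtain C k where C: "0 \<le> C"
    "\<And>r d t. 1 \<le> r \<Longrightarrow> 0 < d \<Longrightarrow> d \<le> r \<Longrightarrow> norm t \<le> r \<Longrightarrow> norm (t ^ m * h t) \<le> exp (C * (r / d) ^ k * lam r d)"
    using smallE[OF sm] by metis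
  show ?thesis
  proof (rule smallI[OF hol C(1), of k])
    fix r d :: real and t :: complex
    assume r: "1 \<le> r" "0 < d" "d \<le> r" "norm t \<le> r"
    show "norm (h t) \<le> exp (C * (r / d) ^ k * lam r d)"
    proof (rule maximum_modulus_frontier[of h "cball 0 r"])
      fix z :: complex assume "z \<in> frontier (cball 0 r)"
      then have z: "norm z = r" using r by auto
      have "1 * norm (h z) \<le> norm z ^ m * norm (h z)"
        using z r by (intro mult_right_mono one_le_power) auto
      also have "\<dots> \<le> exp (C * (r / d) ^ k * lam r d)"
        using C(2)[OF r(1-3), of z] z by (simp add: norm_mult norm_power)
      finally show "norm (h z) \<le> exp (C * (r / d) ^ k * lam r d)" by simp
    qed (use r hol in \<open>auto intro: holomorphic_on_subset holomorphic_on_imp_continuous_on\<close>)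
  qed
qed

text \<open>The quantitative division needs a nonzero value at 0, so a zero of \<open>f\<close> at
  the origin is first split off from both \<open>f\<close> and \<open>f * E\<close>.\<close>

lemma small_divide:
  assumes f: "small f" "f b \<noteq> 0" and fE: "small (\<lambda>t. f t * E t)" and E: "E holomorphic_on UNIV"
  shows "small E"
proof -
  obtain h m where h: "h holomorphic_on UNIV" "h 0 \<noteq> 0" "\<And>z. f z = (z - 0) ^ m * h z"
    using factor_zero_entire[OF small_holomorphic[OF f(1)] f(2)] by metis
  have hE: "(\<lambda>z. h z * E z) holomorphic_on UNIV" by (intro holomorphic_intros h E)
  have "(\<lambda>z. z ^ m * h z) = f" using h(3) by auto
  then have 1: "small h" using f(1) h(1) small_factor_power by metis
  have "(\<lambda>z. z ^ m * (h z * E z)) = (\<lambda>t. f t * E t)" using h(3) by (auto simp: mult.assoc)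
  then have 2: "small (\<lambda>z. h z * E z)" using small_factor_power[OF _ hE, of m] fE by simp
  obtain C k where C: "0 \<le> C"
    "\<And>r d t. 1 \<le> r \<Longrightarrow> 0 < d \<Longrightarrow> d \<le> r \<Longrightarrow> norm t \<le> r + d / 2 \<Longrightarrow> norm (h t) \<le> exp (C * (r / d) ^ k * lam r d)"
    "\<And>r d t. 1 \<le> r \<Longrightarrow> 0 < d \<Longrightarrow> d \<le> r \<Longrightarrow> norm t \<le> r + d / 2 \<Longrightarrow> norm (h t * E t) \<le> exp (C * (r / d) ^ k * lam r d)"
    using small_pairE[OF 1 2] by metis
  define L where "L = \<bar>ln (norm (h 0))\<bar>"
  show ?thesis
  \<comment> \<open>The gap \<open>d / 2\<close> gives
    \<open>1 + 2 * r / (d / 2) = 1 + 4 * (r / d)\<close>, at most \<open>5 * (r / d)\<close>; this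
    further factor \<open>r / d\<close> accounts for \<open>Suc k\<close>.\<close>
  proof (rule smallI[OF E, of "5 * (C + L)" "Suc k"])
    fix r d :: real and t :: complex
    assume r: "1 \<le> r" "0 < d" "d \<le> r" "norm t \<le> r"
    let ?X = "C * (r / d) ^ k * lam r d"
    have rd: "0 \<le> r" "r < r + d / 2" using r by auto
    have "norm (E t) \<le> exp ((1 + 2 * r / (r + d / 2 - r)) * (?X - ln (norm (h 0))))"
      by (rule norm_le_of_norm_mult_le[OF h(1,2) E rd]) (use r C in auto)
    also have "(1 + 2 * r / (r + d / 2 - r)) * (?X - ln (norm (h 0))) \<le> (5 * (r / d)) * (?X + L)"
    proof (rule mult_mono)
      show "1 + 2 * r / (r + d / 2 - r) \<le> 5 * (r / d)" using r by (simp add: field_simps)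
      have "norm (h 0) \<le> exp ?X" using r by (intro C) auto
      then show "0 \<le> ?X - ln (norm (h 0))"
        using h(2) by (metis diff_ge_0_iff_ge ln_exp ln_mono zero_less_norm_iff)
      show "?X - ln (norm (h 0)) \<le> ?X + L" by (simp add: L_def)
    qed (use r C in auto)
    also have "\<dots> \<le> (5 * (r / d)) * ((C + L) * (r / d) ^ k * lam r d)"
      using power_lam_ge[OF r(1-3), of L k] r by (intro mult_left_mono) (auto simp: L_def algebra_simps)
    also have "\<dots> = 5 * (C + L) * (r / d) ^ Suc k * lam r d" by (simp only: power_Suc mult_ac)
    finally show "norm (E t) \<le> exp (5 * (C + L) * (r / d) ^ Suc k * lam r d)" by simp
  qed (use C in \<open>auto simp: L_def\<close>)
qed

text \<open>Borel--Caratheodory over half the gap bounds \<open>norm (e t)\<close> linearly in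
  \<open>A (r + d)\<close>. Since \<open>3 + A (r + d)\<close> is at most
  \<open>exp (lam r d)\<close>, linear growth in \<open>A\<close> already counts as small.\<close>

lemma small_of_Re_le:
  assumes e: "e holomorphic_on UNIV" and le: "\<And>t. Re (e t) \<le> A (norm t)"
  shows "small e"
\<comment> \<open>The constant is \<open>5 * (1 + norm (e 0))\<close> for the prefactor, plus 1 for
  \<open>ln (3 + A (r + d))\<close>.\<close>
proof (rule smallI[OF e, of "6 + 5 * norm (e 0)" 1])
  fix r d :: real and t :: complex
  assume r: "1 \<le> r" "0 < d" "d \<le> r" "norm t \<le> r"
  let ?a = "A (r + d)" and ?n = "norm (e 0)"
  have a0: "0 \<le> ?a" by (rule A_nonneg)
  have rd: "1 \<le> r / d" using r by simp
  have "norm (e t - e 0) \<le> 2 * r / (r + d / 2 - r) * (?a - Re (e 0))"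
  proof (rule Borel_Caratheodory)
    show "Re (e z) \<le> ?a" if "norm z < r + d / 2" for z
      using le[of z] A_mono[of "norm z" "r + d"] that r by linarith
  qed (use r e in \<open>auto intro: holomorphic_on_subset\<close>)
  also have "\<dots> = 4 * (r / d) * (?a - Re (e 0))" using r by (simp add: field_simps)
  also have "\<dots> \<le> 4 * (r / d) * (?a + ?n)"
    using r complex_Re_le_cmod[of "- e 0"] by (intro mult_left_mono) auto
  finally have "norm (e t) \<le> 4 * (r / d) * (?a + ?n) + ?n"
    using norm_triangle_sub[of "e t" "e 0"] by linarith
  also have "\<dots> \<le> (4 * (r / d) * (1 + ?n) + ?n) * (3 + ?a)"
  proof -
    have "?n \<le> ?n * (3 + ?a)" using a0 mult_left_mono[of 1 "3 + ?a" ?n] by simp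
    moreover have "?a + ?n \<le> (1 + ?n) * (3 + ?a)" using a0 by (simp add: algebra_simps)
    then have "4 * (r / d) * (?a + ?n) \<le> 4 * (r / d) * ((1 + ?n) * (3 + ?a))"
      using r by (intro mult_left_mono) auto
    moreover have "(4 * (r / d) * (1 + ?n) + ?n) * (3 + ?a) = 4 * (r / d) * ((1 + ?n) * (3 + ?a)) + ?n * (3 + ?a)"
      by (subst distrib_right) (simp only: mult.assoc)
    ultimately show ?thesis by linarith
  qed
  also have "\<dots> \<le> exp (4 * (r / d) * (1 + ?n) + ?n) * exp (ln (3 + ?a))"
  proof (rule mult_mono)
    show "4 * (r / d) * (1 + ?n) + ?n \<le> exp (4 * (r / d) * (1 + ?n) + ?n)"
      using exp_ge_add_one_self[of "4 * (r / d) * (1 + ?n) + ?n"] by linarith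
  qed (use a0 in auto)
  also have "\<dots> = exp (4 * (r / d) * (1 + ?n) + ?n + ln (3 + ?a))" by (simp add: exp_add)
  also have "4 * (r / d) * (1 + ?n) + ?n + ln (3 + ?a) \<le> (6 + 5 * ?n) * (r / d) ^ 1 * lam r d"
  proof -
    have l: "1 \<le> lam r d" by (rule lam_ge_1) (use r in auto)
    have "ln (3 + ?a) \<le> lam r d" using r by (simp add: lam_def)
    also have "lam r d \<le> (r / d) * lam r d" using l rd mult_right_mono[of 1 "r / d" "lam r d"] by simp
    finally have 1: "ln (3 + ?a) \<le> (r / d) * lam r d" .
    have 2: "r / d \<le> (r / d) * lam r d" using l rd mult_left_mono[of 1 "lam r d" "r / d"] by simp
    have "1 + ?n \<le> (1 + ?n) * (r / d)" using mult_left_mono[OF rd, of "1 + ?n"] by simp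
    then have "?n \<le> (1 + ?n) * (r / d)" by linarith
    then have "4 * (r / d) * (1 + ?n) + ?n \<le> 4 * (r / d) * (1 + ?n) + (1 + ?n) * (r / d)"
      by (rule add_left_mono)
    also have "\<dots> = (5 + 5 * ?n) * (r / d)" by (simp add: algebra_simps add_divide_distrib)
    also have "\<dots> \<le> (5 + 5 * ?n) * ((r / d) * lam r d)" using 2 by (intro mult_left_mono) auto
    finally have 3: "4 * (r / d) * (1 + ?n) + ?n \<le> (5 + 5 * ?n) * ((r / d) * lam r d)" .
    have "(6 + 5 * ?n) * (r / d) ^ 1 * lam r d = (5 + 5 * ?n) * ((r / d) * lam r d) + (r / d) * lam r d"
      by (simp add: algebra_simps add_divide_distrib)
    then show ?thesis using 1 3 by linarith
  qed
  finally show "norm (e t) \<le> exp ((6 + 5 * ?n) * (r / d) ^ 1 * lam r d)" by simp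
qed auto

end

section \<open>Elimination of exponentials by Wronskians\<close>

text \<open>\<open>G / F\<close> has derivative 0 near \<open>a\<close>, where \<open>F\<close> does
  not vanish; the identity theorem carries the proportionality across the zeros of
  \<open>F\<close>.\<close>

lemma proportional_of_wronskian_zero:
  fixes F G :: "complex \<Rightarrow> complex"
  assumes F: "F holomorphic_on UNIV" and G: "G holomorphic_on UNIV" and nz: "F a \<noteq> 0"
    and eq: "\<And>t. deriv G t * F t = G t * deriv F t"
  obtains \<kappa> where "\<And>t. G t = \<kappa> * F t"
proof -
  have "continuous_on UNIV F" using F by (rule holomorphic_on_imp_continuous_on)
  then have "open (F -` (- {0}))" by (intro open_vimage) auto
  then obtain e where e0: "e > 0" "ball a e \<subseteq> F -` (- {0})"
    using nz open_contains_ball[of "F -` (- {0})"] by blast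
  then have e: "e > 0" "\<And>t. t \<in> ball a e \<Longrightarrow> F t \<noteq> 0" by blast+
  have "\<exists>c. \<forall>t\<in>ball a e. G t / F t = c"
  proof (rule has_field_derivative_zero_constant)
    fix t assume t: "t \<in> ball a e"
    have "((\<lambda>t. G t / F t) has_field_derivative (deriv G t * F t - G t * deriv F t) / (F t * F t)) (at t)"
      using e(2)[OF t] holomorphic_derivI[OF F open_UNIV, of t] holomorphic_derivI[OF G open_UNIV, of t]
      by (intro DERIV_divide) auto
    then show "((\<lambda>t. G t / F t) has_field_derivative 0) (at t within ball a e)"
      using eq[of t] by (simp add: has_field_derivative_at_within)
  qed auto
  then obtain c where c: "\<And>t. t \<in> ball a e \<Longrightarrow> G t = c * F t"
    using e(2) by (metis nonzero_eq_divide_eq)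
  have "G t = c * F t" for t
    by (rule analytic_continuation_open[of "ball a e" UNIV G "\<lambda>t. c * F t"])
      (use c e F G in \<open>auto intro!: holomorphic_intros\<close>)
  then show thesis by (rule that)
qed

context growth
begin

text \<open>Eliminating one exponential at a time by Wronskian-type combinations keeps the remaining terms
  linearly independent, so no determinants are needed.\<close>

lemma small_of_independent:
  assumes "finite T"
    and "\<And>j. j \<in> T \<Longrightarrow> small (f j)"
    and L: "\<And>j. j \<in> T \<Longrightarrow> small (L j)"
    and E: "\<And>j t. j \<in> T \<Longrightarrow> (E j has_field_derivative L j t * E j t) (at t)"
    and "\<And>c. (\<And>t. (\<Sum>j\<in>T. c j * (f j t * E j t)) = 0) \<Longrightarrow> \<forall>j\<in>T. c j = (0::complex)"
    and "small (\<lambda>t. \<Sum>j\<in>T. f j t * E j t)"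
    and "i \<in> T"
  shows "small (E i)"
  using assms
proof (induction "card T" arbitrary: T f i rule: less_induct)
  case less
  note fin = less.prems(1) and f = less.prems(2) and L = less.prems(3) and E = less.prems(4)
    and ind = less.prems(5) and sm = less.prems(6) and i = less.prems(7)
  have holE: "E j holomorphic_on UNIV" if "j \<in> T" for j
    using E[OF that] by (auto simp: holomorphic_on_def field_differentiable_def intro: DERIV_subset)
  have holf: "f j holomorphic_on UNIV" if "j \<in> T" for j
    using f[OF that] by (rule small_holomorphic)
  have nz: "\<exists>t. f j t * E j t \<noteq> 0" if j: "j \<in> T" for j
  proof (rule ccontr)
    assume "\<not> ?thesis"
    then have "(\<Sum>l\<in>T. (if l = j then 1 else 0) * (f l t * E l t)) = 0" for t
      by (intro sum.neutral) auto
    from ind[OF this] j show False by auto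
  qed
  show ?case
  proof (cases "T = {i}")
    case True
    obtain b where "f i b \<noteq> 0" using nz[OF i] by auto
    moreover have "small (\<lambda>t. f i t * E i t)" using sm True by simp
    ultimately show ?thesis using small_divide f[OF i] holE[OF i] by blast
  next
    case False
    then obtain N where N: "N \<in> T" "N \<noteq> i" using i by auto
    let ?T = "T - {N}"
    \<comment> \<open>\<open>(f j * E j)' = D j * E j\<close>, so differentiation changes only the
      small coefficients. Below, \<open>g j\<close> is the coefficient of \<open>E j\<close> in
      \<open>s * D N - f N * s'\<close>; it vanishes for \<open>j = N\<close>.\<close>
    define D where "D j t = deriv (f j) t + f j t * L j t" for j t
    define g where "g j t = f j t * D N t - f N t * D j t" for j t
    have smD: "small (D j)" if "j \<in> T" for j
      unfolding D_def using f[OF that] L[OF that] by (intro small_add small_mult small_deriv)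
    have DE: "((\<lambda>t. f j t * E j t) has_field_derivative D j t * E j t) (at t)" if "j \<in> T" for j t
      by (rule derivative_eq_intros holomorphic_derivI[OF holf[OF that] open_UNIV] E[OF that] refl UNIV_I)+
        (simp add: D_def algebra_simps)
    define s where "s t = (\<Sum>j\<in>T. f j t * E j t)" for t
    have ds: "(s has_field_derivative (\<Sum>j\<in>T. D j t * E j t)) (at t)" for t
      unfolding s_def by (intro DERIV_sum DE)
    have sum_g: "(\<Sum>j\<in>?T. c j * (g j t * E j t)) =
        (\<Sum>j\<in>?T. c j * (f j t * E j t)) * D N t - f N t * (\<Sum>j\<in>?T. c j * (D j t * E j t))" for c t
      unfolding g_def sum_distrib_left sum_distrib_right sum_subtractf[symmetric]
      by (intro sum.cong) (auto simp: algebra_simps)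
    have "card ?T < card T" using N fin by (intro psubset_card_mono) auto
    then show ?thesis
    proof (rule less.hyps[of ?T g i])
      show "small (g j)" if "j \<in> ?T" for j
        unfolding g_def using that f N smD by (intro small_diff small_mult) auto
      show "\<forall>j\<in>?T. c j = 0" if c: "\<And>t. (\<Sum>j\<in>?T. c j * (g j t * E j t)) = 0" for c
      proof -
        \<comment> \<open>Multiplied by \<open>E N\<close>, a relation among the
          \<open>g j * E j\<close> says that the Wronskian of \<open>F\<close> and \<open>G\<close>
          vanishes. Then \<open>G = \<kappa> * F\<close> is a relation among the original terms, and
          their independence makes all \<open>c j\<close> zero.\<close>
        define F where "F t = f N t * E N t" for t
        define G where "G t = (\<Sum>j\<in>?T. c j * (f j t * E j t))" for t
        have dF: "(F has_field_derivative D N t * E N t) (at t)" for t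
          unfolding F_def by (rule DE[OF N(1)])
        have dG: "(G has_field_derivative (\<Sum>j\<in>?T. c j * (D j t * E j t))) (at t)" for t
          unfolding G_def by (intro DERIV_sum DERIV_cmult DE) auto
        have hol: "F holomorphic_on UNIV" "G holomorphic_on UNIV"
          using dF dG by (auto simp: holomorphic_on_def field_differentiable_def intro: DERIV_subset)
        obtain a where a: "F a \<noteq> 0" using nz[OF N(1)] by (auto simp: F_def)
        have "deriv G t * F t = G t * deriv F t" for t
          using c[of t] unfolding sum_g DERIV_imp_deriv[OF dF] DERIV_imp_deriv[OF dG]
          by (simp add: F_def G_def algebra_simps)
        then obtain \<kappa> where \<kappa>: "\<And>t. G t = \<kappa> * F t"
          using proportional_of_wronskian_zero[OF hol a] by metis
        let ?c = "\<lambda>j. if j = N then - \<kappa> else c j"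
        have "(\<Sum>j\<in>T. ?c j * (f j t * E j t)) = 0" for t
        proof -
          have "(\<Sum>j\<in>T. ?c j * (f j t * E j t)) = - \<kappa> * F t + (\<Sum>j\<in>?T. ?c j * (f j t * E j t))"
            using sum.remove[OF fin N(1), of "\<lambda>j. ?c j * (f j t * E j t)"] by (simp add: F_def)
          also have "(\<Sum>j\<in>?T. ?c j * (f j t * E j t)) = G t"
            unfolding G_def by (intro sum.cong) auto
          finally show ?thesis using \<kappa>[of t] by simp
        qed
        from ind[OF this] show ?thesis by (metis DiffD1 DiffD2 singletonI)
      qed
      have "small (\<lambda>t. s t * D N t - f N t * deriv s t)"
        using sm f N smD unfolding s_def[symmetric] by (intro small_diff small_mult small_deriv) auto
      moreover have "s t * D N t - f N t * deriv s t = (\<Sum>j\<in>?T. g j t * E j t)" for t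
      proof -
        have "s t * D N t - f N t * deriv s t = (\<Sum>j\<in>T. g j t * E j t)"
          unfolding DERIV_imp_deriv[OF ds] s_def g_def sum_distrib_left sum_distrib_right sum_subtractf[symmetric]
          by (intro sum.cong) (auto simp: algebra_simps)
        also have "\<dots> = (\<Sum>j\<in>?T. g j t * E j t)"
          using sum.remove[OF fin N(1), of "\<lambda>j. g j t * E j t"] by (simp add: g_def)
        finally show ?thesis .
      qed
      ultimately show "small (\<lambda>t. \<Sum>j\<in>?T. g j t * E j t)" by simp
    qed (use fin L E N i in auto)
  qed
qed

text \<open>Dependent exponentials may cancel, so the sum is first rewritten with as few
  \<open>E j\<close> as possible. Minimality makes the remaining ones independent with nonzero
  coefficients, and the nonzero value at \<open>a\<close> keeps at least one of them.\<close>

lemma exists_small_of_sum: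
  assumes fin: "finite J"
    and L: "\<And>j. j \<in> J \<Longrightarrow> small (L j)"
    and E: "\<And>j t. j \<in> J \<Longrightarrow> (E j has_field_derivative L j t * E j t) (at t)"
    and sm: "small (\<lambda>t. \<Sum>j\<in>J. b j * E j t)" and nz: "(\<Sum>j\<in>J. b j * E j a) \<noteq> 0"
  obtains j where "j \<in> J" "small (E j)"
proof -
  define P where "P B c \<longleftrightarrow> B \<subseteq> J \<and> (\<forall>t. (\<Sum>j\<in>B. c j * E j t) = (\<Sum>j\<in>J. b j * E j t))" for B c
  have "P J b" by (simp add: P_def)
  then obtain B c where Bc: "P B c" and least: "\<And>B' c'. P B' c' \<Longrightarrow> card B \<le> card B'"
    using ex_has_least_nat[of "\<lambda>(B, c). P B c" "(J, b)" "\<lambda>(B, c). card B"] by auto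
  have BJ: "B \<subseteq> J" and rep: "\<And>t. (\<Sum>j\<in>B. c j * E j t) = (\<Sum>j\<in>J. b j * E j t)"
    using Bc by (auto simp: P_def)
  have finB: "finite B" using BJ fin by (rule finite_subset)
  have indep: "\<forall>j\<in>B. d j = 0" if d: "\<And>t. (\<Sum>j\<in>B. d j * E j t) = 0" for d
  proof (rule ccontr)
    assume "\<not> ?thesis"
    then obtain i where i: "i \<in> B" "d i \<noteq> 0" by auto
    \<comment> \<open>The multiple of the relation \<open>d\<close> is chosen to cancel the
      coefficient of \<open>E i\<close>, which gives a shorter representation.\<close>
    let ?c = "\<lambda>j. c j - c i / d i * d j"
    have "(\<Sum>j\<in>B - {i}. ?c j * E j t) = (\<Sum>j\<in>J. b j * E j t)" for t
    proof -
      have "(\<Sum>j\<in>B - {i}. ?c j * E j t) = (\<Sum>j\<in>B. ?c j * E j t)"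
        using sum.remove[OF finB i(1), of "\<lambda>j. ?c j * E j t"] i by simp
      also have "\<dots> = (\<Sum>j\<in>B. c j * E j t) - c i / d i * (\<Sum>j\<in>B. d j * E j t)"
        unfolding sum_distrib_left sum_subtractf[symmetric] by (intro sum.cong) (auto simp: algebra_simps)
      finally show ?thesis using d rep by simp
    qed
    then have "P (B - {i}) ?c" using BJ by (auto simp: P_def)
    from least[OF this] i finB show False
      by (metis card_Diff1_less linorder_not_less)
  qed
  have "B \<noteq> {}" using rep[of a] nz by auto
  then obtain i where i: "i \<in> B" by auto
  have cnz: "c j \<noteq> 0" if j: "j \<in> B" for j
  proof
    assume "c j = 0"
    then have "P (B - {j}) c"
      using BJ rep sum.remove[OF finB j, of "\<lambda>j. c j * E j _"] by (auto simp: P_def)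
    from least[OF this] j finB show False by (metis card_Diff1_less linorder_not_less)
  qed
  have "small (E i)"
  proof (rule small_of_independent[OF finB, of "\<lambda>j t. c j" L])
    show "\<forall>j\<in>B. d j = 0" if "\<And>t. (\<Sum>j\<in>B. d j * (c j * E j t)) = 0" for d
      using indep[of "\<lambda>j. d j * c j"] that cnz by (simp add: mult.assoc)
    show "small (\<lambda>t. \<Sum>j\<in>B. c j * E j t)" using sm rep by simp
  qed (use BJ L E i in auto)
  then show thesis using that i BJ by blast
qed

end

section \<open>Monotone functions bounded by their own logarithm\<close>

context growth
begin

text \<open>Borel's growth lemma. Were it false from \<open>r0\<close> on, \<open>A\<close> would
  double at each of the radii \<open>R j\<close> while the steps stay below the geometric sequence
  \<open>q ^ j\<close>. The radii would remain bounded, and \<open>A\<close> would be infinite at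
  their bound.\<close>

lemma exists_no_doubling:
  assumes \<beta>: "0 < \<beta>" and A1: "1 \<le> A r0"
  obtains r where "r0 \<le> r" "A (r + A r powr (- \<beta>)) \<le> 2 * A r"
proof -
  have "\<exists>r\<ge>r0. A (r + A r powr (- \<beta>)) \<le> 2 * A r"
  proof (rule ccontr)
    assume "\<not> ?thesis"
    then have dbl: "2 * A r < A (r + A r powr (- \<beta>))" if "r0 \<le> r" for r
      using that by auto
    define q where "q = (2::real) powr (- \<beta>)"
    have q: "0 < q" "q < 1" using \<beta> by (auto simp: q_def powr_less_one)
    define R where "R j = ((\<lambda>r. r + A r powr (- \<beta>)) ^^ j) r0" for j
    have R_Suc: "R (Suc j) = R j + A (R j) powr (- \<beta>)" for j by (simp add: R_def)
    have main: "r0 \<le> R j \<and> 2 ^ j \<le> A (R j) \<and> R j \<le> r0 + (\<Sum>i<j. q ^ i)" for j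
    proof (induction j)
      case 0
      then show ?case using A1 by (simp add: R_def)
    next
      case (Suc j)
      then have IH: "r0 \<le> R j" "2 ^ j \<le> A (R j)" "R j \<le> r0 + (\<Sum>i<j. q ^ i)" by auto
      have "A (R j) powr (- \<beta>) \<le> (2 ^ j) powr (- \<beta>)"
        using \<beta> IH(2) by (intro powr_mono2') auto
      also have "(2 ^ j) powr (- \<beta>) = q ^ j"
        by (simp add: q_def powr_power powr_realpow[symmetric] powr_powr mult.commute)
      finally have "R (Suc j) \<le> r0 + (\<Sum>i<Suc j. q ^ i)" using IH(3) R_Suc by simp
      moreover have "r0 \<le> R (Suc j)" using IH(1) unfolding R_Suc by (simp add: add_increasing2)
      moreover have "2 ^ Suc j \<le> A (R (Suc j))"
        using dbl[OF IH(1)] IH(2) unfolding R_Suc by simp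
      ultimately show ?case by blast
    qed
    have "(\<Sum>i<j. q ^ i) \<le> 1 / (1 - q)" for j
      using q sum_le_suminf[of "\<lambda>i. q ^ i" "{..<j}"] suminf_geometric[of q] by (simp add: summable_geometric)
    then have "2 ^ j \<le> A (r0 + 1 / (1 - q))" for j
      using main[of j] A_mono[of "R j" "r0 + 1 / (1 - q)"] by (meson add_left_mono order_trans)
    moreover obtain j where "A (r0 + 1 / (1 - q)) < 2 ^ j"
      using real_arch_pow[of 2] by auto
    ultimately show False by (meson linorder_not_less)
  qed
  then show thesis using that by blast
qed

text \<open>Suppose \<open>A r\<close> exceeded \<open>r ^ (4 * K)\<close> from some radius on. With
  the gap \<open>d = A r powr (- 1 / (2 * K))\<close> the factor \<open>(r / d) ^ K\<close> is
  \<open>r ^ K * A r powr (1/2)\<close>, at most the power 3/4 of \<open>A r\<close>, and without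
  doubling \<open>lam r d\<close> is logarithmic in \<open>A r\<close>. Then \<open>A r\<close>
  would be smaller than itself.\<close>

lemma power_bound_of_self_bound:
  assumes C: "0 \<le> C" and K: "0 < K"
    and self: "\<And>r d. 1 \<le> r \<Longrightarrow> 0 < d \<Longrightarrow> d \<le> r \<Longrightarrow> A r \<le> C * (r / d) ^ K * lam r d"
  obtains r where "r0 \<le> r" "A r \<le> r ^ (4 * K)"
proof -
  have "\<exists>r\<ge>r0. A r \<le> r ^ (4 * K)"
  proof (rule ccontr)
    assume "\<not> ?thesis"
    then have big: "r ^ (4 * K) < A r" if "r0 \<le> r" for r using that by auto
    \<comment> \<open>The quarter power left over has to beat the logarithm.\<close>
    have "\<forall>\<^sub>F x::real in at_top. 2 * C * ln (4 + 2 * x) < x powr (1 / 4)" by real_asymp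
    then obtain X where X: "\<And>x. X \<le> x \<Longrightarrow> 2 * C * ln (4 + 2 * x) < x powr (1 / 4)"
      by (auto simp: eventually_at_top_linorder)
    define r1 where "r1 = max (max r0 1) X"
    have r1: "r0 \<le> r1" "1 \<le> r1" "X \<le> r1" by (auto simp: r1_def)
    have r_le: "r \<le> A r" if "r1 \<le> r" for r
    proof -
      have "r ^ 1 \<le> r ^ (4 * K)" using that r1 K by (intro power_increasing) auto
      then show ?thesis using big[of r] that r1 by simp
    qed
    define \<beta> where "\<beta> = 1 / (2 * real K)"
    have \<beta>: "0 < \<beta>" using K by (simp add: \<beta>_def)
    obtain r where r: "r1 \<le> r" "A (r + A r powr (- \<beta>)) \<le> 2 * A r"
      using exists_no_doubling[OF \<beta>, of r1] r_le[of r1] r1 by auto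
    let ?a = "A r" and ?d = "A r powr (- \<beta>)"
    have r': "1 \<le> r" "r0 \<le> r" "X \<le> r" using r r1 by auto
    have a: "1 \<le> ?a" "r \<le> ?a" using r_le[OF r(1)] r' by auto
    have d: "0 < ?d" "?d \<le> 1" using a \<beta> powr_mono[of "- \<beta>" 0 ?a] by auto
    have "(r / ?d) ^ K = r ^ K * ?a powr (1 / 2)"
    proof -
      have "1 / ?d = ?a powr \<beta>" using a by (simp add: powr_minus divide_simps)
      then have "r / ?d = r * ?a powr \<beta>" by (metis times_divide_eq_right mult.right_neutral)
      then have "(r / ?d) ^ K = r ^ K * (?a powr \<beta>) ^ K" by (simp only: power_mult_distrib)
      also have "(?a powr \<beta>) ^ K = ?a powr (1 / 2)" using K a by (simp add: powr_power \<beta>_def)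
      finally show ?thesis .
    qed
    moreover have "r ^ K \<le> ?a powr (1 / 4)"
    proof -
      have "r ^ K = (r ^ (4 * K)) powr (1 / 4)"
        using r' by (simp add: powr_realpow[symmetric] powr_powr)
      also have "\<dots> \<le> ?a powr (1 / 4)" using big[OF r'(2)] r' by (intro powr_mono2) auto
      finally show ?thesis .
    qed
    ultimately have 1: "(r / ?d) ^ K \<le> ?a powr (1 / 4) * ?a powr (1 / 2)"
      by (simp add: mult_right_mono)
    have 2: "lam r ?d \<le> 2 * ln (4 + 2 * ?a)"
    proof -
      have "0 < 3 + r + ?d" "3 + r + ?d \<le> 4 + 2 * ?a" using a d r' by linarith+
      then have "ln (3 + r + ?d) \<le> ln (4 + 2 * ?a)" by (intro ln_mono)
      moreover have "ln (3 + A (r + ?d)) \<le> ln (4 + 2 * ?a)"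
        using r(2) A_nonneg[of "r + ?d"] a by (intro ln_mono) auto
      ultimately show ?thesis by (simp add: lam_def)
    qed
    have "0 \<le> lam r ?d" using lam_ge_1[OF r'(1) d(1)] by simp
    have "?a \<le> C * (r / ?d) ^ K * lam r ?d" using self[OF r'(1) d(1)] d r' by simp
    also have "\<dots> \<le> C * (?a powr (1 / 4) * ?a powr (1 / 2)) * (2 * ln (4 + 2 * ?a))"
      using 1 2 C r'(1) \<open>0 \<le> lam r ?d\<close> by (intro mult_mono) auto
    also have "\<dots> = (2 * C * ln (4 + 2 * ?a)) * ?a powr (3 / 4)"
      by (simp add: powr_add[symmetric])
    also have "\<dots> < ?a powr (1 / 4) * ?a powr (3 / 4)"
      using X[of ?a] a r' by (intro mult_strict_right_mono) auto
    also have "\<dots> = ?a" using a by (simp add: powr_add[symmetric])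
    finally show False by simp
  qed
  then show thesis using that by blast
qed

text \<open>With \<open>d = r = s / 2\<close> the outer radius is exactly \<open>s\<close> and
  \<open>(r / d) ^ k\<close> is 1. A polynomial bound for \<open>A s\<close> therefore makes
  \<open>A\<close> logarithmically bounded at half the radius.\<close>

lemma sublinear_of_self_bound:
  assumes C: "0 \<le> C"
    and self: "\<And>r d. 1 \<le> r \<Longrightarrow> 0 < d \<Longrightarrow> d \<le> r \<Longrightarrow> A r \<le> C * (r / d) ^ k * lam r d"
    and e: "0 < e"
  obtains r where "r0 \<le> r" "A r \<le> e * r"
proof -
  \<comment> \<open>\<open>power_bound_of_self_bound\<close> requires a positive exponent, hence
    \<open>Suc k\<close>.\<close>
  have self': "A r \<le> C * (r / d) ^ Suc k * lam r d" if "1 \<le> r" "0 < d" "d \<le> r" for r d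
    using self[OF that] power_lam_mono[OF that C, of C k "Suc k"] by simp
  define N where "N = 4 * Suc k"
  have "\<forall>\<^sub>F r::real in at_top. C * (ln (3 + 2 * r) + real (N + 1) * ln (3 + 2 * r)) \<le> e * r"
    using e by real_asymp
  then obtain X where X: "\<And>r. X \<le> r \<Longrightarrow> C * (ln (3 + 2 * r) + real (N + 1) * ln (3 + 2 * r)) \<le> e * r"
    by (auto simp: eventually_at_top_linorder)
  obtain s where s: "2 * max (max r0 1) X \<le> s" "A s \<le> s ^ N"
    using power_bound_of_self_bound[OF C _ self', of "2 * max (max r0 1) X"] unfolding N_def by blast
  define r where "r = s / 2"
  have r: "r0 \<le> r" "1 \<le> r" "X \<le> r" "s = r + r" using s(1) by (auto simp: r_def)
  have "A r \<le> C * (r / r) ^ k * lam r r" using r by (intro self) auto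
  also have "\<dots> = C * (ln (3 + 2 * r) + ln (3 + A s))" using r by (simp add: lam_def algebra_simps)
  also have "\<dots> \<le> C * (ln (3 + 2 * r) + real (N + 1) * ln (3 + 2 * r))"
  proof (intro mult_left_mono add_left_mono C)
    have "3 + A s \<le> 3 + s ^ N" using s by simp
    also have "\<dots> \<le> (3 + s) ^ (N + 1)"
    proof -
      have "s ^ N \<le> (3 + s) ^ N" "1 \<le> (3 + s) ^ N" using r by (intro power_mono one_le_power; simp)+
      then have "3 * 1 + 1 * s ^ N \<le> 3 * (3 + s) ^ N + s * (3 + s) ^ N"
        using r by (intro add_mono mult_mono) auto
      then show ?thesis by (simp add: algebra_simps)
    qed
    finally have "ln (3 + A s) \<le> ln ((3 + s) ^ (N + 1))" using A_nonneg[of s] by (intro ln_mono) auto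
    also have "\<dots> = real (N + 1) * ln (3 + 2 * r)" using r by (subst ln_realpow) auto
    finally show "ln (3 + A s) \<le> real (N + 1) * ln (3 + 2 * r)" .
  qed
  also have "\<dots> \<le> e * r" by (rule X) (rule r)
  finally show thesis using that r by blast
qed

text \<open>Liouville's argument from a one-sided bound: Borel--Caratheodory controls
  \<open>f - f 0\<close> on half the disc, Cauchy's estimate its derivative. Arbitrarily large radii
  with a good bound suffice. The 9 is 8 from Cauchy on a circle of radius \<open>r / 4\<close> plus
  1 for the term with \<open>f 0\<close>.\<close>

lemma deriv_zero_of_sublinear:
  assumes f: "f holomorphic_on UNIV" and le: "\<And>t. Re (f t) \<le> A (norm t)"
    and sub: "\<And>e r0. 0 < e \<Longrightarrow> \<exists>r\<ge>r0. A r \<le> e * r"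
  shows "deriv f a = 0"
proof -
  have "norm (deriv f a) \<le> 9 * e" if e: "e > 0" for e
  proof -
    \<comment> \<open>The entry \<open>4 * norm a\<close> keeps the circle of radius
      \<open>r / 4\<close> about \<open>a\<close> inside radius \<open>r / 2\<close>; the last entry
      makes the term with \<open>f 0\<close> at most \<open>e\<close>.\<close>
    define M where "M = max (max 1 (4 * norm a)) (8 * norm (f 0) / e)"
    obtain r where r: "M \<le> r" "A r \<le> e * r" using sub[OF e] by blast
    then have r': "1 \<le> r" "4 * norm a \<le> r" "8 * norm (f 0) / e \<le> r" by (auto simp: M_def)
    have bound: "norm (f t - f 0) \<le> 2 * (e * r + norm (f 0))" if "norm t \<le> r / 2" for t
    proof -
      have "norm (f t - f 0) \<le> 2 * (r / 2) / (r - r / 2) * (A r - Re (f 0))"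
      proof (rule Borel_Caratheodory)
        show "Re (f z) \<le> A r" if "norm z < r" for z
          using le[of z] A_mono[of "norm z" r] that by linarith
      qed (use r' that f in \<open>auto intro: holomorphic_on_subset\<close>)
      also have "\<dots> = 2 * (A r - Re (f 0))" using r' by (simp add: field_simps)
      also have "\<dots> \<le> 2 * (e * r + norm (f 0))"
        using r complex_Re_le_cmod[of "- f 0"] by simp
      finally show ?thesis .
    qed
    have "norm ((deriv ^^ 1) (\<lambda>t. f t - f 0) a) \<le> fact 1 * (2 * (e * r + norm (f 0))) / (r / 4) ^ 1"
    proof (rule Cauchy_inequality)
      fix x assume "norm (a - x) = r / 4"
      then show "norm (f x - f 0) \<le> 2 * (e * r + norm (f 0))"
        using norm_triangle_ineq4[of a "a - x"] r' by (intro bound) auto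
    qed (use r' f in \<open>auto intro!: holomorphic_intros continuous_intros
          intro: holomorphic_on_subset holomorphic_on_imp_continuous_on\<close>)
    also have "\<dots> = 8 * e + 8 * norm (f 0) / r" using r' by (simp add: field_simps)
    also have "8 * norm (f 0) / r \<le> e" using r' e by (simp add: field_simps)
    also have "(deriv ^^ 1) (\<lambda>t. f t - f 0) a = deriv f a"
      using holomorphic_on_imp_differentiable_at[OF f open_UNIV, of a] by simp
    finally show ?thesis by simp
  qed
  from this[of "norm (deriv f a) / 18"] show ?thesis by (cases "deriv f a = 0") auto
qed

end

text \<open>The function \<open>A\<close> measures the growth of the exponentials. All of them turn out to be small with respect
  to \<open>A\<close>, so \<open>A\<close> is bounded by its own logarithm.\<close>

lemma no_generic_entire_solution:
  fixes e :: "'a \<Rightarrow> complex \<Rightarrow> complex" and q :: "'a \<Rightarrow> 'a \<Rightarrow> complex"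
  assumes fin: "finite S" and ne: "S \<noteq> {}"
    and ode: "\<And>i t. i \<in> S \<Longrightarrow> (e i has_field_derivative (\<Sum>j\<in>S. q i j * exp (e j t))) (at t)"
    and hit: "\<And>j. j \<in> S \<Longrightarrow> \<exists>i\<in>S. q i j \<noteq> 0"
    and generic: "\<And>i J. i \<in> S \<Longrightarrow> J \<subseteq> {j \<in> S. q i j \<noteq> 0} \<Longrightarrow> J \<noteq> {} \<Longrightarrow>
      (\<Sum>j\<in>J. q i j * exp (e j 0)) \<noteq> 0"
  shows False
proof -
  have hol: "e i holomorphic_on UNIV" if "i \<in> S" for i
    using ode[OF that] by (auto simp: holomorphic_on_def field_differentiable_def intro: DERIV_subset)
  define F where "F t = (\<Sum>i\<in>S. max 0 (Re (e i t)))" for t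
  \<comment> \<open>\<open>max 0 r\<close> keeps the disc nonempty, so that \<open>A\<close> is
    nonnegative and monotone on all reals.\<close>
  define A where "A r = (SUP t\<in>cball 0 (max 0 r). F t)" for r :: real
  have contF: "continuous_on X F" for X
    unfolding F_def
    by (intro continuous_intros continuous_on_subset[OF holomorphic_on_imp_continuous_on[OF hol]]) auto
  have bdd: "bdd_above (F ` cball 0 r)" for r
    using compact_continuous_image[OF contF compact_cball] by (simp add: bounded_imp_bdd_above compact_imp_bounded)
  have F_le: "F t \<le> A r" if "norm t \<le> r" for t r
    unfolding A_def using that by (intro cSUP_upper bdd) auto
  have A_le: "A r \<le> B" if "0 \<le> r" "\<And>t. norm t \<le> r \<Longrightarrow> F t \<le> B" for r B
    unfolding A_def by (rule cSUP_least) (use that in auto)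
  have F_nonneg: "0 \<le> F t" for t unfolding F_def by (intro sum_nonneg) auto
  interpret growth A
  proof
    show "0 \<le> A r" for r
      unfolding A_def by (rule order_trans[OF F_nonneg cSUP_upper[OF _ bdd, of 0]]) auto
    show "A r \<le> A s" if "r \<le> s" for r s
      unfolding A_def using that by (intro cSUP_subset_mono bdd) auto
  qed
  have Re_le: "Re (e i t) \<le> A (norm t)" if "i \<in> S" for i t
  proof -
    have "Re (e i t) \<le> max 0 (Re (e i t))" by simp
    also have "\<dots> \<le> F t" unfolding F_def by (rule member_le_sum) (use that fin in auto)
    finally show ?thesis using F_le[of t "norm t"] by simp
  qed
  have sm_e: "small (e i)" if "i \<in> S" for i
    by (rule small_of_Re_le[OF hol[OF that] Re_le[OF that]])
  have de: "(\<Sum>j\<in>S. q i j * exp (e j t)) = deriv (e i) t" if "i \<in> S" for i t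
    using DERIV_imp_deriv[OF ode[OF that]] by simp
  have sm_exp: "small (\<lambda>t. exp (e j t))" if j: "j \<in> S" for j
  proof (rule ccontr)
    assume "\<not> ?thesis"
    obtain i where i: "i \<in> S" "q i j \<noteq> 0" using hit[OF j] by blast
    \<comment> \<open>The small exponentials in the equation for \<open>e i\<close> are moved to the
      side of the derivative. The rest is a small sum that genericity keeps from vanishing at 0, so
      one of its terms is small after all.\<close>
    define J where "J = {l \<in> S. q i l \<noteq> 0 \<and> \<not> small (\<lambda>t. exp (e l t))}"
    have J: "J \<subseteq> S" "j \<in> J" using j i \<open>\<not> small _\<close> by (auto simp: J_def)
    have "small (\<lambda>t. deriv (e i) t - (\<Sum>l\<in>S - J. q i l * exp (e l t)))"
    proof (intro small_diff small_sum small_deriv sm_e i)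
      show "small (\<lambda>t. q i l * exp (e l t))" if "l \<in> S - J" for l
        using that by (cases "q i l = 0") (auto simp: J_def)
    qed
    moreover have "deriv (e i) t - (\<Sum>l\<in>S - J. q i l * exp (e l t)) = (\<Sum>l\<in>J. q i l * exp (e l t))" for t
      using sum.subset_diff[OF J(1) fin, of "\<lambda>l. q i l * exp (e l t)"] de[OF i(1), of t] by simp
    ultimately have sm: "small (\<lambda>t. \<Sum>l\<in>J. q i l * exp (e l t))" by simp
    have nz: "(\<Sum>l\<in>J. q i l * exp (e l 0)) \<noteq> 0"
      using J by (intro generic i) (auto simp: J_def)
    obtain l where "l \<in> J" "small (\<lambda>t. exp (e l t))"
    proof (rule exists_small_of_sum[OF _ _ _ sm nz])
      show "finite J" using J(1) fin by (rule finite_subset)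
      show "small (deriv (e l))" if "l \<in> J" for l using that J by (intro small_deriv sm_e) auto
      show "((\<lambda>t. exp (e l t)) has_field_derivative deriv (e l) t * exp (e l t)) (at t)" if "l \<in> J" for l t
        using that J ode[of l t] DERIV_imp_deriv[OF ode[of l t]] by (auto intro!: derivative_eq_intros)
    qed blast
    then show False by (simp add: J_def)
  qed
  \<comment> \<open>Smallness of \<open>exp (e i)\<close> is an upper bound for
    \<open>Re (e i)\<close> itself; adding these bounds one index at a time yields a common
    \<open>C\<close> and \<open>k\<close> for the sum defining \<open>F\<close>.\<close>
  have "\<exists>C\<ge>0. \<exists>k. \<forall>r d t. 1 \<le> r \<longrightarrow> 0 < d \<longrightarrow> d \<le> r \<longrightarrow> norm t \<le> r \<longrightarrow>
      (\<Sum>i\<in>T. max 0 (Re (e i t))) \<le> C * (r / d) ^ k * lam r d" if "T \<subseteq> S" for T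
    using finite_subset[OF that fin] that
  proof (induction T rule: finite_induct)
    case empty
    show ?case by (intro exI[of _ 0]) auto
  next
    case (insert i T)
    then obtain C k where C: "0 \<le> C" "\<And>r d t. 1 \<le> r \<Longrightarrow> 0 < d \<Longrightarrow> d \<le> r \<Longrightarrow> norm t \<le> r \<Longrightarrow>
      (\<Sum>i\<in>T. max 0 (Re (e i t))) \<le> C * (r / d) ^ k * lam r d" by blast
    obtain C' k' where C': "0 \<le> C'" "\<And>r d t. 1 \<le> r \<Longrightarrow> 0 < d \<Longrightarrow> d \<le> r \<Longrightarrow> norm t \<le> r \<Longrightarrow>
      norm (exp (e i t)) \<le> exp (C' * (r / d) ^ k' * lam r d)"
      using smallE[OF sm_exp[of i]] insert.prems by (metis insert_subset)
    show ?case
    proof (rule exI[of _ "C' + C"], intro conjI exI[of _ "max k' k"] allI impI)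
      fix r d :: real and t :: complex
      assume r: "1 \<le> r" "0 < d" "d \<le> r" "norm t \<le> r"
      have "0 \<le> C' * (r / d) ^ k' * lam r d"
        using power_lam_ge[OF r(1-3) C'(1), of k'] C'(1) by linarith
      then have "max 0 (Re (e i t)) \<le> C' * (r / d) ^ k' * lam r d" using C'(2)[OF r] by simp
      also have "\<dots> \<le> C' * (r / d) ^ max k' k * lam r d"
        by (rule power_lam_mono) (use r C' in auto)
      finally have 1: "max 0 (Re (e i t)) \<le> C' * (r / d) ^ max k' k * lam r d" .
      have 2: "(\<Sum>i\<in>T. max 0 (Re (e i t))) \<le> C * (r / d) ^ max k' k * lam r d"
        using C(2)[OF r] power_lam_mono[OF r(1-3) C(1), of C k "max k' k"] by simp
      show "(\<Sum>i\<in>insert i T. max 0 (Re (e i t))) \<le> (C' + C) * (r / d) ^ max k' k * lam r d"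
        using add_mono[OF 1 2] unfolding sum.insert[OF insert.hyps(1,2)] distrib_right .
    qed (use C C' in auto)
  qed
  then obtain C k where C: "0 \<le> C" "\<And>r d t. 1 \<le> r \<Longrightarrow> 0 < d \<Longrightarrow> d \<le> r \<Longrightarrow> norm t \<le> r \<Longrightarrow>
      F t \<le> C * (r / d) ^ k * lam r d" unfolding F_def by blast
  have self: "A r \<le> C * (r / d) ^ k * lam r d" if r: "1 \<le> r" "0 < d" "d \<le> r" for r d
    using r by (intro A_le C(2)) auto
  have sub: "\<exists>r\<ge>r0. A r \<le> \<epsilon> * r" if "0 < \<epsilon>" for \<epsilon> r0
    using sublinear_of_self_bound[OF C(1) self that] by metis
  obtain j where j: "j \<in> S" using ne by blast
  obtain i where i: "i \<in> S" "q i j \<noteq> 0" using hit[OF j] by blast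
  \<comment> \<open>The right-hand side then vanishes at 0, against genericity for the set of all
    indices occurring in it.\<close>
  have "deriv (e i) 0 = 0"
    by (rule deriv_zero_of_sublinear[OF hol[OF i(1)] Re_le[OF i(1)] sub])
  then have "(\<Sum>j\<in>S. q i j * exp (e j 0)) = 0" using de[OF i(1), of 0] by simp
  also have "(\<Sum>j\<in>S. q i j * exp (e j 0)) = (\<Sum>j\<in>{j \<in> S. q i j \<noteq> 0}. q i j * exp (e j 0))"
    using fin by (intro sum.mono_neutral_right) auto
  finally show False using generic[OF i(1) subset_refl] i j by auto
qed

subsection \<open>Exponents and unimodular changes of variables\<close>

text \<open>The weights \<open>s ^ i\<close> turn an exponent vector into the value at
  \<open>s\<close> of a polynomial. Distinct vectors give distinct polynomials, and \<open>s\<close>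
  avoids the finitely many roots of their differences.\<close>

lemma exists_separating_weights:
  fixes S :: "(nat \<Rightarrow>\<^sub>0 int) set"
  assumes fin: "finite S" and keys: "\<And>m. m \<in> S \<Longrightarrow> Poly_Mapping.keys m \<subseteq> {..<n}"
  obtains x :: "nat \<Rightarrow> int" where "inj_on (\<lambda>m. \<Sum>i<n. Poly_Mapping.lookup m i * x i) S"
proof -
  define P where "P m = (\<Sum>i<n. monom (Poly_Mapping.lookup m i) i)" for m :: "nat \<Rightarrow>\<^sub>0 int"
  have coeff_P: "coeff (P m) j = (if j < n then Poly_Mapping.lookup m j else 0)" for m j
    by (simp add: P_def coeff_sum sum.delta)
  have "P m \<noteq> P m'" if m: "m \<in> S" "m' \<in> S" "m \<noteq> m'" for m m'
  proof
    assume eq: "P m = P m'"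
    have "Poly_Mapping.lookup m j = Poly_Mapping.lookup m' j" for j
    proof (cases "j < n")
      case True
      then show ?thesis using coeff_P[of m j] coeff_P[of m' j] eq by simp
    next
      case False
      then have "j \<notin> Poly_Mapping.keys m" "j \<notin> Poly_Mapping.keys m'" using keys m by auto
      then show ?thesis by (simp add: in_keys_iff)
    qed
    with m(3) show False by (simp add: poly_mapping_eqI)
  qed
  then have "finite {s. poly (P m - P m') s = 0}" if "m \<in> S" "m' \<in> S" "m \<noteq> m'" for m m'
    using that by (intro poly_roots_finite) auto
  then have "finite (\<Union>(m, m') \<in> {(m, m') \<in> S \<times> S. m \<noteq> m'}. {s. poly (P m - P m') s = 0})"
    using fin by (intro finite_UN_I finite_subset[OF _ finite_cartesian_product[OF fin fin]]) auto
  then obtain s where s: "s \<notin> (\<Union>(m, m') \<in> {(m, m') \<in> S \<times> S. m \<noteq> m'}. {s. poly (P m - P m') s = 0})"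
    using ex_new_if_finite[OF infinite_UNIV_int] by blast
  have "(\<Sum>i<n. Poly_Mapping.lookup m i * s ^ i) = poly (P m) s" for m
    by (simp add: P_def poly_sum poly_monom)
  moreover have "inj_on (\<lambda>m. poly (P m) s) S"
    using s by (force simp: inj_on_def)
  ultimately have "inj_on (\<lambda>m. \<Sum>i<n. Poly_Mapping.lookup m i * s ^ i) S" by simp
  then show thesis by (rule that)
qed

text \<open>Factoring out the lowest frequency \<open>N\<close> leaves a nonzero polynomial in
  \<open>exp \<tau>\<close>, and the exponential is injective on real \<open>\<tau>\<close>.\<close>

lemma finite_zeros_exponential_sum:
  fixes a :: "'a \<Rightarrow> complex" and k :: "'a \<Rightarrow> int"
  assumes fin: "finite J" and ne: "J \<noteq> {}" and a: "\<And>j. j \<in> J \<Longrightarrow> a j \<noteq> 0" and inj: "inj_on k J"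
  shows "finite {\<tau>::real. (\<Sum>j\<in>J. a j * exp (of_int (k j) * of_real \<tau>)) = 0}"
proof -
  define N where "N = Min (k ` J)"
  have N: "N \<le> k j" if "j \<in> J" for j using that fin by (simp add: N_def)
  define P where "P = (\<Sum>j\<in>J. monom (a j) (nat (k j - N)))"
  obtain j0 where j0: "j0 \<in> J" using ne by blast
  have "coeff P (nat (k j0 - N)) = (\<Sum>j\<in>J. if j = j0 then a j else 0)"
    unfolding P_def coeff_sum
  proof (intro sum.cong refl)
    fix j assume j: "j \<in> J"
    have "nat (k j - N) = nat (k j0 - N) \<longleftrightarrow> j = j0"
      using N[OF j] N[OF j0] inj j j0 by (auto simp: inj_on_def)
    then show "coeff (monom (a j) (nat (k j - N))) (nat (k j0 - N)) = (if j = j0 then a j else 0)" by auto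
  qed
  then have "coeff P (nat (k j0 - N)) = a j0" using fin j0 by simp
  then have "P \<noteq> 0" using a[OF j0] by auto
  then have fin_roots: "finite {z. poly P z = 0}" by (rule poly_roots_finite)
  have inj_exp: "inj_on (\<lambda>\<tau>::real. exp (of_real \<tau> :: complex)) X" for X
    by (auto simp: inj_on_def exp_of_real)
  have "(\<Sum>j\<in>J. a j * exp (of_int (k j) * of_real \<tau>)) = exp (of_int N * of_real \<tau>) * poly P (exp (of_real \<tau>))"
    for \<tau> :: real
    unfolding P_def poly_sum sum_distrib_left
  proof (intro sum.cong refl)
    fix j assume j: "j \<in> J"
    have "exp (of_int (k j) * of_real \<tau> :: complex) = exp (of_int N * of_real \<tau> + of_nat (nat (k j - N)) * of_real \<tau>)"
      using N[OF j] by (simp add: algebra_simps)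
    then show "a j * exp (of_int (k j) * of_real \<tau>) =
        exp (of_int N * of_real \<tau>) * poly (monom (a j) (nat (k j - N))) (exp (of_real \<tau>))"
      by (simp add: poly_monom exp_add exp_of_nat_mult)
  qed
  then have "{\<tau>::real. (\<Sum>j\<in>J. a j * exp (of_int (k j) * of_real \<tau>)) = 0} =
      (\<lambda>\<tau>::real. exp (of_real \<tau> :: complex)) -` {z. poly P z = 0}" by auto
  then show ?thesis using finite_vimageI[OF fin_roots inj_exp] by simp
qed

text \<open>A rational functional on the complex numbers that does not kill the chosen coordinate turns the
  complex relation into a rational one; clearing denominators makes it integral.\<close>

lemma exists_integer_orthogonal:
  fixes S :: "(nat \<Rightarrow> int) set" and v :: "nat \<Rightarrow> complex"
  assumes orth: "\<And>m. m \<in> S \<Longrightarrow> (\<Sum>i<n. of_int (m i) * v i) = 0" and i0: "i0 < n" "v i0 \<noteq> 0"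
  obtains w :: "nat \<Rightarrow> int" where "\<exists>i<n. w i \<noteq> 0" "\<And>m. m \<in> S \<Longrightarrow> (\<Sum>i<n. m i * w i) = 0"
proof -
  interpret Q: vector_space "\<lambda>(r::rat) (z::complex). of_rat r * z"
    by unfold_locales (simp_all add: algebra_simps of_rat_add of_rat_mult)
  interpret Q1: vector_space "\<lambda>(r::rat) (z::rat). r * z"
    by unfold_locales (simp_all add: algebra_simps)
  interpret QQ: vector_space_pair "\<lambda>(r::rat) (z::complex). of_rat r * z" "\<lambda>(r::rat) (z::rat). r * z"
    by unfold_locales
  have "Q.independent {v i0}" using i0 by (simp add: Q.dependent_single)
  then obtain f where f: "Vector_Spaces.linear (\<lambda>(r::rat) (z::complex). of_rat r * z) (\<lambda>(r::rat) (z::rat). r * z) f"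
      "f (v i0) = 1"
    using QQ.linear_independent_extend[of "{v i0}" "\<lambda>_. 1"] by auto
  interpret f: Vector_Spaces.linear "\<lambda>(r::rat) (z::complex). of_rat r * z" "\<lambda>(r::rat) (z::rat). r * z" f
    by (rule f(1))
  have f_int: "f (of_int k * z) = of_int k * f z" for k z
    using f.scale[of "of_int k" z] by simp
  have rel: "(\<Sum>i<n. of_int (m i) * f (v i)) = 0" if "m \<in> S" for m
  proof -
    have "f (\<Sum>i<n. of_int (m i) * v i) = (\<Sum>i<n. of_int (m i) * f (v i))"
      by (simp add: f.sum f_int)
    then show ?thesis using orth[OF that] f.zero by simp
  qed
  define D where "D = (\<Prod>i<n. snd (quotient_of (f (v i))))"
  have pos: "snd (quotient_of r) > 0" for r by (rule quotient_of_denom_pos')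
  have "\<exists>k. of_int D * f (v i) = of_int k" if "i < n" for i
  proof -
    have "D = snd (quotient_of (f (v i))) * (\<Prod>j\<in>{..<n} - {i}. snd (quotient_of (f (v j))))"
      unfolding D_def using that by (intro prod.remove) auto
    moreover have "of_int (snd (quotient_of (f (v i)))) * f (v i) = of_int (fst (quotient_of (f (v i))))"
      using quotient_of_div[of "f (v i)" "fst (quotient_of (f (v i)))" "snd (quotient_of (f (v i)))"] pos[of "f (v i)"]
      by (simp add: field_simps)
    ultimately have "of_int D * f (v i) =
        of_int (fst (quotient_of (f (v i))) * (\<Prod>j\<in>{..<n} - {i}. snd (quotient_of (f (v j)))))"
      by (simp add: mult_ac)
    then show ?thesis by blast
  qed
  then obtain w where w: "\<And>i. i < n \<Longrightarrow> of_int D * f (v i) = of_int (w i)" by metis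
  have D: "D > 0" unfolding D_def using pos by (intro prod_pos) auto
  have "of_int (w i0) = (of_int D :: rat)" using w[OF i0(1)] f(2) by simp
  then have "w i0 \<noteq> 0" using D by simp
  moreover have "(\<Sum>i<n. m i * w i) = 0" if "m \<in> S" for m
  proof -
    have "of_int (\<Sum>i<n. m i * w i) = of_int D * (\<Sum>i<n. of_int (m i) * f (v i))"
      unfolding of_int_sum sum_distrib_left
      by (intro sum.cong refl) (simp add: w[symmetric] mult_ac)
    then show ?thesis using rel[OF that] by (metis of_int_eq_0_iff mult_zero_right)
  qed
  ultimately show thesis using that i0 by blast
qed

text \<open>Carrying the integer inverse along, in both orders, replaces any condition on
  determinants.\<close>

definition unimodular_pair :: "nat \<Rightarrow> (nat \<Rightarrow> nat \<Rightarrow> int) \<Rightarrow> (nat \<Rightarrow> nat \<Rightarrow> int) \<Rightarrow> bool" where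
  "unimodular_pair n V W \<longleftrightarrow>
     (\<forall>i<n. \<forall>j<n. (\<Sum>k<n. V i k * W k j) = (if i = j then 1 else 0)) \<and>
     (\<forall>i<n. \<forall>j<n. (\<Sum>k<n. W i k * V k j) = (if i = j then 1 else 0))"

text \<open>\<open>V\<close> is multiplied on the right by the elementary matrix
  \<open>1 + c E_ab\<close> and \<open>W\<close> on the left by its inverse
  \<open>1 - c E_ab\<close>: a column operation on \<open>V\<close>, a row operation on
  \<open>W\<close>.\<close>

lemma unimodular_pair_add_row:
  assumes VW: "unimodular_pair n V W" and ab: "a < n" "b < n" "a \<noteq> b"
  shows "unimodular_pair n (\<lambda>i j. V i j + (if j = b then c * V i a else 0))
           (\<lambda>i j. W i j - (if i = a then c * W b j else 0))"
proof -
  have VW1: "(\<Sum>k<n. V i k * W k j) = (if i = j then 1 else 0)" if "i < n" "j < n" for i j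
    using VW that by (simp add: unimodular_pair_def)
  have VW2: "(\<Sum>k<n. W i k * V k j) = (if i = j then 1 else 0)" if "i < n" "j < n" for i j
    using VW that by (simp add: unimodular_pair_def)
  have "(\<Sum>k<n. (V i k + (if k = b then c * V i a else 0)) * (W k j - (if k = a then c * W b j else 0))) =
      (if i = j then 1 else 0)" if ij: "i < n" "j < n" for i j
  proof -
    have "(\<Sum>k<n. (V i k + (if k = b then c * V i a else 0)) * (W k j - (if k = a then c * W b j else 0))) =
      (\<Sum>k<n. V i k * W k j) + (\<Sum>k<n. if k = b then c * V i a * W k j else 0)
        - (\<Sum>k<n. if k = a then V i k * c * W b j else 0)"
      unfolding sum.distrib[symmetric] sum_subtractf[symmetric] using ab
      by (intro sum.cong) (auto simp: algebra_simps)
    also have "\<dots> = (\<Sum>k<n. V i k * W k j)" using ab by simp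
    finally show ?thesis using VW1[OF ij] by simp
  qed
  moreover have "(\<Sum>k<n. (W i k - (if i = a then c * W b k else 0)) * (V k j + (if j = b then c * V k a else 0))) =
      (if i = j then 1 else 0)" if ij: "i < n" "j < n" for i j
  proof -
    have "(\<Sum>k<n. (W i k - (if i = a then c * W b k else 0)) * (V k j + (if j = b then c * V k a else 0))) =
      (\<Sum>k<n. W i k * V k j) + (if j = b then c * (\<Sum>k<n. W i k * V k a) else 0)
        - (if i = a then c * (\<Sum>k<n. W b k * V k j) else 0)
        - (if i = a \<and> j = b then c * c * (\<Sum>k<n. W b k * V k a) else 0)"
      by (cases "j = b"; cases "i = a")
        (simp_all add: sum.distrib sum_subtractf sum_distrib_left algebra_simps)
    also have "\<dots> = (if i = j then 1 else 0)"
      using ab ij by (simp add: VW2)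
    finally show ?thesis .
  qed
  ultimately show ?thesis by (simp add: unimodular_pair_def)
qed

lemma unimodular_pair_swap:
  assumes VW: "unimodular_pair n V W" and ab: "a < n" "b < n"
  shows "unimodular_pair n (\<lambda>i. V (Transposition.transpose a b i)) (\<lambda>i j. W i (Transposition.transpose a b j))"
proof -
  let ?t = "Transposition.transpose a b"
  have t: "?t i < n" if "i < n" for i using that ab by (auto simp: Transposition.transpose_def)
  have "(\<Sum>k<n. W i (?t k) * V (?t k) j) = (\<Sum>k<n. W i k * V k j)" for i j
    by (rule sum.reindex_bij_witness[of _ ?t ?t]) (auto simp: t)
  moreover have "?t i = ?t j \<longleftrightarrow> i = j" for i j by (metis transpose_involutory)
  ultimately show ?thesis using VW t by (auto simp: unimodular_pair_def)
qed

text \<open>The Euclidean algorithm on the entries, one subtraction at a time.\<close>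

lemma exists_unimodular_annihilator:
  fixes w :: "nat \<Rightarrow> int"
  assumes n: "1 \<le> n"
  obtains V W where "unimodular_pair n V W" "\<And>i. i < n - 1 \<Longrightarrow> (\<Sum>j<n. V i j * w j) = 0"
proof -
  have "\<exists>V W. unimodular_pair n V W \<and> (\<forall>i<n - 1. (\<Sum>j<n. V i j * w j) = 0)"
  proof (induction "nat (\<Sum>j<n. \<bar>w j\<bar>)" arbitrary: w rule: less_induct)
    case less
    show ?case
    proof (cases "\<exists>a<n. \<exists>b<n. a \<noteq> b \<and> w a \<noteq> 0 \<and> w b \<noteq> 0")
      case True
      then obtain a b where ab: "a < n" "b < n" "a \<noteq> b" "w a \<noteq> 0" "w b \<noteq> 0" "\<bar>w b\<bar> \<le> \<bar>w a\<bar>"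
        by (metis linorder_linear)
      \<comment> \<open>The sign moves \<open>w a\<close> towards 0, and since \<open>w b\<close> is
        nonzero and not larger in absolute value, the absolute value drops strictly.\<close>
      define c where "c = (if w a * w b > 0 then - 1 else 1 :: int)"
      have dec: "\<bar>w a + c * w b\<bar> < \<bar>w a\<bar>"
        using ab by (auto simp: c_def zero_less_mult_iff abs_if split: if_splits)
      define w' where "w' = w(a := w a + c * w b)"
      have "(\<Sum>j<n. \<bar>w' j\<bar>) < (\<Sum>j<n. \<bar>w j\<bar>)"
        by (rule sum_strict_mono_ex1) (use dec ab in \<open>auto simp: w'_def\<close>)
      moreover have "0 \<le> (\<Sum>j<n. \<bar>w' j\<bar>)" by (intro sum_nonneg) auto
      ultimately obtain V W where V: "unimodular_pair n V W" "\<And>i. i < n - 1 \<Longrightarrow> (\<Sum>j<n. V i j * w' j) = 0"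
        using less[of w'] by (metis nat_mono_iff order_le_less_trans)
      \<comment> \<open>Here \<open>w' = (1 + c E_ab) w\<close>, so multiplying \<open>V\<close> by
        the same elementary matrix transfers the annihilation from \<open>w'\<close> to
        \<open>w\<close>.\<close>
      have "(\<Sum>j<n. (V i j + (if j = b then c * V i a else 0)) * w j) = (\<Sum>j<n. V i j * w' j)" for i
      proof -
        have "(\<Sum>j<n. (V i j + (if j = b then c * V i a else 0)) * w j) =
            (\<Sum>j<n. V i j * w j) + (\<Sum>j<n. if j = b then c * V i a * w j else 0)"
          unfolding sum.distrib[symmetric] by (intro sum.cong) (auto simp: algebra_simps)
        moreover have "(\<Sum>j<n. V i j * w' j) = (\<Sum>j<n. V i j * w j) + (\<Sum>j<n. if j = a then V i j * (c * w b) else 0)"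
          unfolding sum.distrib[symmetric] by (intro sum.cong) (auto simp: w'_def algebra_simps)
        ultimately show ?thesis using ab by (simp add: mult_ac)
      qed
      then show ?thesis using unimodular_pair_add_row[OF V(1) ab(1-3), of c] V(2)
        by (intro exI[of _ "\<lambda>i j. V i j + (if j = b then c * V i a else 0)"]
            exI[of _ "\<lambda>i j. W i j - (if i = a then c * W b j else 0)"]) auto
    next
      case False
      then obtain a where a: "a < n" "\<And>j. j < n \<Longrightarrow> j \<noteq> a \<Longrightarrow> w j = 0" using n
        by (metis One_nat_def Suc_le_lessD)
      let ?t = "Transposition.transpose a (n - 1)"
      have "unimodular_pair n (\<lambda>i j. if i = j then 1 else 0) (\<lambda>i j. if i = j then 1 else 0)"
        by (auto simp: unimodular_pair_def if_distrib[of "\<lambda>x. x * _"] cong: if_cong)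
      from unimodular_pair_swap[OF this a(1), of "n - 1"] n
      have "unimodular_pair n (\<lambda>i j. if ?t i = j then 1 else 0) (\<lambda>i j. if i = ?t j then 1 else 0)" by simp
      moreover have "(\<Sum>j<n. (if ?t i = j then 1 else 0) * w j) = 0" if "i < n - 1" for i
      proof (intro sum.neutral ballI)
        fix j assume "j \<in> {..<n}"
        moreover have "?t i \<noteq> a" using that by (auto simp: Transposition.transpose_def)
        ultimately show "(if ?t i = j then 1 else 0) * w j = 0" using a by auto
      qed
      ultimately show ?thesis by blast
    qed
  qed
  then show thesis using that by blast
qed

subsection \<open>Laurent polynomials in logarithmic coordinates\<close>

definition pairing :: "(nat \<Rightarrow>\<^sub>0 int) \<Rightarrow> (nat \<Rightarrow> complex) \<Rightarrow> complex" where
  "pairing m v = (\<Sum>i\<in>Poly_Mapping.keys m. of_int (Poly_Mapping.lookup m i) * v i)"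

text \<open>The linear map of group rings induced by a map of exponents; coefficients of exponents
  with equal images add up. For \<open>frag_extend e\<close> it is substitution of the monomials
  with exponents \<open>e i\<close>.\<close>

definition expo_push :: "((nat \<Rightarrow>\<^sub>0 int) \<Rightarrow> nat \<Rightarrow>\<^sub>0 int) \<Rightarrow> laurent \<Rightarrow> laurent" where
  "expo_push \<phi> P = (\<Sum>m\<in>Poly_Mapping.keys P. Poly_Mapping.single (\<phi> m) (Poly_Mapping.lookup P m))"

text \<open>The value at the point with coordinates \<open>exp (v i)\<close>, where negative powers
  need no side condition.\<close>

definition exp_eval :: "laurent \<Rightarrow> (nat \<Rightarrow> complex) \<Rightarrow> complex" where
  "exp_eval P v = (\<Sum>m\<in>Poly_Mapping.keys P. Poly_Mapping.lookup P m * exp (pairing m v))"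

lemma pairing_superset:
  assumes "Poly_Mapping.keys m \<subseteq> A" "finite A"
  shows "pairing m v = (\<Sum>i\<in>A. of_int (Poly_Mapping.lookup m i) * v i)"
  unfolding pairing_def using assms by (intro sum.mono_neutral_left) (auto simp: in_keys_iff)

lemma pairing_0 [simp]: "pairing 0 v = 0"
  by (simp add: pairing_def)

lemma pairing_add: "pairing (m + m') v = pairing m v + pairing m' v"
proof -
  let ?A = "Poly_Mapping.keys m \<union> Poly_Mapping.keys m'"
  have "pairing (m + m') v = (\<Sum>i\<in>?A. of_int (Poly_Mapping.lookup (m + m') i) * v i)"
    by (rule pairing_superset) (auto simp: in_keys_iff lookup_add)
  then show ?thesis
    by (simp add: pairing_superset[of m ?A] pairing_superset[of m' ?A] lookup_add sum.distrib algebra_simps)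
qed

lemma pairing_frag_cmul: "pairing (frag_cmul c m) v = of_int c * pairing m v"
proof -
  have "pairing (frag_cmul c m) v = (\<Sum>i\<in>Poly_Mapping.keys m. of_int (Poly_Mapping.lookup (frag_cmul c m) i) * v i)"
    by (rule pairing_superset) auto
  then show ?thesis by (simp add: pairing_def sum_distrib_left mult.assoc)
qed

lemma pairing_sum: "pairing (\<Sum>i\<in>I. m i) v = (\<Sum>i\<in>I. pairing (m i) v)"
  by (induction I rule: infinite_finite_induct) (simp_all add: pairing_add)

lemma pairing_frag_extend: "pairing (frag_extend e m) v = pairing m (\<lambda>i. pairing (e i) v)"
  unfolding frag_extend_def pairing_sum pairing_frag_cmul by (simp add: pairing_def)

lemma pairing_cong:
  assumes "\<And>i. i \<in> Poly_Mapping.keys m \<Longrightarrow> v i = w i"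
  shows "pairing m v = pairing m w"
  unfolding pairing_def using assms by (intro sum.cong) auto

lemma pairing_single [simp]: "pairing (Poly_Mapping.single i c) v = of_int c * v i"
  by (cases "c = 0") (auto simp: pairing_def)

lemma expo_push_superset:
  assumes "Poly_Mapping.keys P \<subseteq> A" "finite A"
  shows "expo_push \<phi> P = (\<Sum>m\<in>A. Poly_Mapping.single (\<phi> m) (Poly_Mapping.lookup P m))"
  unfolding expo_push_def using assms by (intro sum.mono_neutral_left) (auto simp: in_keys_iff)

lemma expo_push_0 [simp]: "expo_push \<phi> 0 = 0"
  by (simp add: expo_push_def)

lemma expo_push_add: "expo_push \<phi> (P + Q) = expo_push \<phi> P + expo_push \<phi> Q"
proof -
  let ?A = "Poly_Mapping.keys P \<union> Poly_Mapping.keys Q"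
  have "expo_push \<phi> (P + Q) = (\<Sum>m\<in>?A. Poly_Mapping.single (\<phi> m) (Poly_Mapping.lookup (P + Q) m))"
    by (rule expo_push_superset) (auto simp: in_keys_iff lookup_add)
  then show ?thesis
    by (simp add: expo_push_superset[of P ?A] expo_push_superset[of Q ?A] lookup_add single_add sum.distrib)
qed

lemma expo_push_sum: "expo_push \<phi> (\<Sum>i\<in>I. P i) = (\<Sum>i\<in>I. expo_push \<phi> (P i))"
  by (induction I rule: infinite_finite_induct) (simp_all add: expo_push_add)

lemma expo_push_single [simp]: "expo_push \<phi> (Poly_Mapping.single m c) = Poly_Mapping.single (\<phi> m) c"
  by (cases "c = 0") (auto simp: expo_push_def)

lemma lookup_laurent_const_mult: "Poly_Mapping.lookup (laurent_const c * P) m = c * Poly_Mapping.lookup P m"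
  unfolding laurent_const_def mult_map_scale_conv_mult[symmetric]
  by (simp add: Poly_Mapping.map.rep_eq when_def)

lemma laurent_const_mult_single: "laurent_const c * Poly_Mapping.single m x = Poly_Mapping.single m (c * x)"
  by (simp add: laurent_const_def mult_single)

lemma laurent_eq_sum_single: "(P :: laurent) = (\<Sum>m\<in>Poly_Mapping.keys P. Poly_Mapping.single m (Poly_Mapping.lookup P m))"
  by (rule poly_mapping_eqI) (auto simp: lookup_sum lookup_single when_def in_keys_iff)

lemma expo_push_const_mult: "expo_push \<phi> (laurent_const c * P) = laurent_const c * expo_push \<phi> P"
proof -
  have "laurent_const c * P = (\<Sum>m\<in>Poly_Mapping.keys P. Poly_Mapping.single m (c * Poly_Mapping.lookup P m))"
    by (subst laurent_eq_sum_single[of P]) (simp add: sum_distrib_left laurent_const_mult_single)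
  then show ?thesis
    by (simp add: expo_push_sum) (simp add: expo_push_def sum_distrib_left laurent_const_mult_single)
qed

lemma expo_push_const: "\<phi> 0 = 0 \<Longrightarrow> expo_push \<phi> (laurent_const c) = laurent_const c"
  by (simp add: laurent_const_def)

lemma expo_push_push: "expo_push \<phi> (expo_push \<psi> P) = expo_push (\<lambda>m. \<phi> (\<psi> m)) P"
  by (simp add: expo_push_def[of \<psi> P] expo_push_sum) (simp add: expo_push_def)

lemma expo_push_cong:
  assumes "\<And>m. m \<in> Poly_Mapping.keys P \<Longrightarrow> \<phi> m = \<psi> m"
  shows "expo_push \<phi> P = expo_push \<psi> P"
  unfolding expo_push_def using assms by (intro sum.cong) auto

lemma expo_push_ident:
  assumes "\<And>m. m \<in> Poly_Mapping.keys P \<Longrightarrow> \<phi> m = m"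
  shows "expo_push \<phi> P = P"
  using expo_push_cong[of P \<phi> "\<lambda>m. m"] assms laurent_eq_sum_single[of P] by (simp add: expo_push_def)

lemma exp_eval_superset:
  assumes "Poly_Mapping.keys P \<subseteq> A" "finite A"
  shows "exp_eval P v = (\<Sum>m\<in>A. Poly_Mapping.lookup P m * exp (pairing m v))"
  unfolding exp_eval_def using assms by (intro sum.mono_neutral_left) (auto simp: in_keys_iff)

lemma exp_eval_0 [simp]: "exp_eval 0 v = 0"
  by (simp add: exp_eval_def)

lemma exp_eval_add: "exp_eval (P + Q) v = exp_eval P v + exp_eval Q v"
proof -
  let ?A = "Poly_Mapping.keys P \<union> Poly_Mapping.keys Q"
  have "exp_eval (P + Q) v = (\<Sum>m\<in>?A. Poly_Mapping.lookup (P + Q) m * exp (pairing m v))"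
    by (rule exp_eval_superset) (auto simp: in_keys_iff lookup_add)
  then show ?thesis
    by (simp add: exp_eval_superset[of P ?A] exp_eval_superset[of Q ?A] lookup_add sum.distrib algebra_simps)
qed

lemma exp_eval_sum: "exp_eval (\<Sum>i\<in>I. P i) v = (\<Sum>i\<in>I. exp_eval (P i) v)"
  by (induction I rule: infinite_finite_induct) (simp_all add: exp_eval_add)

lemma exp_eval_single [simp]: "exp_eval (Poly_Mapping.single m c) v = c * exp (pairing m v)"
  by (cases "c = 0") (auto simp: exp_eval_def)

lemma exp_eval_const_mult: "exp_eval (laurent_const c * P) v = c * exp_eval P v"
proof -
  have "exp_eval (laurent_const c * P) v =
      (\<Sum>m\<in>Poly_Mapping.keys P. Poly_Mapping.lookup (laurent_const c * P) m * exp (pairing m v))"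
    by (rule exp_eval_superset) (auto simp: in_keys_iff lookup_laurent_const_mult)
  then show ?thesis
    by (simp add: exp_eval_def lookup_laurent_const_mult sum_distrib_left mult.assoc)
qed

text \<open>Monomial substitutions are linear in logarithmic coordinates.\<close>

lemma exp_eval_push: "exp_eval (expo_push (frag_extend e) P) v = exp_eval P (\<lambda>i. pairing (e i) v)"
  unfolding expo_push_def exp_eval_sum exp_eval_single pairing_frag_extend by (simp add: exp_eval_def)

lemma laurent_polys_0 [simp]: "0 \<in> laurent_polys n"
  by (simp add: laurent_polys_def)

lemma laurent_polys_add: "P \<in> laurent_polys n \<Longrightarrow> Q \<in> laurent_polys n \<Longrightarrow> P + Q \<in> laurent_polys n"
  using keys_add[of P Q] by (auto simp: laurent_polys_def)

lemma laurent_polys_sum: "(\<And>i. i \<in> I \<Longrightarrow> P i \<in> laurent_polys n) \<Longrightarrow> (\<Sum>i\<in>I. P i) \<in> laurent_polys n"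
  by (induction I rule: infinite_finite_induct) (simp_all add: laurent_polys_add)

lemma laurent_polys_const_mult: "P \<in> laurent_polys n \<Longrightarrow> laurent_const c * P \<in> laurent_polys n"
  by (auto simp: laurent_polys_def in_keys_iff lookup_laurent_const_mult)

lemma laurent_polys_const: "laurent_const c \<in> laurent_polys n"
  by (auto simp: laurent_polys_def laurent_const_def)

lemma laurent_polys_diff: "P \<in> laurent_polys n \<Longrightarrow> Q \<in> laurent_polys n \<Longrightarrow> P - Q \<in> laurent_polys n"
  unfolding laurent_polys_def
proof (rule CollectI, rule ballI)
  fix m assume PQ: "P \<in> {P. \<forall>m\<in>Poly_Mapping.keys P. Poly_Mapping.keys m \<subseteq> {..<n}}"
    "Q \<in> {P. \<forall>m\<in>Poly_Mapping.keys P. Poly_Mapping.keys m \<subseteq> {..<n}}" and "m \<in> Poly_Mapping.keys (P - Q)"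
  then have "m \<in> Poly_Mapping.keys P \<or> m \<in> Poly_Mapping.keys Q"
    by (auto simp: in_keys_iff lookup_minus)
  with PQ show "Poly_Mapping.keys m \<subseteq> {..<n}" by blast
qed

lemma laurent_polys_single: "Poly_Mapping.keys m \<subseteq> {..<n} \<Longrightarrow> Poly_Mapping.single m c \<in> laurent_polys n"
  by (auto simp: laurent_polys_def)

text \<open>The system in logarithmic coordinates \<open>z = exp \<circ> g\<close>, entirely solvable near \<open>\<gamma>\<^sub>0\<close>.\<close>

definition log_entire :: "nat \<Rightarrow> (nat \<Rightarrow> laurent) \<Rightarrow> (nat \<Rightarrow> complex) \<Rightarrow> real \<Rightarrow> bool" where
  "log_entire n p \<gamma>0 \<epsilon> \<longleftrightarrow> (\<forall>\<gamma>. (\<forall>i<n. norm (\<gamma> i - \<gamma>0 i) < \<epsilon>) \<longrightarrow>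
     (\<exists>g. \<forall>i<n. g i 0 = \<gamma> i \<and>
        (\<forall>t. (g i has_field_derivative exp_eval (p i) (\<lambda>j. g j t)) (at t))))"

text \<open>Otherwise every exponent occurs in the equation of some pairing, and only a generic
  initial value is missing for a contradiction. Along a real line in the direction of separating
  weights each partial sum is an exponential sum with distinct frequencies, so finitely many points
  of the line are bad and good ones lie arbitrarily near \<open>\<gamma>0\<close>.\<close>

lemma exists_coefficient_orthogonal_to_support:
  fixes p :: "nat \<Rightarrow> laurent"
  assumes p: "\<And>i. i < n \<Longrightarrow> p i \<in> laurent_polys n" and le: "log_entire n p \<gamma>0 \<epsilon>" "0 < \<epsilon>"
    and S: "S = (\<Union>i<n. Poly_Mapping.keys (p i))" "S \<noteq> {}"
  obtains m' where "m' \<in> S" "\<And>m. m \<in> S \<Longrightarrow> pairing m (\<lambda>i. Poly_Mapping.lookup (p i) m') = 0"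
proof -
  have "\<exists>m'\<in>S. \<forall>m\<in>S. pairing m (\<lambda>i. Poly_Mapping.lookup (p i) m') = 0"
  proof (rule ccontr)
    assume no: "\<not> ?thesis"
    have finS: "finite S" using S by simp
    have keysS: "Poly_Mapping.keys m \<subseteq> {..<n}" if "m \<in> S" for m
      using that p unfolding S by (auto simp: laurent_polys_def)
    define q where "q m m' = pairing m (\<lambda>i. Poly_Mapping.lookup (p i) m')" for m m'
    have hit: "\<exists>m\<in>S. q m m' \<noteq> 0" if "m' \<in> S" for m'
      using no that unfolding q_def by blast
    obtain x where x: "inj_on (\<lambda>m. \<Sum>i<n. Poly_Mapping.lookup m i * x i) S"
      using exists_separating_weights[OF finS keysS] by metis
    define k where "k m = (\<Sum>i<n. Poly_Mapping.lookup m i * x i)" for m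
    define \<gamma> where "\<gamma> \<tau> i = \<gamma>0 i + of_int (x i) * of_real \<tau>" for \<tau> :: real and i
    have pair_\<gamma>: "pairing m (\<gamma> \<tau>) = pairing m \<gamma>0 + of_int (k m) * of_real \<tau>" if "m \<in> S" for m \<tau>
      unfolding k_def of_int_sum sum_distrib_right pairing_superset[OF keysS[OF that] finite_lessThan]
        \<gamma>_def sum.distrib[symmetric]
      by (intro sum.cong refl) (simp add: algebra_simps)
    define bad where "bad m J = {\<tau>::real. (\<Sum>m'\<in>J. q m m' * exp (pairing m' (\<gamma> \<tau>))) = 0}" for m J
    have fin_bad: "finite (bad m J)" if "m \<in> S" "J \<subseteq> {m' \<in> S. q m m' \<noteq> 0}" "J \<noteq> {}" for m J
    proof -
      have "finite {\<tau>::real. (\<Sum>m'\<in>J. q m m' * exp (pairing m' \<gamma>0) * exp (of_int (k m') * of_real \<tau>)) = 0}"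
      proof (rule finite_zeros_exponential_sum)
        show "inj_on k J" using x inj_on_subset[of k S J] that(2) unfolding k_def by auto
      qed (use that finS in \<open>auto intro: finite_subset\<close>)
      moreover have "(\<Sum>m'\<in>J. q m m' * exp (pairing m' (\<gamma> \<tau>))) =
          (\<Sum>m'\<in>J. q m m' * exp (pairing m' \<gamma>0) * exp (of_int (k m') * of_real \<tau>))" for \<tau>
        using that(2) by (intro sum.cong refl) (auto simp: pair_\<gamma> exp_add)
      ultimately show ?thesis by (simp add: bad_def)
    qed
    define Bad where "Bad = (\<Union>(m, J) \<in> {(m, J). m \<in> S \<and> J \<subseteq> {m' \<in> S. q m m' \<noteq> 0} \<and> J \<noteq> {}}. bad m J)"
    have "finite {(m, J). m \<in> S \<and> J \<subseteq> {m' \<in> S. q m m' \<noteq> 0} \<and> J \<noteq> {}}"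
      by (rule finite_subset[of _ "S \<times> Pow S"]) (use finS in auto)
    then have "finite Bad" unfolding Bad_def using fin_bad by (intro finite_UN_I) auto
    \<comment> \<open>\<open>X\<close> exceeds every weight, so
      \<open>\<tau> < \<epsilon> / X\<close> keeps the initial value in the allowed
      neighbourhood.\<close>
    define X where "X = 1 + (\<Sum>i<n. \<bar>real_of_int (x i)\<bar>)"
    have X: "0 < X" "\<And>i. i < n \<Longrightarrow> \<bar>real_of_int (x i)\<bar> < X"
    proof -
      show "0 < X" unfolding X_def by (intro add_pos_nonneg sum_nonneg) auto
      show "\<bar>real_of_int (x i)\<bar> < X" if "i < n" for i
        using member_le_sum[of i "{..<n}" "\<lambda>i. \<bar>real_of_int (x i)\<bar>"] that by (simp add: X_def)
    qed
    have "infinite {0<..<\<epsilon> / X}" using X le(2) by (intro infinite_Ioo) simp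
    then obtain \<tau> where \<tau>: "0 < \<tau>" "\<tau> < \<epsilon> / X" "\<tau> \<notin> Bad"
      using \<open>finite Bad\<close> by (metis finite_subset greaterThanLessThan_iff subsetI)
    have "norm (\<gamma> \<tau> i - \<gamma>0 i) < \<epsilon>" if "i < n" for i
    proof -
      have "norm (\<gamma> \<tau> i - \<gamma>0 i) = \<bar>real_of_int (x i)\<bar> * \<tau>" using \<tau> by (simp add: \<gamma>_def norm_mult)
      also have "\<dots> \<le> X * \<tau>" using X(2)[OF that] \<tau> by (intro mult_right_mono) auto
      also have "\<dots> < \<epsilon>" using \<tau> X by (simp add: field_simps)
      finally show ?thesis .
    qed
    then obtain g where g: "\<And>i. i < n \<Longrightarrow> g i 0 = \<gamma> \<tau> i"
        "\<And>i t. i < n \<Longrightarrow> (g i has_field_derivative exp_eval (p i) (\<lambda>j. g j t)) (at t)"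
      using le(1) unfolding log_entire_def by metis
    define e where "e m t = pairing m (\<lambda>j. g j t)" for m t
    have e0: "e m 0 = pairing m (\<gamma> \<tau>)" if "m \<in> S" for m
      unfolding e_def using keysS[OF that] g(1) by (intro pairing_cong) auto
    show False
    proof (rule no_generic_entire_solution[OF finS S(2), of e q])
      show "(e m has_field_derivative (\<Sum>m'\<in>S. q m m' * exp (e m' t))) (at t)" if m: "m \<in> S" for m t
      proof -
        have "(e m has_field_derivative pairing m (\<lambda>i. exp_eval (p i) (\<lambda>j. g j t))) (at t)"
          unfolding e_def pairing_def using keysS[OF m] g(2) by (intro DERIV_sum DERIV_cmult) auto
        also have "pairing m (\<lambda>i. exp_eval (p i) (\<lambda>j. g j t)) =
            pairing m (\<lambda>i. \<Sum>m'\<in>S. Poly_Mapping.lookup (p i) m' * exp (e m' t))"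
          unfolding e_def using keysS[OF m] finS S by (intro pairing_cong exp_eval_superset) auto
        also have "\<dots> = (\<Sum>m'\<in>S. q m m' * exp (e m' t))"
          unfolding pairing_def q_def sum_distrib_left sum_distrib_right
          by (subst sum.swap) (simp add: mult.assoc)
        finally show ?thesis .
      qed
      show "(\<Sum>m'\<in>J. q m m' * exp (e m' 0)) \<noteq> 0" if "m \<in> S" "J \<subseteq> {m' \<in> S. q m m' \<noteq> 0}" "J \<noteq> {}" for m J
      proof -
        have "(\<Sum>m'\<in>J. q m m' * exp (e m' 0)) = (\<Sum>m'\<in>J. q m m' * exp (pairing m' (\<gamma> \<tau>)))"
          using that by (intro sum.cong) (auto simp: e0)
        then show ?thesis using \<tau>(3) that unfolding Bad_def bad_def by auto
      qed
    qed (use hit in auto)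
  qed
  then show thesis using that by blast
qed

subsection \<open>Reduction of the number of variables\<close>

text \<open>Here \<open>e k i\<close> is the exponent vector of the monomial \<open>M k i\<close> of the triangular form.\<close>

definition triangular_data ::
  "nat \<Rightarrow> (nat \<Rightarrow> laurent) \<Rightarrow> (nat \<Rightarrow> nat \<Rightarrow> complex) \<Rightarrow> (nat \<Rightarrow> laurent) \<Rightarrow>
    (nat \<Rightarrow> nat \<Rightarrow> nat \<Rightarrow> int) \<Rightarrow> (nat \<Rightarrow> nat \<Rightarrow> nat \<Rightarrow>\<^sub>0 int) \<Rightarrow> bool" where
  "triangular_data n p u \<theta> a e \<longleftrightarrow>
     (\<forall>k\<in>{1..n-1}. \<theta> k \<in> laurent_polys k) \<and>
     (\<forall>i<n. e n i = Poly_Mapping.single i 1) \<and>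
     (\<forall>k\<in>{2..n}. \<forall>i<k-1. e (k-1) i = (\<Sum>j<k. frag_cmul (a k i j) (e k j))) \<and>
     (\<forall>k\<in>{1..n}. \<forall>i<k. Poly_Mapping.keys (e k i) \<subseteq> {..<n}) \<and>
     (\<forall>k\<in>{1..n-1}. \<forall>i<k. pairing (e k i) (u k) = 0) \<and>
     (\<forall>i<n. p i = (\<Sum>k=1..n-1. laurent_const (u k i) * expo_push (frag_extend (e k)) (\<theta> k)) + laurent_const (u 0 i))"

lemma frag_extend_compose: "frag_extend f (frag_extend g m) = frag_extend (\<lambda>i. frag_extend f (g i)) m"
  by (subst (2) frag_extend_def) (simp add: frag_extend_sum frag_extend_def[of "\<lambda>i. frag_extend f (g i)"] frag_extend_cmul o_def)

lemma frag_extend_single [simp]: "frag_extend f (Poly_Mapping.single i c) = frag_cmul c (f i)"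
  by (cases "c = 0") (auto simp: frag_extend_def)

lemma frag_cmul_single [simp]: "frag_cmul c (Poly_Mapping.single i d) = Poly_Mapping.single i (c * d)"
  by (rule poly_mapping_eqI) (simp add: lookup_single when_def)

lemma laurent_const_0 [simp]: "laurent_const 0 = 0"
  by (simp add: laurent_const_def)

lemma laurent_const_mult: "laurent_const c * laurent_const d = laurent_const (c * d)"
  by (simp add: laurent_const_def mult_single)

lemma laurent_const_add: "laurent_const c + laurent_const d = laurent_const (c + d)"
  by (simp add: laurent_const_def single_add)

lemma laurent_const_sum: "(\<Sum>i\<in>I. laurent_const (c i)) = laurent_const (\<Sum>i\<in>I. c i)"
  by (induction I rule: infinite_finite_induct) (simp_all add: laurent_const_add)

text \<open>The new coordinates are those of \<open>V \<gamma>\<close> without the last. Each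
  \<open>p j\<close> depends on these alone, so they satisfy a closed system. Initial values are
  lifted through \<open>W\<close>, with the omitted coordinate kept at its base value.\<close>

lemma log_entire_reduce:
  assumes VW: "unimodular_pair (Suc n) V W"
    and le: "log_entire (Suc n) p \<gamma>0 \<epsilon>" "0 < \<epsilon>"
    and P: "\<And>j. j < Suc n \<Longrightarrow> P j \<in> laurent_polys n"
    and p: "\<And>j. j < Suc n \<Longrightarrow> p j = expo_push (frag_extend rw) (P j)"
    and rw: "\<And>i. rw i = (\<Sum>j<Suc n. Poly_Mapping.single j (V i j))"
  obtains \<eta>0 \<epsilon>' where "0 < \<epsilon>'"
    "log_entire n (\<lambda>i. \<Sum>j<Suc n. laurent_const (of_int (V i j)) * P j) \<eta>0 \<epsilon>'"
proof -
  have VW1: "(\<Sum>k<Suc n. V i k * W k j) = (if i = j then 1 else 0)" if "i < Suc n" "j < Suc n" for i j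
    using VW that by (simp add: unimodular_pair_def)
  have pairing_rw: "pairing (rw i) v = (\<Sum>j<Suc n. of_int (V i j) * v j)" for i v
    by (simp only: rw pairing_sum pairing_single)
  define X where "X = 1 + (\<Sum>j<Suc n. \<Sum>l<n. \<bar>real_of_int (W j l)\<bar>)"
  have X0: "0 < X" unfolding X_def by (intro add_pos_nonneg sum_nonneg) auto
  have X: "(\<Sum>l<n. \<bar>real_of_int (W j l)\<bar>) < X" if "j < Suc n" for j
    using member_le_sum[of j "{..<Suc n}" "\<lambda>j. \<Sum>l<n. \<bar>real_of_int (W j l)\<bar>"] that
    by (auto simp: X_def sum_nonneg)
  define \<eta>0 where "\<eta>0 i = (\<Sum>j<Suc n. of_int (V i j) * \<gamma>0 j)" for i
  have "log_entire n (\<lambda>i. \<Sum>j<Suc n. laurent_const (of_int (V i j)) * P j) \<eta>0 (\<epsilon> / X)"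
    unfolding log_entire_def
  proof (intro allI impI)
    fix \<eta> assume \<eta>: "\<forall>i<n. norm (\<eta> i - \<eta>0 i) < \<epsilon> / X"
    define \<gamma> where "\<gamma> j = \<gamma>0 j + (\<Sum>l<n. of_int (W j l) * (\<eta> l - \<eta>0 l))" for j
    have "norm (\<gamma> j - \<gamma>0 j) < \<epsilon>" if j: "j < Suc n" for j
    proof -
      have "norm (\<gamma> j - \<gamma>0 j) \<le> (\<Sum>l<n. norm (of_int (W j l) * (\<eta> l - \<eta>0 l)))"
        by (simp add: \<gamma>_def norm_sum)
      also have "\<dots> \<le> (\<Sum>l<n. \<bar>real_of_int (W j l)\<bar> * (\<epsilon> / X))"
        unfolding norm_mult norm_of_int using \<eta> by (intro sum_mono mult_left_mono) (auto simp: less_imp_le)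
      also have "\<dots> = (\<Sum>l<n. \<bar>real_of_int (W j l)\<bar>) * (\<epsilon> / X)" by (simp only: sum_distrib_right)
      also have "\<dots> < X * (\<epsilon> / X)" using X[OF j] le(2) X0 by (intro mult_strict_right_mono) auto
      also have "\<dots> = \<epsilon>" using X0 by simp
      finally show ?thesis .
    qed
    then obtain g where g: "\<And>j. j < Suc n \<Longrightarrow> g j 0 = \<gamma> j"
        "\<And>j t. j < Suc n \<Longrightarrow> (g j has_field_derivative exp_eval (p j) (\<lambda>i. g i t)) (at t)"
      using le(1) unfolding log_entire_def by metis
    define h where "h i t = (\<Sum>j<Suc n. of_int (V i j) * g j t)" for i t
    have V\<gamma>: "h i 0 = \<eta> i" if i: "i < n" for i
    proof -
      have "h i 0 = (\<Sum>j<Suc n. of_int (V i j) * \<gamma> j)"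
        unfolding h_def by (intro sum.cong refl) (simp add: g(1))
      also have "\<dots> = \<eta>0 i + (\<Sum>j<Suc n. \<Sum>l<n. of_int (V i j * W j l) * (\<eta> l - \<eta>0 l))"
        unfolding \<gamma>_def \<eta>0_def
        by (simp only: distrib_left sum.distrib sum_distrib_left of_int_mult mult.assoc)
      also have "(\<Sum>j<Suc n. \<Sum>l<n. of_int (V i j * W j l) * (\<eta> l - \<eta>0 l)) =
          (\<Sum>l<n. of_int (\<Sum>j<Suc n. V i j * W j l) * (\<eta> l - \<eta>0 l))"
        by (subst sum.swap) (simp only: of_int_sum sum_distrib_right)
      also have "\<dots> = (\<Sum>l<n. if l = i then \<eta> l - \<eta>0 l else 0)"
        using i by (intro sum.cong refl) (auto simp only: VW1 lessThan_iff less_SucI split: if_splits, auto)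
      also have "\<dots> = \<eta> i - \<eta>0 i" using i by simp
      finally show ?thesis by simp
    qed
    have dh: "(h i has_field_derivative
        exp_eval (\<Sum>j<Suc n. laurent_const (of_int (V i j)) * P j) (\<lambda>l. h l t)) (at t)" for i t
    proof -
      have "(h i has_field_derivative (\<Sum>j<Suc n. of_int (V i j) * exp_eval (p j) (\<lambda>i. g i t))) (at t)"
        unfolding h_def by (intro DERIV_sum DERIV_cmult g(2)) auto
      also have "(\<Sum>j<Suc n. of_int (V i j) * exp_eval (p j) (\<lambda>i. g i t)) =
          (\<Sum>j<Suc n. of_int (V i j) * exp_eval (P j) (\<lambda>l. h l t))"
      proof (intro sum.cong refl arg_cong2[of _ _ _ _ "(*)"])
        fix j assume "j \<in> {..<Suc n}"
        then show "exp_eval (p j) (\<lambda>i. g i t) = exp_eval (P j) (\<lambda>l. h l t)"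
          by (simp only: p exp_eval_push pairing_rw h_def lessThan_iff)
      qed
      finally show ?thesis by (simp only: exp_eval_sum exp_eval_const_mult)
    qed
    show "\<exists>h. \<forall>i<n. h i 0 = \<eta> i \<and> (\<forall>t. (h i has_field_derivative
        exp_eval (\<Sum>j<Suc n. laurent_const (of_int (V i j)) * P j) (\<lambda>j. h j t)) (at t))"
      using V\<gamma> dh by blast
  qed
  moreover have "0 < \<epsilon> / X" using le(2) X0 by simp
  ultimately show thesis using that by blast
qed

text \<open>Data of the reduced system are pulled back through \<open>W\<close>. What that system
  cannot see is a multiple of the last column of \<open>W\<close>; this column becomes
  \<open>u' n\<close>, and it is killed by the first \<open>n\<close> rows of \<open>V\<close>,
  which form the new matrix.\<close>

lemma triangular_data_extend:
  assumes n: "1 \<le> n" and VW: "unimodular_pair (Suc n) V W"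
    and P: "\<And>j. j < Suc n \<Longrightarrow> P j \<in> laurent_polys n"
    and p: "\<And>j. j < Suc n \<Longrightarrow> p j = expo_push (frag_extend rw) (P j)"
    and rw: "\<And>i. rw i = (\<Sum>j<Suc n. Poly_Mapping.single j (V i j))"
    and tri: "triangular_data n (\<lambda>i. \<Sum>j<Suc n. laurent_const (of_int (V i j)) * P j) u \<theta> a e"
  obtains u' \<theta>' a' e' where "triangular_data (Suc n) p u' \<theta>' a' e'"
proof -
  have VW1: "(\<Sum>k<Suc n. V i k * W k j) = (if i = j then 1 else 0)" if "i < Suc n" "j < Suc n" for i j
    using VW that by (simp add: unimodular_pair_def)
  have VW2: "(\<Sum>k<Suc n. W i k * V k j) = (if i = j then 1 else 0)" if "i < Suc n" "j < Suc n" for i j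
    using VW that by (simp add: unimodular_pair_def)
  have pairing_rw: "pairing (rw i) v = (\<Sum>j<Suc n. of_int (V i j) * v j)" for i v
    by (simp only: rw pairing_sum pairing_single)
  have keys_rw: "Poly_Mapping.keys (rw i) \<subseteq> {..<Suc n}" for i
    unfolding rw by (rule order_trans[OF keys_sum]) (auto split: if_splits)
  have t: "\<And>k. k \<in> {1..n-1} \<Longrightarrow> \<theta> k \<in> laurent_polys k"
    "\<And>i. i < n \<Longrightarrow> e n i = Poly_Mapping.single i 1"
    "\<And>k i. k \<in> {2..n} \<Longrightarrow> i < k-1 \<Longrightarrow> e (k-1) i = (\<Sum>j<k. frag_cmul (a k i j) (e k j))"
    "\<And>k i. k \<in> {1..n} \<Longrightarrow> i < k \<Longrightarrow> Poly_Mapping.keys (e k i) \<subseteq> {..<n}"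
    "\<And>k i. k \<in> {1..n-1} \<Longrightarrow> i < k \<Longrightarrow> pairing (e k i) (u k) = 0"
    "\<And>i. i < n \<Longrightarrow> (\<Sum>j<Suc n. laurent_const (of_int (V i j)) * P j) =
       (\<Sum>k=1..n-1. laurent_const (u k i) * expo_push (frag_extend (e k)) (\<theta> k)) + laurent_const (u 0 i)"
    using tri unfolding triangular_data_def by blast+
  define e' where "e' k i = (if k = Suc n then Poly_Mapping.single i 1 else frag_extend rw (e k i))" for k i
  \<comment> \<open>For \<open>k = Suc n\<close> the recursion reads only the rows
    \<open>i < n\<close> of \<open>V\<close>.\<close>
  define a' where "a' k = (if k = Suc n then V else a k)" for k
  \<comment> \<open>For \<open>k \<noteq> n\<close> the vector \<open>u k\<close> is padded with a
    last entry 0 and multiplied by \<open>W\<close>.\<close>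
  define u' where "u' k j = (if k = n then of_int (W j n) else \<Sum>l<n. of_int (W j l) * u k l)" for k j
  \<comment> \<open>The first \<open>n\<close> entries of \<open>V R\<close> vanish, so
    \<open>R = W (V R)\<close> is the last column of \<open>W\<close> times the scalar
    \<open>\<rho>\<close>, the last entry of \<open>V R\<close>.\<close>
  define R where "R j = P j - (\<Sum>k=1..n-1. laurent_const (u' k j) * expo_push (frag_extend (e k)) (\<theta> k))
      - laurent_const (u' 0 j)" for j
  define \<rho> where "\<rho> = (\<Sum>j<Suc n. laurent_const (of_int (V n j)) * R j)"
  define \<theta>' where "\<theta>' k = (if k = n then \<rho> else \<theta> k)" for k
  have Vu: "(\<Sum>j<Suc n. of_int (V i j) * u' k j) = u k i" if "i < n" "k \<noteq> n" for i k
  proof -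
    have "(\<Sum>j<Suc n. of_int (V i j) * u' k j) = (\<Sum>j<Suc n. \<Sum>l<n. of_int (V i j * W j l) * u k l)"
      using that by (simp only: u'_def if_False sum_distrib_left of_int_mult mult.assoc)
    also have "\<dots> = (\<Sum>l<n. of_int (\<Sum>j<Suc n. V i j * W j l) * u k l)"
      by (subst sum.swap) (simp only: of_int_sum sum_distrib_right)
    also have "\<dots> = (\<Sum>l<n. if l = i then u k l else 0)"
      using that by (intro sum.cong refl) (auto simp only: VW1 lessThan_iff less_SucI split: if_splits, auto)
    also have "\<dots> = u k i" using that by simp
    finally show ?thesis .
  qed
  have VR: "(\<Sum>j<Suc n. laurent_const (of_int (V i j)) * R j) = 0" if i: "i < n" for i
  proof -
    have k: "k \<noteq> n" if "k \<in> {1..n-1}" for k using that n by auto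
    have "(\<Sum>j<Suc n. laurent_const (of_int (V i j)) * R j) =
        (\<Sum>j<Suc n. laurent_const (of_int (V i j)) * P j)
        - (\<Sum>j<Suc n. \<Sum>k=1..n-1. laurent_const (of_int (V i j) * u' k j) * expo_push (frag_extend (e k)) (\<theta> k))
        - (\<Sum>j<Suc n. laurent_const (of_int (V i j) * u' 0 j))"
      unfolding R_def by (simp only: right_diff_distrib sum_subtractf sum_distrib_left laurent_const_mult
          mult.assoc[symmetric])
    also have "(\<Sum>j<Suc n. \<Sum>k=1..n-1. laurent_const (of_int (V i j) * u' k j) * expo_push (frag_extend (e k)) (\<theta> k))
        = (\<Sum>k=1..n-1. laurent_const (u k i) * expo_push (frag_extend (e k)) (\<theta> k))"
      by (subst sum.swap, intro sum.cong refl)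
        (simp only: sum_distrib_right[symmetric] laurent_const_sum Vu[OF i k])
    also have "(\<Sum>j<Suc n. laurent_const (of_int (V i j) * u' 0 j)) = laurent_const (u 0 i)"
      using n by (simp only: laurent_const_sum) (subst Vu[OF i], auto)
    finally show ?thesis using t(6)[OF i] by simp
  qed
  have R_\<rho>: "R j = laurent_const (of_int (W j n)) * \<rho>" if j: "j < Suc n" for j
  proof -
    have "(\<Sum>l<Suc n. laurent_const (of_int (W j l)) * (\<Sum>j'<Suc n. laurent_const (of_int (V l j')) * R j'))
        = (\<Sum>j'<Suc n. laurent_const (of_int (\<Sum>l<Suc n. W j l * V l j')) * R j')"
      by (simp only: sum_distrib_left mult.assoc[symmetric] laurent_const_mult of_int_mult[symmetric], subst sum.swap,
          simp only: sum_distrib_right[symmetric] laurent_const_sum of_int_sum)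
    also have "\<dots> = (\<Sum>j'<Suc n. if j' = j then R j' else 0)"
      using j by (intro sum.cong refl) (auto simp only: VW2 lessThan_iff split: if_splits,
        auto simp: laurent_const_def simp flip: single_one)
    also have "\<dots> = R j" using j by simp
    finally have "R j = (\<Sum>l<Suc n. laurent_const (of_int (W j l)) * (\<Sum>j'<Suc n. laurent_const (of_int (V l j')) * R j'))"
      by simp
    also have "\<dots> = (\<Sum>l<n. laurent_const (of_int (W j l)) * (\<Sum>j'<Suc n. laurent_const (of_int (V l j')) * R j'))
        + laurent_const (of_int (W j n)) * \<rho>"
      unfolding \<rho>_def by (rule sum.lessThan_Suc)
    also have "(\<Sum>l<n. laurent_const (of_int (W j l)) * (\<Sum>j'<Suc n. laurent_const (of_int (V l j')) * R j')) = 0"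
      using VR by (intro sum.neutral) auto
    finally show ?thesis by simp
  qed
  have keys_push: "expo_push (frag_extend (e k)) (\<theta> k) \<in> laurent_polys n" if k: "k \<in> {1..n-1}" for k
    unfolding expo_push_def
  proof (intro laurent_polys_sum laurent_polys_single)
    have kn: "k \<in> {1..n}" using k by auto
    fix m assume "m \<in> Poly_Mapping.keys (\<theta> k)"
    then have "Poly_Mapping.keys m \<subseteq> {..<k}" using t(1)[OF k] by (auto simp: laurent_polys_def)
    then have "\<And>i. i \<in> Poly_Mapping.keys m \<Longrightarrow> Poly_Mapping.keys (e k i) \<subseteq> {..<n}"
      using t(4)[OF kn] by blast
    then show "Poly_Mapping.keys (frag_extend (e k) m) \<subseteq> {..<n}"
      by (intro order_trans[OF keys_frag_extend]) blast
  qed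
  have \<rho>: "\<rho> \<in> laurent_polys n" unfolding \<rho>_def R_def
    by (intro laurent_polys_sum laurent_polys_const_mult laurent_polys_diff laurent_polys_const keys_push P) auto
  have "triangular_data (Suc n) p u' \<theta>' a' e'"
    unfolding triangular_data_def
  proof (intro conjI ballI allI impI)
    show "\<theta>' k \<in> laurent_polys k" if "k \<in> {1..Suc n - 1}" for k
      using that t(1)[of k] \<rho> by (auto simp: \<theta>'_def)
    show "e' (Suc n) i = Poly_Mapping.single i 1" for i by (simp add: e'_def)
    show "e' (k-1) i = (\<Sum>j<k. frag_cmul (a' k i j) (e' k j))" if k: "k \<in> {2..Suc n}" "i < k - 1" for k i
    proof (cases "k = Suc n")
      case True
      then show ?thesis using k t(2)[of i] by (simp add: e'_def a'_def rw del: sum.lessThan_Suc)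
    next
      case False
      then have k': "k \<in> {2..n}" "k - 1 \<noteq> Suc n" using k by auto
      show ?thesis using False k' t(3)[OF k'(1) k(2)]
        by (simp add: e'_def a'_def frag_extend_sum o_def frag_extend_cmul)
    qed
    show "Poly_Mapping.keys (e' k i) \<subseteq> {..<Suc n}" if "k \<in> {1..Suc n}" "i < k" for k i
    proof (cases "k = Suc n")
      case False
      then show ?thesis using keys_rw by (simp add: e'_def) (rule order_trans[OF keys_frag_extend], blast)
    qed (use that in \<open>simp add: e'_def\<close>)
    show "pairing (e' k i) (u' k) = 0" if k: "k \<in> {1..Suc n - 1}" "i < k" for k i
    proof (cases "k = n")
      case True
      then have "pairing (e' k i) (u' k) = of_int (\<Sum>j<Suc n. V i j * W j n)"
        using k t(2)[of i] by (simp add: e'_def u'_def pairing_rw del: sum.lessThan_Suc)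
      moreover have "(\<Sum>j<Suc n. V i j * W j n) = 0"
        using VW1[of i n] True k by (simp del: sum.lessThan_Suc)
      ultimately show ?thesis by (simp only: of_int_0)
    next
      case False
      then have k': "k \<in> {1..n-1}" using k by auto
      have "pairing (e' k i) (u' k) = pairing (e k i) (\<lambda>l. pairing (rw l) (u' k))"
        using k False by (simp add: e'_def pairing_frag_extend)
      also have "\<dots> = pairing (e k i) (u k)"
      proof (rule pairing_cong)
        fix l assume "l \<in> Poly_Mapping.keys (e k i)"
        moreover have "k \<in> {1..n}" using k' by auto
        ultimately have "l < n" using t(4)[of k i] k(2) by blast
        then show "pairing (rw l) (u' k) = u k l" unfolding pairing_rw using False by (rule Vu)
      qed
      finally show ?thesis using t(5)[OF k' k(2)] by simp
    qed
    show "p j = (\<Sum>k=1..Suc n - 1. laurent_const (u' k j) * expo_push (frag_extend (e' k)) (\<theta>' k)) + laurent_const (u' 0 j)"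
      if j: "j < Suc n" for j
    proof -
      have "P j = (\<Sum>k=1..n-1. laurent_const (u' k j) * expo_push (frag_extend (e k)) (\<theta> k)) +
          laurent_const (of_int (W j n)) * \<rho> + laurent_const (u' 0 j)"
        using R_\<rho>[OF j] by (simp add: R_def algebra_simps)
      then have "p j = (\<Sum>k=1..n-1. laurent_const (u' k j) * expo_push (frag_extend rw) (expo_push (frag_extend (e k)) (\<theta> k))) +
          laurent_const (u' n j) * expo_push (frag_extend rw) \<rho> + laurent_const (u' 0 j)"
        using p[OF j] by (simp add: expo_push_add expo_push_sum expo_push_const_mult expo_push_const u'_def)
      also have "expo_push (frag_extend rw) \<rho> = expo_push (frag_extend (e' n)) (\<theta>' n)"
      proof -
        have "e' n f = rw f" if "f < n" for f using t(2)[OF that] by (simp add: e'_def)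
        then have "frag_extend rw m = frag_extend (e' n) m" if "m \<in> Poly_Mapping.keys \<rho>" for m
          using \<rho> that by (intro frag_extend_eq) (auto simp: laurent_polys_def subset_iff)
        then show ?thesis unfolding \<theta>'_def by (auto intro: expo_push_cong)
      qed
      also have "(\<Sum>k=1..n-1. laurent_const (u' k j) * expo_push (frag_extend rw) (expo_push (frag_extend (e k)) (\<theta> k))) =
          (\<Sum>k=1..n-1. laurent_const (u' k j) * expo_push (frag_extend (e' k)) (\<theta>' k))"
      proof (intro sum.cong refl)
        fix k assume "k \<in> {1..n-1}"
        then have "k \<noteq> n" "k \<noteq> Suc n" using n by auto
        then have "e' k = (\<lambda>i. frag_extend rw (e k i))" "\<theta>' k = \<theta> k" by (auto simp: e'_def \<theta>'_def)
        then show "laurent_const (u' k j) * expo_push (frag_extend rw) (expo_push (frag_extend (e k)) (\<theta> k)) =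
            laurent_const (u' k j) * expo_push (frag_extend (e' k)) (\<theta>' k)"
          by (simp add: expo_push_push frag_extend_compose)
      qed
      also have "\<dots> + laurent_const (u' n j) * expo_push (frag_extend (e' n)) (\<theta>' n) =
          (\<Sum>k=1..Suc n - 1. laurent_const (u' k j) * expo_push (frag_extend (e' k)) (\<theta>' k))"
        using n by (cases n) auto
      finally show ?thesis .
    qed
  qed
  then show thesis by (rule that)
qed

text \<open>In one variable an exponent orthogonal to a nonzero coefficient is 0, so
  \<open>p 0\<close> is constant. The induction is stated with an arbitrary centre and radius
  because the change of variables alters both.\<close>

lemma exists_triangular_data:
  assumes "1 \<le> n" and "\<And>i. i < n \<Longrightarrow> p i \<in> laurent_polys n" and "log_entire n p \<gamma>0 \<epsilon>" "0 < \<epsilon>"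
  shows "\<exists>u \<theta> a e. triangular_data n p u \<theta> a e"
  using assms
proof (induction n arbitrary: p \<gamma>0 \<epsilon> rule: nat_induct_at_least)
  case base
  have S1: "(\<Union>i<1. Poly_Mapping.keys (p i)) = Poly_Mapping.keys (p 0)" by auto
  have "Poly_Mapping.keys (p 0) \<subseteq> {0}"
  proof (cases "Poly_Mapping.keys (p 0) = {}")
    case False
    then obtain m' where m': "m' \<in> Poly_Mapping.keys (p 0)"
        "\<And>m. m \<in> Poly_Mapping.keys (p 0) \<Longrightarrow> pairing m (\<lambda>i. Poly_Mapping.lookup (p i) m') = 0"
      using exists_coefficient_orthogonal_to_support[OF base(1-3) S1[symmetric]] by blast
    show ?thesis
    proof
      fix m assume m: "m \<in> Poly_Mapping.keys (p 0)"
      then have keys_m: "Poly_Mapping.keys m \<subseteq> {..<1}" using base(1)[of 0] by (auto simp: laurent_polys_def)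
      have "of_int (Poly_Mapping.lookup m 0) * Poly_Mapping.lookup (p 0) m' = 0"
        using m'(2)[OF m] pairing_superset[OF keys_m] by simp
      then have "Poly_Mapping.lookup m 0 = 0" using m'(1) by (simp add: in_keys_iff)
      then have "Poly_Mapping.lookup m k = 0" for k
        using keys_m by (cases "k = 0") (auto simp: in_keys_iff subset_iff)
      then show "m \<in> {0}" by (simp add: poly_mapping_eqI)
    qed
  qed auto
  then have "p 0 = laurent_const (Poly_Mapping.lookup (p 0) 0)"
    unfolding laurent_const_def
    by (intro poly_mapping_eqI) (auto simp: lookup_single when_def in_keys_iff)
  then have "triangular_data 1 p (\<lambda>k i. Poly_Mapping.lookup (p 0) 0) (\<lambda>_. 0) (\<lambda>_ _ _. 0) (\<lambda>_ i. Poly_Mapping.single i 1)"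
    by (auto simp: triangular_data_def)
  then show ?case by blast
next
  case (Suc n)
  define S where "S = (\<Union>i<Suc n. Poly_Mapping.keys (p i))"
  have keysS: "Poly_Mapping.keys m \<subseteq> {..<Suc n}" if "m \<in> S" for m
    using that Suc.prems(1) unfolding S_def by (fastforce simp: laurent_polys_def)
  obtain w :: "nat \<Rightarrow> int" where w: "\<exists>i<Suc n. w i \<noteq> 0"
      "\<And>m. m \<in> S \<Longrightarrow> (\<Sum>i<Suc n. Poly_Mapping.lookup m i * w i) = 0"
  proof (cases "S = {}")
    case True
    show thesis by (rule that[of "\<lambda>_. 1"]) (use True in auto)
  next
    case False
    obtain m' where m': "m' \<in> S" "\<And>m. m \<in> S \<Longrightarrow> pairing m (\<lambda>i. Poly_Mapping.lookup (p i) m') = 0"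
      using exists_coefficient_orthogonal_to_support[OF Suc.prems S_def False] by blast
    obtain i0 where i0: "i0 < Suc n" "Poly_Mapping.lookup (p i0) m' \<noteq> 0"
      using m'(1) unfolding S_def by (auto simp: in_keys_iff)
    obtain w where w: "\<exists>i<Suc n. w i \<noteq> 0"
        "\<And>m. m \<in> Poly_Mapping.lookup ` S \<Longrightarrow> (\<Sum>i<Suc n. m i * w i) = 0"
    proof (rule exists_integer_orthogonal[where v = "\<lambda>i. Poly_Mapping.lookup (p i) m'" and S = "Poly_Mapping.lookup ` S"
          and n = "Suc n" and ?i0.0 = i0])
      show "(\<Sum>i<Suc n. of_int (m i) * Poly_Mapping.lookup (p i) m') = 0" if mem: "m \<in> Poly_Mapping.lookup ` S" for m
      proof -
        obtain x where x: "x \<in> S" "m = Poly_Mapping.lookup x" using mem by blast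
        show ?thesis using m'(2)[OF x(1)] unfolding x(2) pairing_superset[OF keysS[OF x(1)] finite_lessThan] .
      qed
    qed (use i0 in blast)+
    then show thesis using that by blast
  qed
  obtain V W where VW: "unimodular_pair (Suc n) V W" "\<And>i. i < n \<Longrightarrow> (\<Sum>j<Suc n. V i j * w j) = 0"
    using exists_unimodular_annihilator[of "Suc n" w] by auto
  have VW2: "(\<Sum>k<Suc n. W i k * V k j) = (if i = j then 1 else 0)" if "i < Suc n" "j < Suc n" for i j
    using VW(1) that by (simp add: unimodular_pair_def)
  \<comment> \<open>Only the last entry of \<open>V w\<close> can be nonzero, so \<open>w\<close> is
    \<open>d\<close> times the last column of \<open>W\<close>. Orthogonality of the exponents to
    \<open>w\<close> thus passes to that column, although \<open>w\<close> itself may be a proper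
    multiple of it.\<close>
  define d where "d = (\<Sum>j<Suc n. V n j * w j)"
  have w_d: "w i = W i n * d" if "i < Suc n" for i
  proof -
    have "(\<Sum>k<Suc n. W i k * (\<Sum>j<Suc n. V k j * w j)) = (\<Sum>j<Suc n. (\<Sum>k<Suc n. W i k * V k j) * w j)"
      by (simp only: sum_distrib_left sum_distrib_right mult.assoc, subst sum.swap, rule refl)
    also have "\<dots> = (\<Sum>j<Suc n. if j = i then w j else 0)"
      using that by (intro sum.cong refl) (simp add: VW2 del: sum.lessThan_Suc)
    also have "\<dots> = w i" using that by simp
    finally have "w i = (\<Sum>k<Suc n. W i k * (\<Sum>j<Suc n. V k j * w j))" by simp
    also have "\<dots> = (\<Sum>k<n. W i k * (\<Sum>j<Suc n. V k j * w j)) + W i n * d"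
      unfolding d_def by (rule sum.lessThan_Suc)
    also have "(\<Sum>k<n. W i k * (\<Sum>j<Suc n. V k j * w j)) = 0"
      using VW(2) by (intro sum.neutral) auto
    finally show ?thesis by simp
  qed
  have "d \<noteq> 0" using w(1) w_d by fastforce
  have mW: "(\<Sum>j<Suc n. Poly_Mapping.lookup m j * W j n) = 0" if "m \<in> S" for m
  proof -
    have "(\<Sum>j<Suc n. Poly_Mapping.lookup m j * w j) = (\<Sum>j<Suc n. Poly_Mapping.lookup m j * W j n * d)"
      by (intro sum.cong refl) (simp add: w_d)
    then have "(\<Sum>j<Suc n. Poly_Mapping.lookup m j * W j n) * d = 0"
      using w(2)[OF that] by (simp only: sum_distrib_right)
    then show ?thesis using \<open>d \<noteq> 0\<close> by simp
  qed
  define rw where "rw i = (\<Sum>j<Suc n. Poly_Mapping.single j (V i j))" for i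
  \<comment> \<open>\<open>\<pi> m\<close> is \<open>m W\<close> without its last entry. That entry
    is 0 on \<open>S\<close>, so \<open>m = (m W) V\<close> is recovered from the first
    \<open>n\<close> rows of \<open>V\<close>.\<close>
  define \<pi> where "\<pi> m = (\<Sum>l<n. Poly_Mapping.single l (\<Sum>j<Suc n. Poly_Mapping.lookup m j * W j l))"
    for m :: "nat \<Rightarrow>\<^sub>0 int"
  have rw_\<pi>: "frag_extend rw (\<pi> m) = m" if m: "m \<in> S" for m
  proof (rule poly_mapping_eqI)
    fix k
    have "Poly_Mapping.lookup (frag_extend rw (\<pi> m)) k =
        (\<Sum>l<n. (\<Sum>j<Suc n. Poly_Mapping.lookup m j * W j l) * Poly_Mapping.lookup (rw l) k)"
      unfolding \<pi>_def by (simp add: frag_extend_sum lookup_sum o_def del: sum.lessThan_Suc)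
    also have "\<dots> = Poly_Mapping.lookup m k"
    proof (cases "k < Suc n")
      case True
      then have rwk: "Poly_Mapping.lookup (rw l) k = V l k" for l
        unfolding rw_def lookup_sum lookup_single when_def by (simp del: sum.lessThan_Suc)
      have "(\<Sum>l<n. (\<Sum>j<Suc n. Poly_Mapping.lookup m j * W j l) * V l k) =
          (\<Sum>l<Suc n. (\<Sum>j<Suc n. Poly_Mapping.lookup m j * W j l) * V l k)"
        unfolding sum.lessThan_Suc[of _ n] using mW[OF m] by simp
      also have "\<dots> = (\<Sum>j<Suc n. Poly_Mapping.lookup m j * (\<Sum>l<Suc n. W j l * V l k))"
        by (simp only: sum_distrib_left sum_distrib_right mult.assoc, subst sum.swap, rule refl)
      also have "\<dots> = (\<Sum>j<Suc n. if j = k then Poly_Mapping.lookup m j else 0)"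
        using True by (intro sum.cong refl) (simp add: VW2 del: sum.lessThan_Suc)
      also have "\<dots> = Poly_Mapping.lookup m k" using True by simp
      finally show ?thesis unfolding rwk .
    next
      case False
      then have "Poly_Mapping.lookup (rw l) k = 0" for l
        unfolding rw_def lookup_sum lookup_single when_def by (intro sum.neutral) auto
      moreover have "Poly_Mapping.lookup m k = 0" using keysS[OF m] False by (auto simp: in_keys_iff subset_iff)
      ultimately show ?thesis by simp
    qed
    finally show "Poly_Mapping.lookup (frag_extend rw (\<pi> m)) k = Poly_Mapping.lookup m k" .
  qed
  define P where "P j = expo_push \<pi> (p j)" for j
  have keys_\<pi>: "Poly_Mapping.keys (\<pi> m) \<subseteq> {..<n}" for m
    unfolding \<pi>_def by (rule order_trans[OF keys_sum]) (auto split: if_splits)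
  have P: "P j \<in> laurent_polys n" for j
    unfolding P_def expo_push_def by (intro laurent_polys_sum laurent_polys_single keys_\<pi>)
  have p: "p j = expo_push (frag_extend rw) (P j)" if "j < Suc n" for j
    unfolding P_def expo_push_push using that by (intro expo_push_ident[symmetric] rw_\<pi>) (auto simp: S_def)
  obtain \<eta>0 \<epsilon>' where le: "0 < \<epsilon>'"
      "log_entire n (\<lambda>i. \<Sum>j<Suc n. laurent_const (of_int (V i j)) * P j) \<eta>0 \<epsilon>'"
    using log_entire_reduce[OF VW(1) Suc.prems(2,3) P p rw_def] by blast
  have "\<exists>u \<theta> a e. triangular_data n (\<lambda>i. \<Sum>j<Suc n. laurent_const (of_int (V i j)) * P j) u \<theta> a e"
    by (rule Suc.IH[OF _ le(2,1)]) (intro laurent_polys_sum laurent_polys_const_mult P)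
  then obtain u \<theta> a e where
    data: "triangular_data n (\<lambda>i. \<Sum>j<Suc n. laurent_const (of_int (V i j)) * P j) u \<theta> a e" by blast
  obtain u' \<theta>' a' e' where "triangular_data (Suc n) p u' \<theta>' a' e'"
  proof (rule triangular_data_extend[where n = n and V = V and W = W and P = P and p = p and rw = rw
        and u = u and \<theta> = \<theta> and a = a and e = e])
    show "rw i = (\<Sum>j<Suc n. Poly_Mapping.single j (V i j))" for i by (rule rw_def)
  qed (use Suc.hyps(1) VW(1) P p data in blast)+
  then show ?case by blast
qed

subsection \<open>Monomials and matrix chains\<close>

text \<open>The opposite monomial is the only inverse of a monomial, so the description in
  \<open>unit_powi\<close> selects it.\<close>

lemma unit_powi_single: "unit_powi (Poly_Mapping.single m 1 :: laurent) z = Poly_Mapping.single (frag_cmul z m) 1"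
proof -
  have pow: "(Poly_Mapping.single m 1 :: laurent) ^ k = Poly_Mapping.single (frag_cmul (int k) m) 1" for m k
    by (induction k) (simp_all add: mult_single frag_cmul_distrib)
  have inv: "Poly_Mapping.single m 1 * Poly_Mapping.single (- m) 1 = (1 :: laurent)"
    by (simp add: mult_single)
  have "(THE y. (Poly_Mapping.single m 1 :: laurent) * y = 1) = Poly_Mapping.single (- m) 1"
  proof (rule the_equality)
    show "Poly_Mapping.single m 1 * Poly_Mapping.single (- m) 1 = (1 :: laurent)" by (rule inv)
  next
    fix y :: laurent assume y: "Poly_Mapping.single m 1 * y = 1"
    have "y = (Poly_Mapping.single m 1 * Poly_Mapping.single (- m) 1) * y" using inv by simp
    also have "\<dots> = Poly_Mapping.single (- m) 1 * (Poly_Mapping.single m 1 * y)" by (simp only: mult_ac)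
    finally show "y = Poly_Mapping.single (- m) 1" using y by simp
  qed
  moreover have "frag_cmul (- z) (- m) = frag_cmul z m" by (rule poly_mapping_eqI) simp
  ultimately show ?thesis by (simp add: unit_powi_def pow)
qed

lemma prod_single_1: "(\<Prod>i\<in>I. Poly_Mapping.single (f i) 1 :: laurent) = Poly_Mapping.single (\<Sum>i\<in>I. f i) 1"
  by (induction I rule: infinite_finite_induct) (simp_all add: mult_single)

text \<open>Substituting monomials acts on exponents alone, through the homomorphism
  \<open>frag_extend e\<close>.\<close>

lemma laurent_subst_monomials:
  assumes P: "P \<in> laurent_polys k" and M: "\<And>i. i < k \<Longrightarrow> M i = Poly_Mapping.single (e i) 1"
  shows "laurent_subst P M = expo_push (frag_extend e) P"
  unfolding laurent_subst_def expo_push_def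
proof (intro sum.cong refl)
  fix m assume "m \<in> Poly_Mapping.keys P"
  then have m: "i < k" if "i \<in> Poly_Mapping.keys m" for i using P that by (auto simp: laurent_polys_def)
  have "(\<Prod>i\<in>Poly_Mapping.keys m. unit_powi (M i) (Poly_Mapping.lookup m i)) =
      (\<Prod>i\<in>Poly_Mapping.keys m. Poly_Mapping.single (frag_cmul (Poly_Mapping.lookup m i) (e i)) 1)"
    by (intro prod.cong refl) (simp add: M m unit_powi_single)
  then show "laurent_const (Poly_Mapping.lookup P m) * (\<Prod>i\<in>Poly_Mapping.keys m. unit_powi (M i) (Poly_Mapping.lookup m i)) =
      Poly_Mapping.single (frag_extend e m) (Poly_Mapping.lookup P m)"
    by (simp add: prod_single_1 laurent_const_mult_single frag_extend_def)
qed

text \<open>The exponent vector of \<open>M k i\<close> in the original variables. The matrix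
  equation for \<open>u k\<close> thus says that \<open>u k\<close> is orthogonal to the exponents
  of all \<open>M k i\<close>.\<close>

definition chain_row :: "(nat \<Rightarrow> int mat) \<Rightarrow> nat \<Rightarrow> nat \<Rightarrow> nat \<Rightarrow> nat \<Rightarrow>\<^sub>0 int" where
  "chain_row a n k i = (\<Sum>j<n. Poly_Mapping.single j (mat_chain a k n $$ (i, j)))"

lemma lookup_chain_row: "Poly_Mapping.lookup (chain_row a n k i) j = (if j < n then mat_chain a k n $$ (i, j) else 0)"
  unfolding chain_row_def lookup_sum lookup_single when_def by simp

lemma keys_chain_row: "Poly_Mapping.keys (chain_row a n k i) \<subseteq> {..<n}"
  by (auto simp: in_keys_iff lookup_chain_row split: if_splits)

lemma mat_chain_last: "mat_chain a n n = 1\<^sub>m n"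
  by (simp add: mat_chain_def)

lemma mat_chain_step:
  assumes "1 \<le> k" "k \<le> n"
  shows "mat_chain a (k - 1) n = a k * mat_chain a k n"
  using assms by (simp add: mat_chain_def upt_conv_Cons del: upt_Suc)

lemma mat_chain_carrier:
  assumes a: "\<And>k. k \<in> {2..n} \<Longrightarrow> a k \<in> carrier_mat (k - 1) k" and k: "k \<in> {1..n}"
  shows "mat_chain a k n \<in> carrier_mat k n"
proof -
  have "k \<le> n" using k by simp
  then have "1 \<le> k \<longrightarrow> mat_chain a k n \<in> carrier_mat k n"
  proof (induction rule: inc_induct)
    case (step m)
    show ?case
    proof
      assume "1 \<le> m"
      then have "a (Suc m) * mat_chain a (Suc m) n \<in> carrier_mat m n"
        using step a[of "Suc m"] by (intro mult_carrier_mat) auto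
      then show "mat_chain a m n \<in> carrier_mat m n"
        using mat_chain_step[of "Suc m" n a] step by simp
    qed
  qed (simp add: mat_chain_last)
  then show ?thesis using k by simp
qed

lemma chain_row_last: "i < n \<Longrightarrow> chain_row a n n i = Poly_Mapping.single i 1"
  by (rule poly_mapping_eqI) (auto simp: lookup_chain_row mat_chain_last lookup_single when_def)

lemma chain_row_step:
  assumes a: "\<And>k. k \<in> {2..n} \<Longrightarrow> a k \<in> carrier_mat (k - 1) k" and k: "k \<in> {2..n}" "i < k - 1"
  shows "chain_row a n (k - 1) i = (\<Sum>j<k. frag_cmul (a k $$ (i, j)) (chain_row a n k j))"
proof (rule poly_mapping_eqI)
  fix l
  have C: "mat_chain a k n \<in> carrier_mat k n" using k by (intro mat_chain_carrier a) auto
  have "(a k * mat_chain a k n) $$ (i, l) = (\<Sum>j<k. a k $$ (i, j) * mat_chain a k n $$ (j, l))" if "l < n"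
    using a[OF k(1)] C k that
    by (auto simp: scalar_prod_def atLeast0LessThan intro!: sum.cong)
  then show "Poly_Mapping.lookup (chain_row a n (k - 1) i) l =
      Poly_Mapping.lookup (\<Sum>j<k. frag_cmul (a k $$ (i, j)) (chain_row a n k j)) l"
    using mat_chain_step[of k n a] k by (simp add: lookup_sum lookup_chain_row)
qed

lemma pairing_chain_row:
  assumes C: "mat_chain a k n \<in> carrier_mat k n" and i: "i < k" and u: "u \<in> carrier_vec n"
  shows "pairing (chain_row a n k i) (vec_index u) = (map_mat of_int (mat_chain a k n) *\<^sub>v u) $ i"
proof -
  have "pairing (chain_row a n k i) (vec_index u) = (\<Sum>j<n. of_int (mat_chain a k n $$ (i, j)) * u $ j)"
    by (subst pairing_superset[OF keys_chain_row finite_lessThan]) (simp add: lookup_chain_row)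
  also have "\<dots> = (map_mat of_int (mat_chain a k n) *\<^sub>v u) $ i"
    using C i u by (auto simp: scalar_prod_def atLeast0LessThan intro!: sum.cong)
  finally show ?thesis .
qed

lemma mult_mat_vec_eq_0_iff:
  assumes C: "mat_chain a k n \<in> carrier_mat k n" and u: "u \<in> carrier_vec n"
  shows "map_mat of_int (mat_chain a k n) *\<^sub>v u = 0\<^sub>v k \<longleftrightarrow>
    (\<forall>i<k. pairing (chain_row a n k i) (vec_index u) = (0::complex))"
  unfolding vec_eq_iff using C pairing_chain_row[OF C _ u] by auto

text \<open>Descending from \<open>k = n\<close>, one step of the recursion is one more matrix
  factor on the left. This identifies \<open>e k i\<close> with row \<open>i\<close> of the chain
  and turns orthogonality into the matrix equation.\<close>

lemma triangular_form_of_data: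
  assumes n: "1 \<le> n" and data: "triangular_data n p u \<theta> a e"
  shows "triangular_form n p"
proof -
  have t: "\<And>k. k \<in> {1..n-1} \<Longrightarrow> \<theta> k \<in> laurent_polys k"
    "\<And>i. i < n \<Longrightarrow> e n i = Poly_Mapping.single i 1"
    "\<And>k i. k \<in> {2..n} \<Longrightarrow> i < k-1 \<Longrightarrow> e (k-1) i = (\<Sum>j<k. frag_cmul (a k i j) (e k j))"
    "\<And>k i. k \<in> {1..n-1} \<Longrightarrow> i < k \<Longrightarrow> pairing (e k i) (u k) = 0"
    "\<And>i. i < n \<Longrightarrow> p i =
       (\<Sum>k=1..n-1. laurent_const (u k i) * expo_push (frag_extend (e k)) (\<theta> k)) + laurent_const (u 0 i)"
    using data unfolding triangular_data_def by blast+
  define a' where "a' k = mat (k - 1) k (\<lambda>(i, j). a k i j)" for k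
  define u' where "u' k = vec n (u k)" for k
  define M where "M k i = (Poly_Mapping.single (e k i) 1 :: laurent)" for k i
  have a'_index: "a' k $$ (i, j) = a k i j" if "i < k - 1" "j < k" for k i j
    using that by (simp add: a'_def)
  have a': "a' k \<in> carrier_mat (k - 1) k" for k by (simp add: a'_def)
  have e_row: "\<forall>i<k. e k i = chain_row a' n k i" if k: "1 \<le> k" "k \<le> n" for k
  proof -
    from k(2) have "1 \<le> k \<longrightarrow> (\<forall>i<k. e k i = chain_row a' n k i)"
    proof (induction rule: inc_induct)
      case base
      then show ?case by (simp add: t(2) chain_row_last)
    next
      case (step m)
      show ?case
      proof (intro impI allI)
        fix i assume m: "1 \<le> m" "i < m"
        then have m': "Suc m \<in> {2..n}" "i < Suc m - 1" using step by auto
        have "e m i = (\<Sum>j<Suc m. frag_cmul (a (Suc m) i j) (e (Suc m) j))"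
          using t(3)[OF m'] by simp
        also have "\<dots> = (\<Sum>j<Suc m. frag_cmul (a' (Suc m) $$ (i, j)) (chain_row a' n (Suc m) j))"
          using step m by (intro sum.cong refl) (auto simp: a'_index)
        also have "\<dots> = chain_row a' n m i"
          using chain_row_step[of n a', OF a' m'] by simp
        finally show "e m i = chain_row a' n m i" .
      qed
    qed
    then show ?thesis using k by blast
  qed
  show ?thesis
    unfolding triangular_form_def
  proof (intro exI[of _ u'] exI[of _ \<theta>] exI[of _ M] exI[of _ a'] conjI ballI allI impI)
    show "M n i = laurent_var i" if "i < n" for i
      using t(2)[OF that] by (simp add: M_def laurent_var_def)
    show "M (k-1) i = (\<Prod>j<k. unit_powi (M k j) (a' k $$ (i, j)))" if "k \<in> {2..n}" "i < k - 1" for k i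
    proof -
      have "e (k - 1) i = (\<Sum>j<k. frag_cmul (a' k $$ (i, j)) (e k j))"
        using t(3)[OF that] that by (simp add: a'_index)
      then show ?thesis by (simp add: M_def unit_powi_single prod_single_1)
    qed
    show "map_mat of_int (mat_chain a' k n) *\<^sub>v u' k = 0\<^sub>v k" if k: "k \<in> {1..n-1}" for k
    proof -
      have "mat_chain a' k n \<in> carrier_mat k n" using k by (intro mat_chain_carrier a') auto
      then show ?thesis
      proof (subst mult_mat_vec_eq_0_iff)
        show "\<forall>i<k. pairing (chain_row a' n k i) (vec_index (u' k)) = 0"
        proof (intro allI impI)
          fix i assume i: "i < k"
          have "pairing (chain_row a' n k i) (vec_index (u' k)) = pairing (chain_row a' n k i) (u k)"
            using keys_chain_row by (intro pairing_cong) (force simp: u'_def)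
          then show "pairing (chain_row a' n k i) (vec_index (u' k)) = 0"
            using t(4)[OF k i] e_row[of k] k i by simp
        qed
      qed (auto simp: u'_def)
    qed
    show "p i = (\<Sum>k=1..n-1. laurent_const (vec_index (u' k) i) * laurent_subst (\<theta> k) (M k)) + laurent_const (vec_index (u' 0) i)"
      if "i < n" for i
    proof -
      have "laurent_subst (\<theta> k) (M k) = expo_push (frag_extend (e k)) (\<theta> k)" if "k \<in> {1..n-1}" for k
        by (rule laurent_subst_monomials[OF t(1)[OF that]]) (simp add: M_def)
      then show ?thesis using t(5)[OF that] that by (simp add: u'_def)
    qed
  qed (use t a' in \<open>auto simp: u'_def\<close>)
qed

text \<open>The same descent in the other direction: the recursion fixes \<open>M k i\<close> for
  \<open>i < k\<close> only, which is all that \<open>\<theta> k\<close> reads, and keeps each of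
  them a single monomial.\<close>

lemma exists_data_of_triangular_form:
  assumes n: "1 \<le> n" and form: "triangular_form n p"
  shows "\<exists>u \<theta> a e. triangular_data n p u \<theta> a e"
proof -
  obtain u :: "nat \<Rightarrow> complex Matrix.vec" and \<theta> M a where F:
    "(\<forall>k\<in>{0..n-1}. u k \<in> carrier_vec n) \<and>
     (\<forall>k\<in>{1..n-1}. \<theta> k \<in> laurent_polys k) \<and>
     (\<forall>k\<in>{2..n}. a k \<in> carrier_mat (k-1) k) \<and>
     (\<forall>i<n. M n i = laurent_var i) \<and>
     (\<forall>k\<in>{2..n}. \<forall>i<k-1. M (k-1) i = (\<Prod>j<k. unit_powi (M k j) (a k $$ (i, j)))) \<and>
     (\<forall>k\<in>{1..n-1}. map_mat of_int (mat_chain a k n) *\<^sub>v u k = 0\<^sub>v k) \<and>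
     (\<forall>i<n. p i = (\<Sum>k=1..n-1. laurent_const (vec_index (u k) i) * laurent_subst (\<theta> k) (M k))
           + laurent_const (vec_index (u 0) i))"
    using form unfolding triangular_form_def by (elim exE) (rule that)
  have u: "\<And>k. k \<in> {0..n-1} \<Longrightarrow> u k \<in> carrier_vec n" using F by blast
  have \<theta>: "\<And>k. k \<in> {1..n-1} \<Longrightarrow> \<theta> k \<in> laurent_polys k" using F by blast
  have a: "\<And>k. k \<in> {2..n} \<Longrightarrow> a k \<in> carrier_mat (k-1) k" using F by blast
  have Mn: "\<And>i. i < n \<Longrightarrow> M n i = laurent_var i" using F by blast
  have M: "\<And>k i. k \<in> {2..n} \<Longrightarrow> i < k-1 \<Longrightarrow> M (k-1) i = (\<Prod>j<k. unit_powi (M k j) (a k $$ (i, j)))"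
    using F by blast
  have orth: "\<And>k. k \<in> {1..n-1} \<Longrightarrow> map_mat of_int (mat_chain a k n) *\<^sub>v u k = 0\<^sub>v k" using F by blast
  have p: "\<And>i. i < n \<Longrightarrow> p i = (\<Sum>k=1..n-1. laurent_const (vec_index (u k) i) * laurent_subst (\<theta> k) (M k))
           + laurent_const (vec_index (u 0) i)" using F by blast
  have M_row: "\<forall>i<k. M k i = Poly_Mapping.single (chain_row a n k i) 1" if k: "1 \<le> k" "k \<le> n" for k
  proof -
    from k(2) have "1 \<le> k \<longrightarrow> (\<forall>i<k. M k i = Poly_Mapping.single (chain_row a n k i) 1)"
    proof (induction rule: inc_induct)
      case base
      then show ?case by (simp add: Mn laurent_var_def chain_row_last)
    next
      case (step m)
      show ?case
      proof (intro impI allI)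
        fix i assume m: "1 \<le> m" "i < m"
        then have m': "Suc m \<in> {2..n}" "i < Suc m - 1" using step by auto
        have "M m i = (\<Prod>j<Suc m. unit_powi (M (Suc m) j) (a (Suc m) $$ (i, j)))"
          using M[OF m'] by simp
        also have "\<dots> = (\<Prod>j<Suc m. Poly_Mapping.single (frag_cmul (a (Suc m) $$ (i, j)) (chain_row a n (Suc m) j)) 1)"
          using step m by (intro prod.cong refl) (auto simp: unit_powi_single)
        also have "\<dots> = Poly_Mapping.single (chain_row a n m i) 1"
          using chain_row_step[OF a m'] by (simp only: prod_single_1 diff_Suc_1)
        finally show "M m i = Poly_Mapping.single (chain_row a n m i) 1" .
      qed
    qed
    then show ?thesis using k by blast
  qed
  have "triangular_data n p (\<lambda>k. vec_index (u k)) \<theta> (\<lambda>k i j. a k $$ (i, j)) (chain_row a n)"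
    unfolding triangular_data_def
  proof (intro conjI ballI allI impI)
    show "pairing (chain_row a n k i) (vec_index (u k)) = 0" if k: "k \<in> {1..n-1}" "i < k" for k i
    proof -
      have "mat_chain a k n \<in> carrier_mat k n" using k by (intro mat_chain_carrier a) auto
      moreover have "u k \<in> carrier_vec n" using k by (intro u) auto
      ultimately show ?thesis using orth[OF k(1)] k(2) by (simp add: mult_mat_vec_eq_0_iff)
    qed
    show "p i = (\<Sum>k=1..n-1. laurent_const (vec_index (u k) i) * expo_push (frag_extend (chain_row a n k)) (\<theta> k))
        + laurent_const (vec_index (u 0) i)" if "i < n" for i
    proof -
      have "laurent_subst (\<theta> k) (M k) = expo_push (frag_extend (chain_row a n k)) (\<theta> k)" if "k \<in> {1..n-1}" for k
        using M_row[of k] that by (intro laurent_subst_monomials[OF \<theta>[OF that]]) auto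
      then show ?thesis using p[OF that] by simp
    qed
  qed (use \<theta> keys_chain_row chain_row_step[OF a] in \<open>auto simp: chain_row_last\<close>)
  then show ?thesis by blast
qed

section \<open>From units to entire logarithms\<close>

text \<open>An open set contains a point with all coordinates nonzero, and a neighbourhood of its
  logarithms is mapped into the set by \<open>exp\<close>. Units have entire logarithms; their
  equation, known on \<open>V\<close>, extends by the identity theorem.\<close>

lemma log_entire_of_units:
  assumes p: "\<And>i. i < n \<Longrightarrow> p i \<in> laurent_polys n"
    and U: "openin (product_topology (\<lambda>_. euclidean :: complex topology) {..<n}) U" "U \<noteq> {}"
    and units: "\<And>c. c \<in> U \<Longrightarrow> admissible n p c \<Longrightarrow>
      \<exists>V z. solves_on n p c V z \<and> (\<forall>i<n. \<exists>f. entire_extension V (z i) f \<and> unit_function f)"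
  obtains \<gamma>0 \<epsilon> where "0 < \<epsilon>" "log_entire n p \<gamma>0 \<epsilon>"
proof -
  obtain c0 where "c0 \<in> U" using U(2) by blast
  then obtain X where X: "\<And>i. i < n \<Longrightarrow> open (X i)" "c0 \<in> Pi\<^sub>E {..<n} X" "Pi\<^sub>E {..<n} X \<subseteq> U"
  proof -
    have "\<exists>X. (\<forall>i\<in>{..<n}. open (X i)) \<and> c0 \<in> Pi\<^sub>E {..<n} X \<and> Pi\<^sub>E {..<n} X \<subseteq> U"
      using bspec[OF U(1)[unfolded openin_product_topology_alt] \<open>c0 \<in> U\<close>] by simp
    then show thesis using that by (metis lessThan_iff)
  qed
  have "\<exists>c1. c1 \<in> X i \<and> c1 \<noteq> 0" if "i < n" for i
  proof (rule ccontr)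
    assume "\<not> ?thesis"
    moreover have "c0 i \<in> X i" using X(2) that by (auto simp: PiE_iff)
    ultimately have "X i = {0}" by auto
    then show False using X(1)[OF that] not_open_singleton by metis
  qed
  then obtain c1 where c1: "\<And>i. i < n \<Longrightarrow> c1 i \<in> X i" "\<And>i. i < n \<Longrightarrow> c1 i \<noteq> 0" by metis
  define \<gamma>0 where "\<gamma>0 i = Ln (c1 i)" for i
  have "\<exists>\<delta>>0. \<forall>\<gamma>. norm (\<gamma> - \<gamma>0 i) < \<delta> \<longrightarrow> exp \<gamma> \<in> X i" if i: "i < n" for i
  proof -
    have "open (exp -` X i)" using X(1)[OF i] by (intro open_vimage continuous_intros) auto
    moreover have "\<gamma>0 i \<in> exp -` X i" using c1 i by (simp add: \<gamma>0_def)
    ultimately obtain \<delta> where "\<delta> > 0" "ball (\<gamma>0 i) \<delta> \<subseteq> exp -` X i"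
      by (meson open_contains_ball)
    then show ?thesis by (intro exI[of _ \<delta>]) (auto simp: dist_norm norm_minus_commute subset_iff)
  qed
  then obtain \<delta> where \<delta>: "\<And>i. i < n \<Longrightarrow> 0 < \<delta> i"
      "\<And>i \<gamma>. i < n \<Longrightarrow> norm (\<gamma> - \<gamma>0 i) < \<delta> i \<Longrightarrow> exp \<gamma> \<in> X i" by metis
  define \<epsilon> where "\<epsilon> = Min (insert 1 (\<delta> ` {..<n}))"
  have \<epsilon>: "0 < \<epsilon>" "\<And>i. i < n \<Longrightarrow> \<epsilon> \<le> \<delta> i" using \<delta>(1) by (auto simp: \<epsilon>_def)
  have "log_entire n p \<gamma>0 \<epsilon>"
    unfolding log_entire_def
  proof (intro allI impI)
    fix \<gamma> assume \<gamma>: "\<forall>i<n. norm (\<gamma> i - \<gamma>0 i) < \<epsilon>"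
    \<comment> \<open>Points of the product space are extensional, hence the restriction.\<close>
    define c where "c = restrict (\<lambda>i. exp (\<gamma> i)) {..<n}"
    have "exp (\<gamma> i) \<in> X i" if i: "i < n" for i
    proof (rule \<delta>(2)[OF i])
      have "norm (\<gamma> i - \<gamma>0 i) < \<epsilon>" using \<gamma> i by blast
      also have "\<dots> \<le> \<delta> i" by (rule \<epsilon>(2)[OF i])
      finally show "norm (\<gamma> i - \<gamma>0 i) < \<delta> i" .
    qed
    then have "c \<in> Pi\<^sub>E {..<n} X" by (simp add: c_def)
    then have "c \<in> U" using X(3) by blast
    moreover have "admissible n p c"
      using p unfolding admissible_def laurent_defined_def laurent_polys_def by (auto simp: c_def subset_iff)
    ultimately obtain V z where z: "solves_on n p c V z"
        "\<forall>i<n. \<exists>f. entire_extension V (z i) f \<and> unit_function f" using units by blast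
    then obtain f where f: "\<And>i. i < n \<Longrightarrow> entire_extension V (z i) (f i)" "\<And>i. i < n \<Longrightarrow> unit_function (f i)"
      by metis
    have V: "open V" "0 \<in> V" using z(1) by (auto simp: solves_on_def)
    have "\<exists>h. h holomorphic_on UNIV \<and> (\<forall>t. f i t = exp (h t)) \<and> h 0 = \<gamma> i" if i: "i < n" for i
    proof -
      obtain h where h: "h holomorphic_on UNIV" "\<And>t. f i t = exp (h t)"
        using contractible_imp_holomorphic_log[of "f i" UNIV] f(2)[OF i] contractible_UNIV
        unfolding unit_function_def by auto
      have "exp (h 0) = exp (\<gamma> i)"
        using f(1)[OF i] z(1) i V h(2)[of 0] by (simp add: entire_extension_def solves_on_def c_def)
      \<comment> \<open>The logarithm may miss the prescribed \<open>\<gamma> i\<close> by a period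
        of \<open>exp\<close>; a constant shift corrects this.\<close>
      then show ?thesis using h
        by (intro exI[of _ "\<lambda>t. h t - h 0 + \<gamma> i"]) (auto simp: exp_add exp_diff intro!: holomorphic_intros)
    qed
    then obtain g where g: "\<And>i. i < n \<Longrightarrow> g i holomorphic_on UNIV" "\<And>i t. i < n \<Longrightarrow> f i t = exp (g i t)"
        "\<And>i. i < n \<Longrightarrow> g i 0 = \<gamma> i" by metis
    have z_exp: "z j t = exp (g j t)" if "j < n" "t \<in> V" for j t
      using f(1)[OF that(1)] g(2)[OF that(1)] that(2) by (simp add: entire_extension_def)
    have ev: "laurent_eval (p i) (\<lambda>j. z j t) = exp_eval (p i) (\<lambda>j. g j t)" if i: "i < n" and t: "t \<in> V" for i t
      unfolding laurent_eval_def exp_eval_def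
    proof (intro sum.cong refl arg_cong2[of _ _ _ _ "(*)"])
      fix m assume "m \<in> Poly_Mapping.keys (p i)"
      then have "j < n" if "j \<in> Poly_Mapping.keys m" for j using p[OF i] that by (auto simp: laurent_polys_def)
      then have "(\<Prod>j\<in>Poly_Mapping.keys m. z j t powi Poly_Mapping.lookup m j) =
          (\<Prod>j\<in>Poly_Mapping.keys m. exp (of_int (Poly_Mapping.lookup m j) * g j t))"
        by (intro prod.cong refl) (simp add: z_exp t exp_power_int)
      then show "(\<Prod>j\<in>Poly_Mapping.keys m. z j t powi Poly_Mapping.lookup m j) = exp (pairing m (\<lambda>j. g j t))"
        by (simp add: pairing_def exp_sum)
    qed
    have on_V: "deriv (g i) t = exp_eval (p i) (\<lambda>j. g j t)" if i: "i < n" and t: "t \<in> V" for i t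
    proof -
      have "(z i has_field_derivative z i t * exp_eval (p i) (\<lambda>j. g j t)) (at t)"
        unfolding ev[OF i t, symmetric] using z(1) i t unfolding solves_on_def by blast
      then have "(f i has_field_derivative z i t * exp_eval (p i) (\<lambda>j. g j t)) (at t)"
        by (rule has_field_derivative_transform_within_open[OF _ V(1) t])
          (use f(1)[OF i] in \<open>auto simp: entire_extension_def\<close>)
      moreover have "z i t = exp (g i t)" by (rule z_exp[OF i t])
      moreover have "f i = (\<lambda>t. exp (g i t))" using g(2)[OF i] by auto
      ultimately have "((\<lambda>t. exp (g i t)) has_field_derivative exp (g i t) * exp_eval (p i) (\<lambda>j. g j t)) (at t)"
        by simp
      moreover have "((\<lambda>t. exp (g i t)) has_field_derivative exp (g i t) * deriv (g i) t) (at t)"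
        using holomorphic_derivI[OF g(1)[OF i] open_UNIV, of t] by (auto intro!: derivative_eq_intros)
      ultimately have "exp (g i t) * exp_eval (p i) (\<lambda>j. g j t) = exp (g i t) * deriv (g i) t"
        by (rule DERIV_unique)
      then show ?thesis by simp
    qed
    have hol_ev: "(\<lambda>t. exp_eval (p i) (\<lambda>j. g j t)) holomorphic_on UNIV" if "i < n" for i
      unfolding exp_eval_def pairing_def using p[OF that] g(1)
      by (intro holomorphic_intros) (auto simp: laurent_polys_def)
    have "deriv (g i) t = exp_eval (p i) (\<lambda>j. g j t)" if i: "i < n" for i t
    proof (rule analytic_continuation_open[of V UNIV "deriv (g i)" "\<lambda>t. exp_eval (p i) (\<lambda>j. g j t)"])
      show "deriv (g i) holomorphic_on UNIV" by (intro holomorphic_deriv g i) auto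
    qed (use V hol_ev[OF i] on_V[OF i] in auto)
    then have "(g i has_field_derivative exp_eval (p i) (\<lambda>j. g j t)) (at t)" if "i < n" for i t
      using holomorphic_derivI[OF g(1)[OF that] open_UNIV, of t] that by simp
    then show "\<exists>g. \<forall>i<n. g i 0 = \<gamma> i \<and> (\<forall>t. (g i has_field_derivative exp_eval (p i) (\<lambda>j. g j t)) (at t))"
      using g(3) by blast
  qed
  with \<epsilon>(1) show thesis by (rule that)
qed

subsection \<open>Integration level by level\<close>

text \<open>\<open>L k\<close> is the lattice of exponents of monomials in the \<open>M k i\<close>,
  and the recursion makes it grow with \<open>k\<close>. The coefficient vector at
  \<open>m' \<noteq> 0\<close> combines only those \<open>u k\<close> with \<open>m'\<close> in
  \<open>L k\<close>, hence with \<open>\<kappa> m' \<le> k\<close>. If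
  \<open>\<kappa> m \<le> \<kappa> m'\<close>, then \<open>m\<close> lies in all these
  \<open>L k\<close> and is orthogonal to these \<open>u k\<close>.\<close>

lemma exists_level_function:
  assumes n: "1 \<le> n" and data: "triangular_data n p u \<theta> a e"
  obtains \<kappa> :: "(nat \<Rightarrow>\<^sub>0 int) \<Rightarrow> nat" where
    "\<And>m m'. Poly_Mapping.keys m \<subseteq> {..<n} \<Longrightarrow> Poly_Mapping.keys m' \<subseteq> {..<n} \<Longrightarrow> \<kappa> m \<le> \<kappa> m' \<Longrightarrow>
      pairing m (\<lambda>i. Poly_Mapping.lookup (p i) m') = 0"
proof -
  have t: "\<And>k. k \<in> {1..n-1} \<Longrightarrow> \<theta> k \<in> laurent_polys k"
    "\<And>i. i < n \<Longrightarrow> e n i = Poly_Mapping.single i 1"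
    "\<And>k i. k \<in> {2..n} \<Longrightarrow> i < k-1 \<Longrightarrow> e (k-1) i = (\<Sum>j<k. frag_cmul (a k i j) (e k j))"
    "\<And>k i. k \<in> {1..n-1} \<Longrightarrow> i < k \<Longrightarrow> pairing (e k i) (u k) = 0"
    "\<And>i. i < n \<Longrightarrow> p i =
       (\<Sum>k=1..n-1. laurent_const (u k i) * expo_push (frag_extend (e k)) (\<theta> k)) + laurent_const (u 0 i)"
    using data unfolding triangular_data_def by blast+
  define L where "L k = {frag_extend (e k) \<mu> |\<mu>. Poly_Mapping.keys \<mu> \<subseteq> {..<k}}" for k
  have L_Suc: "L k \<subseteq> L (Suc k)" if k: "1 \<le> k" "k < n" for k
  proof
    fix m assume "m \<in> L k"
    then obtain \<mu> where \<mu>: "m = frag_extend (e k) \<mu>" "Poly_Mapping.keys \<mu> \<subseteq> {..<k}" by (auto simp: L_def)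
    define b where "b i = (\<Sum>j<Suc k. Poly_Mapping.single j (a (Suc k) i j))" for i
    have "m = frag_extend (\<lambda>i. frag_extend (e (Suc k)) (b i)) \<mu>"
      unfolding \<mu>(1)
    proof (rule frag_extend_eq)
      fix i assume "i \<in> Poly_Mapping.keys \<mu>"
      then have "Suc k \<in> {2..n}" "i < Suc k - 1" using k \<mu>(2) by auto
      from t(3)[OF this] show "e k i = frag_extend (e (Suc k)) (b i)"
        by (simp add: b_def frag_extend_sum o_def del: sum.lessThan_Suc)
    qed
    then have "m = frag_extend (e (Suc k)) (frag_extend b \<mu>)" by (simp add: frag_extend_compose)
    moreover have "Poly_Mapping.keys (b i) \<subseteq> {..<Suc k}" for i
      unfolding b_def by (rule order_trans[OF keys_sum]) (auto split: if_splits)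
    then have "Poly_Mapping.keys (frag_extend b \<mu>) \<subseteq> {..<Suc k}"
      by (intro order_trans[OF keys_frag_extend]) blast
    ultimately show "m \<in> L (Suc k)" by (auto simp: L_def)
  qed
  have L_mono: "L k \<subseteq> L k'" if "1 \<le> k" "k \<le> k'" "k' \<le> n" for k k'
    using that(2,1,3)
  proof (induction rule: dec_induct)
    case (step j)
    then have "L k \<subseteq> L j" "L j \<subseteq> L (Suc j)" using L_Suc[of j] by auto
    then show ?case by (rule order_trans)
  qed simp
  have L_n: "m \<in> L n" if "Poly_Mapping.keys m \<subseteq> {..<n}" for m
  proof -
    have "frag_extend (e n) m = frag_extend (\<lambda>i. Poly_Mapping.single i 1) m"
      using that t(2) by (intro frag_extend_eq) auto
    also have "\<dots> = m"
      by (rule poly_mapping_eqI) (auto simp: frag_extend_def lookup_sum lookup_single when_def in_keys_iff)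
    finally have "m = frag_extend (e n) m" by simp
    then show ?thesis using that unfolding L_def by blast
  qed
  have orth: "pairing m (u k) = 0" if "m \<in> L k" "k \<in> {1..n-1}" for m k
  proof -
    obtain \<mu> where \<mu>: "m = frag_extend (e k) \<mu>" "Poly_Mapping.keys \<mu> \<subseteq> {..<k}" using \<open>m \<in> L k\<close> by (auto simp: L_def)
    have "pairing \<mu> (\<lambda>i. pairing (e k i) (u k)) = pairing \<mu> (\<lambda>_. 0)"
      using t(4)[OF that(2)] \<mu>(2) by (intro pairing_cong) auto
    also have "\<dots> = 0" by (simp add: pairing_def)
    finally show ?thesis unfolding \<mu>(1) pairing_frag_extend .
  qed
  define b where "b k m = Poly_Mapping.lookup (expo_push (frag_extend (e k)) (\<theta> k)) m" for k m
  have b0: "m \<in> L k" if nz: "b k m \<noteq> 0" and k: "k \<in> {1..n-1}" for k m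
  proof -
    have "frag_extend (e k) \<mu> \<in> L k" if "\<mu> \<in> Poly_Mapping.keys (\<theta> k)" for \<mu>
      using t(1)[OF k] that by (auto simp: L_def laurent_polys_def)
    then have "b k m = 0" if "m \<notin> L k"
      unfolding b_def expo_push_def lookup_sum lookup_single when_def using that
      by (intro sum.neutral) auto
    then show ?thesis using nz by blast
  qed
  have coeff: "Poly_Mapping.lookup (p i) m = (\<Sum>k=1..n-1. u k i * b k m)" if "i < n" "m \<noteq> 0" for i m
    unfolding t(5)[OF that(1)] lookup_add lookup_sum lookup_laurent_const_mult b_def
    using that(2) by (simp add: laurent_const_def lookup_single when_def)
  \<comment> \<open>Level 0 is reserved for the exponent 0, whose coefficient contains the
    unconstrained \<open>u 0\<close>. All other levels are at least 1, so
    \<open>\<kappa> m \<le> \<kappa> 0\<close> forces \<open>m = 0\<close>.\<close>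
  define \<kappa> where "\<kappa> m = (if m = 0 then 0 else LEAST k. 1 \<le> k \<and> m \<in> L k)" for m
  show thesis
  proof (rule that[of \<kappa>])
    fix m m' assume m: "Poly_Mapping.keys m \<subseteq> {..<n}" and m': "Poly_Mapping.keys m' \<subseteq> {..<n}" and le: "\<kappa> m \<le> \<kappa> m'"
    show "pairing m (\<lambda>i. Poly_Mapping.lookup (p i) m') = 0"
    proof (cases "m = 0")
      case False
      have least: "1 \<le> \<kappa> m" "m \<in> L (\<kappa> m)"
        using LeastI[of "\<lambda>k. 1 \<le> k \<and> m \<in> L k" n] n L_n[OF m] False by (auto simp: \<kappa>_def)
      then have "m' \<noteq> 0" using le by (auto simp: \<kappa>_def[of m'])
      have "pairing m (\<lambda>i. Poly_Mapping.lookup (p i) m') = pairing m (\<lambda>i. \<Sum>k=1..n-1. u k i * b k m')"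
        using m coeff \<open>m' \<noteq> 0\<close> by (intro pairing_cong) auto
      also have "\<dots> = (\<Sum>k=1..n-1. pairing m (u k) * b k m')"
        unfolding pairing_def sum_distrib_left sum_distrib_right by (subst sum.swap) (simp add: mult.assoc)
      also have "\<dots> = 0"
      proof (intro sum.neutral ballI)
        fix k assume k: "k \<in> {1..n-1}"
        show "pairing m (u k) * b k m' = 0"
        proof (cases "b k m' = 0")
          case False
          then have "\<kappa> m' \<le> k" using b0[OF False k] k by (auto simp: \<kappa>_def intro: Least_le)
          moreover have "k \<le> n" using k by auto
          ultimately have "L (\<kappa> m) \<subseteq> L k" using L_mono least(1) le by (meson order_trans)
          then have "m \<in> L k" using least(2) by blast
          then show ?thesis using orth[OF _ k] by simp
        qed simp
      qed
      finally show ?thesis .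
    qed simp
  qed
qed

lemma entire_primitive:
  assumes "h holomorphic_on UNIV"
  obtains H where "H 0 = 0" "\<And>t. (H has_field_derivative h t) (at t)"
proof -
  obtain H where H: "\<And>x. (H has_field_derivative h x) (at x)"
    using holomorphic_convex_primitive'[OF convex_UNIV open_UNIV assms] by auto
  show thesis
  proof (rule that[of "\<lambda>t. H t - H 0"])
    show "((\<lambda>t. H t - H 0) has_field_derivative h t) (at t)" for t
      using DERIV_diff[OF H[of t] DERIV_const[of "H 0"]] by simp
  qed simp
qed

lemma linear_ode_unique:
  fixes y w h :: "complex \<Rightarrow> complex"
  assumes V: "open V" "connected V" "0 \<in> V" "t \<in> V"
    and y: "\<And>t. t \<in> V \<Longrightarrow> (y has_field_derivative y t * h t) (at t)"
    and w: "\<And>t. t \<in> V \<Longrightarrow> (w has_field_derivative w t * h t) (at t)" "\<And>t. t \<in> V \<Longrightarrow> w t \<noteq> 0"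
    and init: "y 0 = w 0"
  shows "y t = w t"
proof -
  have "((\<lambda>t. y t / w t) has_field_derivative 0) (at t)" if "t \<in> V" for t
    using DERIV_divide[OF y[OF that] w(1)[OF that] w(2)[OF that]] by (simp add: mult_ac)
  then obtain c where "\<And>t. t \<in> V \<Longrightarrow> y t / w t = c"
    using DERIV_zero_connected_constant[OF V(2,1) finite.emptyI, of "\<lambda>t. y t / w t"]
    by (metis Diff_empty continuous_at_imp_continuous_on DERIV_isCont)
  then show ?thesis using V w(2) init by (metis divide_self nonzero_eq_divide_eq mult_1)
qed

text \<open>\<open>V\<close> need not be simply connected, so \<open>h\<close> is integrated on a
  disc about \<open>s\<close> only. The integrating factor gives \<open>y = 0\<close> there, and the
  identity theorem extends this to \<open>V\<close>.\<close>

lemma linear_ode_zero: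
  fixes y h :: "complex \<Rightarrow> complex"
  assumes V: "open V" "connected V" "s \<in> V" "t \<in> V"
    and h: "h holomorphic_on V" and y: "\<And>t. t \<in> V \<Longrightarrow> (y has_field_derivative y t * h t) (at t)" and y0: "y s = 0"
  shows "y t = 0"
proof -
  obtain r where r: "r > 0" "ball s r \<subseteq> V" using V by (meson open_contains_ball)
  obtain H where H: "\<And>x. x \<in> ball s r \<Longrightarrow> (H has_field_derivative h x) (at x within ball s r)"
    using holomorphic_convex_primitive'[OF convex_ball open_ball holomorphic_on_subset[OF h r(2)]] by blast
  then have H': "(H has_field_derivative h x) (at x)" if "x \<in> ball s r" for x
    using that at_within_open[OF that open_ball] by metis
  have "((\<lambda>x. y x * exp (- H x)) has_field_derivative 0) (at x within ball s r)" if "x \<in> ball s r" for x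
  proof (rule has_field_derivative_at_within)
    show "((\<lambda>x. y x * exp (- H x)) has_field_derivative 0) (at x)"
      using r(2) that by (auto intro!: derivative_eq_intros y H')
  qed
  then have "\<exists>c. \<forall>x\<in>ball s r. y x * exp (- H x) = c"
    by (intro has_field_derivative_zero_constant) auto
  then have ball0: "y x = 0" if "x \<in> ball s r" for x
    using that y0 r(1) by (metis centre_in_ball exp_not_eq_zero mult_eq_0_iff)
  have "y holomorphic_on V"
    using y by (auto simp: holomorphic_on_def field_differentiable_def intro: has_field_derivative_at_within)
  then show ?thesis
    using analytic_continuation_open[OF open_ball V(1) _ V(2) r(2) _ holomorphic_on_const, of y 0 t] r ball0 V(4)
    by auto
qed

text \<open>At level \<open>N\<close> the sum involves only lower levels, where \<open>E\<close> is
  already entire; \<open>C m\<close> times the exponential of a primitive solves the equation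
  without zeros. Finiteness of \<open>S\<close> bounds the levels.\<close>

lemma solve_by_levels:
  fixes q :: "'a \<Rightarrow> 'a \<Rightarrow> complex" and \<kappa> :: "'a \<Rightarrow> nat"
  assumes lev: "\<And>m m'. m \<in> S \<Longrightarrow> m' \<in> S \<Longrightarrow> \<kappa> m \<le> \<kappa> m' \<Longrightarrow> q m m' = 0" and C: "\<And>m. m \<in> S \<Longrightarrow> C m \<noteq> 0"
    and fin: "finite S"
  obtains E where "\<And>m. m \<in> S \<Longrightarrow> E m 0 = C m" "\<And>m t. m \<in> S \<Longrightarrow> E m t \<noteq> 0"
    "\<And>m t. m \<in> S \<Longrightarrow> (E m has_field_derivative E m t * (\<Sum>m'\<in>S. q m m' * E m' t)) (at t)"
proof -
  define good where "good E m \<longleftrightarrow> E m 0 = C m \<and> (\<forall>t. E m t \<noteq> 0 \<and>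
      (E m has_field_derivative E m t * (\<Sum>m'\<in>S. q m m' * E m' t)) (at t))" for E m
  have "\<exists>E. \<forall>m\<in>S. \<kappa> m < N \<longrightarrow> good E m" for N
  proof (induction N)
    case (Suc N)
    then obtain E where E: "\<And>m. m \<in> S \<Longrightarrow> \<kappa> m < N \<Longrightarrow> good E m" by blast
    define h where "h m t = (\<Sum>m'\<in>{m'\<in>S. \<kappa> m' < N}. q m m' * E m' t)" for m t
    have "h m holomorphic_on UNIV" for m
      unfolding h_def
    proof (intro holomorphic_intros)
      fix m' assume "m' \<in> {m'\<in>S. \<kappa> m' < N}"
      then have "good E m'" using E by auto
      then show "E m' holomorphic_on UNIV"
        by (auto simp: good_def holomorphic_on_def field_differentiable_def intro: has_field_derivative_at_within)
    qed
    then have "\<exists>H. H 0 = 0 \<and> (\<forall>t. (H has_field_derivative h m t) (at t))" for m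
      using entire_primitive by metis
    then obtain H where H: "\<And>m. H m 0 = 0" "\<And>m t. (H m has_field_derivative h m t) (at t)" by metis
    define E' where "E' m = (if \<kappa> m = N then (\<lambda>t. C m * exp (H m t)) else E m)" for m
    have "good E' m" if m: "m \<in> S" "\<kappa> m < Suc N" for m
    proof (cases "\<kappa> m = N")
      case True
      have "(\<Sum>m'\<in>S. q m m' * E' m' t) = h m t" for t
        unfolding h_def
      proof (intro sum.mono_neutral_cong_right fin ballI)
        fix m' assume "m' \<in> S - {m' \<in> S. \<kappa> m' < N}"
        then have "q m m' = 0" using lev[OF m(1), of m'] True by auto
        then show "q m m' * E' m' t = 0" by simp
      qed (auto simp: E'_def)
      moreover have "((\<lambda>t. C m * exp (H m t)) has_field_derivative C m * exp (H m t) * h m t) (at t)" for t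
        by (rule derivative_eq_intros H refl | simp)+
      ultimately show ?thesis using True C m H(1) by (simp add: good_def E'_def)
    next
      case False
      then have "\<kappa> m < N" using m by simp
      have "(\<Sum>m'\<in>S. q m m' * E' m' t) = (\<Sum>m'\<in>S. q m m' * E m' t)" for t
        using lev[OF m(1)] \<open>\<kappa> m < N\<close> by (intro sum.cong refl) (auto simp: E'_def)
      then show ?thesis using E[OF m(1) \<open>\<kappa> m < N\<close>] False by (simp add: good_def E'_def)
    qed
    then show ?case by blast
  qed auto
  then obtain E where "\<forall>m\<in>S. \<kappa> m < Suc (Max (\<kappa> ` S)) \<longrightarrow> good E m" by blast
  then have "good E m" if "m \<in> S" for m using that fin by (simp add: less_Suc_eq_le)
  then show thesis using that[of E] unfolding good_def by blast
qed

section \<open>Existence and uniqueness for the triangular system\<close>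

definition monomial_eval :: "(nat \<Rightarrow>\<^sub>0 int) \<Rightarrow> (nat \<Rightarrow> complex) \<Rightarrow> complex" where
  "monomial_eval m x = (\<Prod>i\<in>Poly_Mapping.keys m. x i powi Poly_Mapping.lookup m i)"

lemma has_field_derivative_prod_powi:
  fixes x h :: "'a \<Rightarrow> complex \<Rightarrow> complex"
  assumes "finite I" and "\<And>i. i \<in> I \<Longrightarrow> x i t \<noteq> 0"
    and "\<And>i. i \<in> I \<Longrightarrow> (x i has_field_derivative x i t * h i t) (at t)"
  shows "((\<lambda>t. \<Prod>i\<in>I. x i t powi k i) has_field_derivative
    (\<Prod>i\<in>I. x i t powi k i) * (\<Sum>i\<in>I. of_int (k i) * h i t)) (at t)"
  using assms
proof (induction I rule: finite_induct)
  case (insert i I)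
  have "((\<lambda>t. x i t powi k i) has_field_derivative of_int (k i) * x i t powi (k i - 1) * (x i t * h i t)) (at t)"
    by (rule DERIV_power_int) (use insert.prems in auto)
  also have "of_int (k i) * x i t powi (k i - 1) * (x i t * h i t) = x i t powi k i * (of_int (k i) * h i t)"
    using insert.prems(1)[of i] power_int_minus_mult[of "x i t" "k i"] by (simp add: mult_ac)
  finally have "((\<lambda>t. x i t powi k i * (\<Prod>i\<in>I. x i t powi k i)) has_field_derivative
     (x i t powi k i * (of_int (k i) * h i t)) * (\<Prod>i\<in>I. x i t powi k i) +
     ((\<Prod>i\<in>I. x i t powi k i) * (\<Sum>i\<in>I. of_int (k i) * h i t)) * x i t powi k i) (at t)"
    by (rule DERIV_mult) (use insert in auto)
  then show ?case using insert.hyps by (simp add: algebra_simps)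
qed auto

lemma monomial_eval_derivative:
  assumes m: "Poly_Mapping.keys m \<subseteq> {..<n}"
    and nz: "\<And>i. i \<in> Poly_Mapping.keys m \<Longrightarrow> x i t \<noteq> 0"
    and dx: "\<And>i. i < n \<Longrightarrow> (x i has_field_derivative x i t * (\<Sum>m'\<in>S. Poly_Mapping.lookup (p i) m' * F m')) (at t)"
  shows "((\<lambda>t. monomial_eval m (\<lambda>i. x i t)) has_field_derivative monomial_eval m (\<lambda>i. x i t) *
    (\<Sum>m'\<in>S. pairing m (\<lambda>i. Poly_Mapping.lookup (p i) m') * F m')) (at t)"
proof -
  have "((\<lambda>t. monomial_eval m (\<lambda>i. x i t)) has_field_derivative monomial_eval m (\<lambda>i. x i t) *
    (\<Sum>i\<in>Poly_Mapping.keys m. of_int (Poly_Mapping.lookup m i) * (\<Sum>m'\<in>S. Poly_Mapping.lookup (p i) m' * F m'))) (at t)"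
    unfolding monomial_eval_def
    by (rule has_field_derivative_prod_powi[where h = "\<lambda>i _. \<Sum>m'\<in>S. Poly_Mapping.lookup (p i) m' * F m'"])
      (use m nz dx in auto)
  also have "(\<Sum>i\<in>Poly_Mapping.keys m. of_int (Poly_Mapping.lookup m i) * (\<Sum>m'\<in>S. Poly_Mapping.lookup (p i) m' * F m')) =
      (\<Sum>m'\<in>S. pairing m (\<lambda>i. Poly_Mapping.lookup (p i) m') * F m')"
    unfolding pairing_def sum_distrib_left sum_distrib_right by (subst sum.swap) (simp add: mult.assoc)
  finally show ?thesis .
qed

text \<open>The monomials are first treated as independent unknowns \<open>E\<close>, integrated by
  levels; the components follow by one more integration. Uniqueness for linear equations then shows
  that the monomials of the components are the given \<open>E\<close>.\<close>

lemma entire_solutions_of_triangular_form: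
  assumes n: "1 \<le> n" and p: "\<And>i. i < n \<Longrightarrow> p i \<in> laurent_polys n"
    and form: "triangular_form n p" and adm: "admissible n p c"
  obtains f where "solves_on n p c UNIV f" "\<And>i. i < n \<Longrightarrow> f i holomorphic_on UNIV"
    "\<And>i. i < n \<Longrightarrow> (\<forall>t. f i t \<noteq> 0) \<or> (\<forall>t. f i t = 0)"
    "\<And>V z i t. solves_on n p c V z \<Longrightarrow> i < n \<Longrightarrow> t \<in> V \<Longrightarrow> f i t = z i t"
proof -
  obtain u \<theta> a e where data: "triangular_data n p u \<theta> a e"
    using exists_data_of_triangular_form[OF n form] by blast
  obtain \<kappa> where \<kappa>: "\<And>m m'. Poly_Mapping.keys m \<subseteq> {..<n} \<Longrightarrow> Poly_Mapping.keys m' \<subseteq> {..<n} \<Longrightarrow> \<kappa> m \<le> (\<kappa> m' :: nat) \<Longrightarrow>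
      pairing m (\<lambda>i. Poly_Mapping.lookup (p i) m') = 0"
    using exists_level_function[OF n data] by metis
  \<comment> \<open>A component with \<open>c j = 0\<close> stays 0. By admissibility its variable
    occurs only with positive exponents, so the monomials left out vanish along the solution, and
    those kept involve only components without zeros.\<close>
  define S where "S = {m \<in> (\<Union>i<n. Poly_Mapping.keys (p i)). \<forall>j\<in>Poly_Mapping.keys m. c j \<noteq> 0}"
  have fin: "finite S" by (simp add: S_def)
  have keysS: "Poly_Mapping.keys m \<subseteq> {..<n}" if "m \<in> S" for m
    using that p unfolding S_def by (fastforce simp: laurent_polys_def)
  have cS: "c j \<noteq> 0" if "m \<in> S" "j \<in> Poly_Mapping.keys m" for m j using that by (auto simp: S_def)
  have eval: "laurent_eval (p i) x = (\<Sum>m\<in>S. Poly_Mapping.lookup (p i) m * monomial_eval m x)"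
    if i: "i < n" and x: "\<And>j. j < n \<Longrightarrow> c j = 0 \<Longrightarrow> x j = 0" for i x
  proof -
    have "monomial_eval m x = 0" if m: "m \<in> Poly_Mapping.keys (p i)" "m \<notin> S" for m
    proof -
      obtain j where j: "j \<in> Poly_Mapping.keys m" "c j = 0" using m i by (auto simp: S_def)
      have "j < n" using j(1) m(1) p[OF i] by (auto simp: laurent_polys_def)
      moreover have "\<not> Poly_Mapping.lookup m j < 0"
        using adm i m(1) j unfolding admissible_def laurent_defined_def by blast
      then have "0 < Poly_Mapping.lookup m j" using j(1) by (simp add: in_keys_iff)
      ultimately have "x j powi Poly_Mapping.lookup m j = 0" using x j(2) by simp
      then show ?thesis unfolding monomial_eval_def using j(1) by (meson finite_keys prod_zero)
    qed
    then have "(\<Sum>m\<in>Poly_Mapping.keys (p i). Poly_Mapping.lookup (p i) m * monomial_eval m x) =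
        (\<Sum>m\<in>S. Poly_Mapping.lookup (p i) m * monomial_eval m x)"
      using i fin by (intro sum.mono_neutral_cong) (auto simp: in_keys_iff)
    then show ?thesis by (simp add: laurent_eval_def monomial_eval_def)
  qed
  define q where "q m m' = pairing m (\<lambda>i. Poly_Mapping.lookup (p i) m')" for m m'
  obtain E where E: "\<And>m. m \<in> S \<Longrightarrow> E m 0 = monomial_eval m c" "\<And>m t. m \<in> S \<Longrightarrow> E m t \<noteq> 0"
    "\<And>m t. m \<in> S \<Longrightarrow> (E m has_field_derivative E m t * (\<Sum>m'\<in>S. q m m' * E m' t)) (at t)"
  proof (rule solve_by_levels[where S = S and \<kappa> = \<kappa> and q = q and C = "\<lambda>m. monomial_eval m c"])
    show "q m m' = 0" if "m \<in> S" "m' \<in> S" "\<kappa> m \<le> \<kappa> m'" for m m'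
      unfolding q_def by (rule \<kappa>[OF keysS keysS]) (use that in auto)
    show "monomial_eval m c \<noteq> 0" if "m \<in> S" for m
      unfolding monomial_eval_def using cS[OF that] by (simp add: power_int_eq_0_iff)
  qed (use fin in blast)+
  have holE: "E m holomorphic_on UNIV" if "m \<in> S" for m
    using E(3)[OF that] by (auto simp: holomorphic_on_def field_differentiable_def intro: has_field_derivative_at_within)
  define h where "h i t = (\<Sum>m\<in>S. Poly_Mapping.lookup (p i) m * E m t)" for i t
  have "h i holomorphic_on UNIV" for i unfolding h_def by (intro holomorphic_intros holE)
  then have "\<exists>H. H 0 = 0 \<and> (\<forall>t. (H has_field_derivative h i t) (at t))" for i
    using entire_primitive by metis
  then obtain H where H: "\<And>i. H i 0 = 0" "\<And>i t. (H i has_field_derivative h i t) (at t)" by metis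
  define f where "f i t = c i * exp (H i t)" for i t
  have df: "(f i has_field_derivative f i t * h i t) (at t)" for i t
    unfolding f_def by (rule derivative_eq_intros H refl | simp)+
  have f0: "f i 0 = c i" for i by (simp add: f_def H)
  have f_nz: "f i t \<noteq> 0 \<longleftrightarrow> c i \<noteq> 0" for i t by (simp add: f_def)
  \<comment> \<open>Since \<open>f\<close> was built from \<open>h\<close>, its monomials satisfy
    linear equations with the known coefficients formed from \<open>E\<close>.\<close>
  have mono_f: "monomial_eval m (\<lambda>i. f i t) = E m t" if m: "m \<in> S" for m t
  proof (rule linear_ode_unique[OF open_UNIV connected_UNIV, where y = "\<lambda>t. monomial_eval m (\<lambda>i. f i t)"
        and w = "E m" and h = "\<lambda>t. \<Sum>m'\<in>S. q m m' * E m' t"])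
    fix s
    show "((\<lambda>t. monomial_eval m (\<lambda>i. f i t)) has_field_derivative
        monomial_eval m (\<lambda>i. f i s) * (\<Sum>m'\<in>S. q m m' * E m' s)) (at s)"
      unfolding q_def
      by (rule monomial_eval_derivative[OF keysS[OF m]]) (use cS[OF m] f_nz df in \<open>auto simp: h_def\<close>)
  qed (use E m f0 in auto)
  have sol: "solves_on n p c UNIV f"
    unfolding solves_on_def
  proof (intro conjI allI impI ballI)
    show "admissible n p (\<lambda>j. f j t)" for t
      using adm f_nz unfolding admissible_def laurent_defined_def by blast
    show "(f i has_field_derivative f i t * laurent_eval (p i) (\<lambda>j. f j t)) (at t)" if "i < n" for i t
    proof -
      have "laurent_eval (p i) (\<lambda>j. f j t) = h i t"
        unfolding h_def using f_nz by (subst eval[OF that]) (auto simp: mono_f)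
      then show ?thesis using df by simp
    qed
  qed (use f0 in auto)
  have uniq: "f i t = z i t" if z: "solves_on n p c V z" and i: "i < n" and t: "t \<in> V" for V z i t
  proof -
    have V: "open V" "connected V" "0 \<in> V" and z0: "\<And>i. i < n \<Longrightarrow> z i 0 = c i"
      and adm_z: "\<And>t. t \<in> V \<Longrightarrow> admissible n p (\<lambda>j. z j t)"
      and dz: "\<And>i t. i < n \<Longrightarrow> t \<in> V \<Longrightarrow> (z i has_field_derivative z i t * laurent_eval (p i) (\<lambda>j. z j t)) (at t)"
      using z by (auto simp: solves_on_def)
    have holz: "z i holomorphic_on V" if "i < n" for i
      using dz[OF that] by (auto simp: holomorphic_on_def field_differentiable_def intro: has_field_derivative_at_within)
    have hol_ev: "(\<lambda>t. laurent_eval (p i) (\<lambda>j. z j t)) holomorphic_on V" if i: "i < n" for i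
      unfolding laurent_eval_def
    proof (intro holomorphic_intros)
      fix m j assume m: "m \<in> Poly_Mapping.keys (p i)" and j: "j \<in> Poly_Mapping.keys m"
      show "z j holomorphic_on V" using p[OF i] m j by (intro holz) (auto simp: laurent_polys_def)
      show "0 \<le> Poly_Mapping.lookup m j \<or> (\<forall>t\<in>V. z j t \<noteq> 0)"
        using adm_z i m j unfolding admissible_def laurent_defined_def by (meson linorder_not_le)
    qed
    \<comment> \<open>Along a given solution each component obeys a linear equation with holomorphic
      coefficient, so it vanishes everywhere on \<open>V\<close> or nowhere.\<close>
    have zero_iff: "z j s = 0 \<longleftrightarrow> c j = 0" if j: "j < n" and s: "s \<in> V" for j s
    proof
      assume "z j s = 0"
      then have "z j 0 = 0"
        using linear_ode_zero[OF V(1,2) s V(3) hol_ev[OF j] dz[OF j]] by blast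
      then show "c j = 0" using z0[OF j] by simp
    next
      assume "c j = 0"
      then show "z j s = 0"
        using linear_ode_zero[OF V(1,2,3) s hol_ev[OF j] dz[OF j]] z0[OF j] by simp
    qed
    have dz': "(z j has_field_derivative z j s *
        (\<Sum>m\<in>S. Poly_Mapping.lookup (p j) m * monomial_eval m (\<lambda>j. z j s))) (at s)" if "j < n" "s \<in> V" for j s
      using dz[OF that] eval[OF that(1), of "\<lambda>j. z j s"] zero_iff that(2) by simp
    \<comment> \<open>For an arbitrary solution the equation of a monomial contains other monomials
      of \<open>z\<close>: those of lower level are known by induction, the others carry the
      coefficient 0.\<close>
    have mono_z: "\<forall>s\<in>V. monomial_eval m (\<lambda>i. z i s) = E m s" if "m \<in> S" for m
      using that
    proof (induction "\<kappa> m" arbitrary: m rule: less_induct)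
      case less
      have "monomial_eval m (\<lambda>i. z i s) = E m s" if "s \<in> V" for s
      proof (rule linear_ode_unique[OF V that, where y = "\<lambda>t. monomial_eval m (\<lambda>i. z i t)"
            and w = "E m" and h = "\<lambda>t. \<Sum>m'\<in>S. q m m' * E m' t"])
        fix s assume s: "s \<in> V"
        have "((\<lambda>t. monomial_eval m (\<lambda>i. z i t)) has_field_derivative
            monomial_eval m (\<lambda>i. z i s) * (\<Sum>m'\<in>S. q m m' * monomial_eval m' (\<lambda>i. z i s))) (at s)"
          unfolding q_def
          by (rule monomial_eval_derivative[OF keysS[OF less.prems]])
            (use cS[OF less.prems] keysS[OF less.prems] zero_iff s dz' in \<open>auto simp: subset_iff\<close>)
        also have "(\<Sum>m'\<in>S. q m m' * monomial_eval m' (\<lambda>i. z i s)) = (\<Sum>m'\<in>S. q m m' * E m' s)"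
        proof (intro sum.cong refl)
          fix m' assume m': "m' \<in> S"
          show "q m m' * monomial_eval m' (\<lambda>i. z i s) = q m m' * E m' s"
          proof (cases "\<kappa> m' < \<kappa> m")
            case True
            then show ?thesis using less.hyps[OF True m'] s by simp
          next
            case False
            then have "q m m' = 0" unfolding q_def using less.prems m' by (intro \<kappa> keysS) auto
            then show ?thesis by simp
          qed
        qed
        finally show "((\<lambda>t. monomial_eval m (\<lambda>i. z i t)) has_field_derivative
            monomial_eval m (\<lambda>i. z i s) * (\<Sum>m'\<in>S. q m m' * E m' s)) (at s)" .
      next
        have "monomial_eval m (\<lambda>i. z i 0) = monomial_eval m c"
          unfolding monomial_eval_def using keysS[OF less.prems] z0 by (intro prod.cong) auto
        then show "monomial_eval m (\<lambda>i. z i 0) = E m 0" using E(1)[OF less.prems] by simp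
      qed (use E less.prems in auto)
      then show ?case by blast
    qed
    show ?thesis
    proof (cases "c i = 0")
      case True
      then show ?thesis using zero_iff[OF i t] f_nz by metis
    next
      case False
      have "z i t = f i t"
      proof (rule linear_ode_unique[OF V t, where h = "h i"])
        show "(z i has_field_derivative z i s * h i s) (at s)" if "s \<in> V" for s
          using dz'[OF i that] mono_z that by (simp add: h_def)
      qed (use df f_nz False z0[OF i] f0 in auto)
      then show ?thesis by simp
    qed
  qed
  show thesis
  proof (rule that[of f])
    show "solves_on n p c UNIV f" by (rule sol)
    show "f i t = z i t" if "solves_on n p c V z" "i < n" "t \<in> V" for V z i t
      using that by (rule uniq)
    show "f i holomorphic_on UNIV" for i
      using df by (auto simp: holomorphic_on_def field_differentiable_def intro: has_field_derivative_at_within)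
    show "(\<forall>t. f i t \<noteq> 0) \<or> (\<forall>t. f i t = 0)" for i using f_nz by blast
  qed
qed

theorem theorem2:
  fixes n :: nat and p :: "nat \<Rightarrow> laurent"
  assumes "n \<ge> 1"
    and "\<forall>i<n. p i \<in> laurent_polys n"
  shows
    "((\<exists>U. openin (product_topology (\<lambda>_. euclidean :: complex topology) {..<n}) U \<and> U \<noteq> {} \<and>
         (\<forall>c\<in>U. admissible n p c \<longrightarrow>
            (\<exists>V z. solves_on n p c V z \<and>
               (\<forall>i<n. \<exists>f. entire_extension V (z i) f \<and> unit_function f))))
       \<longrightarrow> triangular_form n p)
     \<and>
     (triangular_form n p \<longrightarrow>
       (\<forall>c. admissible n p c \<longrightarrow>
         (\<exists>z. solves_on n p c UNIV z) \<and>
         (\<forall>V z. solves_on n p c V z \<longrightarrow>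
            (\<forall>i<n. \<exists>f. entire_extension V (z i) f \<and> (unit_function f \<or> (\<forall>t. f t = 0))))))"
proof (intro conjI impI allI)
  assume "\<exists>U. openin (product_topology (\<lambda>_. euclidean :: complex topology) {..<n}) U \<and> U \<noteq> {} \<and>
         (\<forall>c\<in>U. admissible n p c \<longrightarrow>
            (\<exists>V z. solves_on n p c V z \<and>
               (\<forall>i<n. \<exists>f. entire_extension V (z i) f \<and> unit_function f)))"
  then obtain U where U: "openin (product_topology (\<lambda>_. euclidean :: complex topology) {..<n}) U" "U \<noteq> {}"
    and units: "\<And>c. c \<in> U \<Longrightarrow> admissible n p c \<Longrightarrow>
      \<exists>V z. solves_on n p c V z \<and> (\<forall>i<n. \<exists>f. entire_extension V (z i) f \<and> unit_function f)" by blast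
  obtain \<gamma>0 \<epsilon> where "0 < \<epsilon>" "log_entire n p \<gamma>0 \<epsilon>"
    using log_entire_of_units[OF _ U units] assms(2) by blast
  then obtain u \<theta> a e where "triangular_data n p u \<theta> a e"
    using exists_triangular_data[OF assms(1), of p] assms(2) by blast
  then show "triangular_form n p" by (rule triangular_form_of_data[OF assms(1)])
next
  fix c assume form: "triangular_form n p" and adm: "admissible n p c"
  show "\<exists>z. solves_on n p c UNIV z"
    by (rule entire_solutions_of_triangular_form[OF assms(1) _ form adm]) (use assms(2) in blast)+
next
  fix c V z i
  assume form: "triangular_form n p" and adm: "admissible n p c" and z: "solves_on n p c V z" "i < n"
  show "\<exists>f. entire_extension V (z i) f \<and> (unit_function f \<or> (\<forall>t. f t = 0))"
  proof (rule entire_solutions_of_triangular_form[OF assms(1) _ form adm])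
    fix f
    assume hol: "\<And>i. i < n \<Longrightarrow> f i holomorphic_on UNIV"
      and nz: "\<And>i. i < n \<Longrightarrow> (\<forall>t. f i t \<noteq> 0) \<or> (\<forall>t. f i t = 0)"
      and eq: "\<And>V z i t. solves_on n p c V z \<Longrightarrow> i < n \<Longrightarrow> t \<in> V \<Longrightarrow> f i t = z i t"
    show ?thesis
      using hol[OF z(2)] nz[OF z(2)] eq[OF z]
      by (intro exI[of _ "f i"]) (auto simp: entire_extension_def unit_function_def)
  qed (use assms(2) in blast)
qed

end
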